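(* Let $E$ be a nonzero complex Banach space and let $K\subset E$ be a compact set. Fix a product and an equivalent norm on $E$ making it a commutative unital Banach algebra, as described in the context. The following statements are equivalent. (i) $\mathbb{P}(K,A)=\mathcal{P}_N(K)\hat\otimes_\epsilon A$ for every commutative unital complex Banach algebra $A$. (ii) $\mathbb{P}(K,E)=\mathcal{P}_N(K)\hat\otimes_\epsilon E$. (iii) $I\in\mathcal{P}_N(K)\hat\otimes_\epsilon E$, where $I:E\to E$ is the identity operator (regarded, by restriction to $K$, as an element of $\mathcal{C}(K,E)$).
   Context: $\mathcal{L}(E,A)$ is the space of bounded linear operators $E\to A$. For a Banach space $F$, $\mathcal{C}(K,F)$ is the space of continuous functions $f:K\to F$ with norm $\|f\|_K=\sup_{x\in K}\|f(x)\|$, and $\mathcal{C}(K)=\mathcal{C}(K,\mathbb{C})$. Let $A$ be a commutative unital complex Banach algebra. For $n\ge 1$, $\mathbb{P}({}^nE,A)$ is the space of maps $P:E\to A$ of the form $P(x)=\sum_{i=1}^\infty T_i(x)^n$ with $T_i\in\mathcal{L}(E,A)$ and $\sum_{i=1}^\infty\|T_i\|^n<\infty$ (powers taken in $A$); $\mathbb{P}({}^0E,A)$ is the space of constant maps. $\mathbb{P}(E,A)$ is the space of all finite sums $P_0+P_1+\dots+P_n$ with $P_k\in\mathbb{P}({}^kE,A)$, $n\in\mathbb{N}$. $\mathbb{P}(K,A)$ is the closure in $\mathcal{C}(K,A)$ of $\{P|_K:P\in\mathbb{P}(E,A)\}$. Nuclear scalar polynomials: $\mathcal{P}_N(E)=\mathbb{P}(E,\mathbb{C})$,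 and $\mathcal{P}_N(K)$ is the closure in $\mathcal{C}(K)$ of $\{P|_K:P\in\mathcal{P}_N(E)\}$. For a Banach space $F$, the injective tensor product $\mathcal{P}_N(K)\hat\otimes_\epsilon F$ is identified isometrically, via $f\otimes a\mapsto (x\mapsto f(x)a)$, with the closed subspace of $\mathcal{C}(K,F)$ that is the closure of $\{\sum_{i=1}^n f_i a_i: f_i\in\mathcal{P}_N(K),\ a_i\in F,\ n\in\mathbb{N}\}$, where $(f_ia_i)(x)=f_i(x)a_i$. The equalities in (i) and (ii) and the membership in (iii) are understood inside $\mathcal{C}(K,A)$ and $\mathcal{C}(K,E)$ under this identification. Algebra structure on $E$: choose $\psi\in E^*$ and $e\in E$ with $\|e\|=1$ and $\psi(e)=1$, so $E=\ker\psi\oplus\mathbb{C}e$. For $a=x+\psi(a)e$ and $b=y+\psi(b)e$ with $x,y\in\ker\psi$, put $ab=\psi(b)x+\psi(a)y+\psi(a)\psi(b)e$ and $\|a\|_1=|\psi(a)|+\|x\|$. Then $\|\cdot\|_1$ is an equivalent norm on $E$ making it a commutative unital Banach algebra with identity $e$; in (ii), $\mathbb{P}(K,E)$ is formed with respect to this algebra structure. *)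

theory Defs
  imports "HOL-Analysis.Analysis" "HOL-Algebra.Module" "HOL-Algebra.Algebraic_Closure_Type"
begin

text \<open>
  Banach spaces and Banach algebras are records with an explicit carrier, extending the modules
  and algebras of HOL-Algebra by a norm, so that a formula can quantify over all Banach algebras
  (with carrier in a given type). As in HOL-Algebra, the fields \<open>mult\<close> and \<open>one\<close> are irrelevant
  when a record is only used as a module.
\<close>

record ('a, 'b) normed_module = "('a, 'b) module" +
  vnorm :: "'b \<Rightarrow> real"

abbreviation complex_ring :: "complex ring"
  where "complex_ring \<equiv> ring_of_type_algebra"

text \<open>
  Nonnegativity and symmetry in \<^locale>\<open>Metric_space\<close> are required also outside the space, hence
  the totalisation by 0.
\<close>

definition norm_metric :: "('a, 'b, 'm) normed_module_scheme \<Rightarrow> 'b metric"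
  where "norm_metric V = metric (carrier V,
    \<lambda>x y. if x \<in> carrier V \<and> y \<in> carrier V then vnorm V (x \<ominus>\<^bsub>V\<^esub> y) else 0)"

abbreviation norm_topology :: "('a, 'b, 'm) normed_module_scheme \<Rightarrow> 'b topology"
  where "norm_topology V \<equiv> mtopology_of (norm_metric V)"

locale complex_banach_space = module complex_ring V
  for V :: "(complex, 'b, 'm) normed_module_scheme" (structure) +
  assumes vnorm_eq_zero: "x \<in> carrier V \<Longrightarrow> vnorm V x = 0 \<longleftrightarrow> x = \<zero>"
    and vnorm_triangle:
      "\<lbrakk>x \<in> carrier V; y \<in> carrier V\<rbrakk> \<Longrightarrow> vnorm V (x \<oplus> y) \<le> vnorm V x + vnorm V y"
    and vnorm_smult: "x \<in> carrier V \<Longrightarrow> vnorm V (c \<odot> x) = cmod c * vnorm V x"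
    and complete: "mcomplete_of (norm_metric V)"

text \<open>HOL-Algebra's \<^locale>\<open>algebra\<close> is a commutative unital algebra.\<close>

locale comm_unital_banach_algebra =
  complex_banach_space A + algebra complex_ring A
  for A :: "(complex, 'b, 'm) normed_module_scheme" (structure) +
  assumes vnorm_mult:
      "\<lbrakk>x \<in> carrier A; y \<in> carrier A\<rbrakk> \<Longrightarrow> vnorm A (x \<otimes> y) \<le> vnorm A x * vnorm A y"
    and vnorm_one: "vnorm A \<one> = 1"

definition complex_alg :: "(complex, complex) normed_module"
  where "complex_alg =
    \<lparr>carrier = UNIV, mult = (*), one = 1, zero = 0, add = (+), smult = (*), vnorm = cmod\<rparr>"

definition bounded_operators ::
    "(complex, 'a, 'm) normed_module_scheme \<Rightarrow> (complex, 'b, 'n) normed_module_scheme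
      \<Rightarrow> ('a \<Rightarrow> 'b) set"
  where "bounded_operators V W =
    {T. T \<in> carrier V \<rightarrow> carrier W
      \<and> (\<forall>x\<in>carrier V. \<forall>y\<in>carrier V. T (x \<oplus>\<^bsub>V\<^esub> y) = T x \<oplus>\<^bsub>W\<^esub> T y)
      \<and> (\<forall>c. \<forall>x\<in>carrier V. T (c \<odot>\<^bsub>V\<^esub> x) = c \<odot>\<^bsub>W\<^esub> T x)
      \<and> (\<exists>C. \<forall>x\<in>carrier V. vnorm W (T x) \<le> C * vnorm V x)}"

definition operator_norm ::
    "(complex, 'a, 'm) normed_module_scheme \<Rightarrow> (complex, 'b, 'n) normed_module_scheme
      \<Rightarrow> ('a \<Rightarrow> 'b) \<Rightarrow> real"
  where "operator_norm V W T = (SUP x\<in>{x \<in> carrier V. vnorm V x \<le> 1}. vnorm W (T x))"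

text \<open>
  Functions on a carrier or on \<open>K\<close> are taken \<^const>\<open>extensional\<close>, i.e. \<^const>\<open>undefined\<close> outside.
\<close>

definition homogeneous_polys ::
    "nat \<Rightarrow> (complex, 'a, 'm) normed_module_scheme \<Rightarrow> (complex, 'b, 'n) normed_module_scheme
      \<Rightarrow> ('a \<Rightarrow> 'b) set"
  where "homogeneous_polys n E A =
    (if n = 0 then {\<lambda>x\<in>carrier E. a | a. a \<in> carrier A}
     else {P \<in> carrier E \<rightarrow>\<^sub>E carrier A.
       \<exists>T :: nat \<Rightarrow> 'a \<Rightarrow> 'b. (\<forall>i. T i \<in> bounded_operators E A)
         \<and> summable (\<lambda>i. operator_norm E A (T i) ^ n)
         \<and> (\<forall>x\<in>carrier E.
              limitin (norm_topology A) (\<lambda>N. \<Oplus>\<^bsub>A\<^esub>i\<in>{..<N}. T i x [^]\<^bsub>A\<^esub> n) (P x) sequentially)})"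

definition polys ::
    "(complex, 'a, 'm) normed_module_scheme \<Rightarrow> (complex, 'b, 'n) normed_module_scheme
      \<Rightarrow> ('a \<Rightarrow> 'b) set"
  where "polys E A =
    {\<lambda>x\<in>carrier E. \<Oplus>\<^bsub>A\<^esub>k\<in>{..n}. P k x | n P. \<forall>k\<le>n. P k \<in> homogeneous_polys k E A}"

text \<open>
  The continuous functions from a compact \<open>K \<subseteq> carrier E\<close> to \<open>F\<close> with the supremum metric
  (the boundedness built into \<^const>\<open>cfunspace\<close> is then automatic).
\<close>

definition continuous_functions ::
    "(complex, 'a, 'm) normed_module_scheme \<Rightarrow> 'a set \<Rightarrow> (complex, 'b, 'n) normed_module_scheme
      \<Rightarrow> ('a \<Rightarrow> 'b) metric"
  where "continuous_functions E K F = cfunspace (subtopology (norm_topology E) K) (norm_metric F)"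

definition closed_polys ::
    "(complex, 'a, 'm) normed_module_scheme \<Rightarrow> 'a set \<Rightarrow> (complex, 'b, 'n) normed_module_scheme
      \<Rightarrow> ('a \<Rightarrow> 'b) set"
  where "closed_polys E K A =
    mtopology_of (continuous_functions E K A) closure_of ((\<lambda>P. restrict P K) ` polys E A)"

abbreviation nuclear_closed_polys ::
    "(complex, 'a, 'm) normed_module_scheme \<Rightarrow> 'a set \<Rightarrow> ('a \<Rightarrow> complex) set"
  where "nuclear_closed_polys E K \<equiv> closed_polys E K complex_alg"

text \<open>
  The injective tensor product of \<^const>\<open>nuclear_closed_polys\<close> with \<open>F\<close>, as a closed subspace of
  the continuous functions from \<open>K\<close> to \<open>F\<close>.
\<close>

definition nuclear_tensor ::
    "(complex, 'a, 'm) normed_module_scheme \<Rightarrow> 'a set \<Rightarrow> (complex, 'b, 'n) normed_module_scheme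
      \<Rightarrow> ('a \<Rightarrow> 'b) set"
  where "nuclear_tensor E K F =
    mtopology_of (continuous_functions E K F) closure_of
      {\<lambda>x\<in>K. \<Oplus>\<^bsub>F\<^esub>i\<in>{..<n}. f i x \<odot>\<^bsub>F\<^esub> a i | (n :: nat) f a.
        \<forall>i<n. f i \<in> nuclear_closed_polys E K \<and> a i \<in> carrier F}"

definition kernel_part ::
    "(complex, 'a, 'm) normed_module_scheme \<Rightarrow> ('a \<Rightarrow> complex) \<Rightarrow> 'a \<Rightarrow> 'a \<Rightarrow> 'a"
  where "kernel_part E \<psi> e a = a \<ominus>\<^bsub>E\<^esub> \<psi> a \<odot>\<^bsub>E\<^esub> e"

text \<open>
  \<open>E\<close> as a Banach algebra with identity \<open>e\<close> and square-zero ideal \<open>ker \<psi>\<close>, where \<open>\<psi> e = 1\<close>;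
  the decomposition is \<open>a = kernel_part E \<psi> e a + \<psi> a e\<close>.
\<close>

definition banach_algebra_on ::
    "(complex, 'a) normed_module \<Rightarrow> ('a \<Rightarrow> complex) \<Rightarrow> 'a \<Rightarrow> (complex, 'a) normed_module"
  where "banach_algebra_on E \<psi> e = E\<lparr>
    mult := (\<lambda>a b. \<psi> b \<odot>\<^bsub>E\<^esub> kernel_part E \<psi> e a \<oplus>\<^bsub>E\<^esub> \<psi> a \<odot>\<^bsub>E\<^esub> kernel_part E \<psi> e b
      \<oplus>\<^bsub>E\<^esub> (\<psi> a * \<psi> b) \<odot>\<^bsub>E\<^esub> e),
    one := e,
    vnorm := (\<lambda>a. cmod (\<psi> a) + vnorm E (kernel_part E \<psi> e a))\<rparr>"

end

theory Submission
  imports Defs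
begin

text \<open>
  On the compact set \<open>K\<close> every series of powers converges uniformly, so \<open>P(K, A)\<close> is the uniform
  closure of the span of the constants and the powers \<open>T ^ n\<close> of operators, and the tensor product
  with \<open>F\<close> is the uniform closure of the span of the functions \<open>\<phi> ^ n \<odot> a\<close> with \<open>\<phi>\<close> a functional
  and \<open>a \<in> F\<close>. Polarization shows that for \<open>n > 0\<close> every \<open>a\<close> in a unital algebra is a linear combination
  of powers \<open>(1 + t a) ^ n\<close>, so the tensor product is always contained in \<open>P(K, A)\<close>; applied to
  \<open>(\<phi> + t \<psi>) ^ (n + m)\<close>, it shows that the tensor product with an algebra is closed under products.
  Hence if the identity of \<open>E\<close> lies in the tensor product with \<open>E\<close>, composition with an operator \<open>T\<close>
  gives \<open>T\<close> and then \<open>T ^ n\<close> in the tensor product with \<open>A\<close>. Conversely, the identity is an operator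
  from \<open>E\<close> into the algebra built on \<open>E\<close>, hence one of its polynomials.
\<close>

section \<open>Complex normed spaces\<close>

text \<open>The closures in the definitions live in a metric space of bounded continuous functions
  and are awkward to work with. Every generator, however, is bounded and Lipschitz on
  \<open>K\<close>, and a uniform limit of such functions lies in that space automatically. Hence
  each closure can be described by inequalities with \<epsilon>, without mention of continuity.
  Compactness supplies a radius \<open>R\<close> for \<open>K\<close>, and the numbers ||T_i||^n R^n
  then dominate a series of degree n.

  Polarization uses no roots of unity: if the values at all complex t of a polynomial in t lie in a
  linear space of functions, then so do its coefficients, as a comparison of t with 2 t shows. In (1
  + t a)^n the coefficient of t is n a, which is where the unit enters and why n must be positive;
  in (\<phi> + t \<psi>)^(n + m) the coefficient of t^m is a nonzero multiple of \<phi>^n \<psi>^m.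

  For the algebra on \<open>E\<close> the decisive fact is that its norm is equivalent to the given
  one. The identity is then an operator into it, and the tensor products formed with the two norms
  are the same set of functions.\<close>

lemma complex_ring_simps [simp]:
  "carrier complex_ring = UNIV" "\<zero>\<^bsub>complex_ring\<^esub> = 0"
  "(\<oplus>\<^bsub>complex_ring\<^esub>) = (+)" "(\<otimes>\<^bsub>complex_ring\<^esub>) = (*)"
  by (simp_all add: ring_of_type_algebra_def)

lemma complex_ring_one: "\<one>\<^bsub>complex_ring\<^esub> = 1"
  by (simp add: ring_of_type_algebra_def)

text \<open>
  Completeness is left out: for a new norm it is obtained by transfer along bounded operators,
  which already relies on the facts below.
\<close>

locale complex_normed_space = module complex_ring V
  for V :: "(complex, 'b, 'm) normed_module_scheme" (structure) +
  assumes vnorm_eq_zero: "x \<in> carrier V \<Longrightarrow> vnorm V x = 0 \<longleftrightarrow> x = \<zero>"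
    and vnorm_triangle:
      "\<lbrakk>x \<in> carrier V; y \<in> carrier V\<rbrakk> \<Longrightarrow> vnorm V (x \<oplus> y) \<le> vnorm V x + vnorm V y"
    and vnorm_smult: "x \<in> carrier V \<Longrightarrow> vnorm V (c \<odot> x) = cmod c * vnorm V x"

sublocale complex_banach_space \<subseteq> complex_normed_space
  by unfold_locales (simp_all add: vnorm_eq_zero vnorm_triangle vnorm_smult)

context complex_normed_space
begin

lemma smult_closed' [simp, intro]: "x \<in> carrier V \<Longrightarrow> c \<odot> x \<in> carrier V"
  by simp

lemma smult_add_left: "x \<in> carrier V \<Longrightarrow> (a + b) \<odot> x = a \<odot> x \<oplus> b \<odot> x"
  using smult_l_distr[of a b x] by simp

lemma smult_add_right:
  "\<lbrakk>x \<in> carrier V; y \<in> carrier V\<rbrakk> \<Longrightarrow> a \<odot> (x \<oplus> y) = a \<odot> x \<oplus> a \<odot> y"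
  using smult_r_distr[of a x y] by simp

lemma smult_smult: "x \<in> carrier V \<Longrightarrow> a \<odot> (b \<odot> x) = (a * b) \<odot> x"
  using smult_assoc1[of a b x] by simp

lemma smult_1 [simp]: "x \<in> carrier V \<Longrightarrow> 1 \<odot> x = x"
  using smult_one[of x] by (simp add: complex_ring_one)

lemma smult_0_left [simp]: "x \<in> carrier V \<Longrightarrow> 0 \<odot> x = \<zero>"
  using smult_l_null[of x] by simp

lemma smult_minus1: "x \<in> carrier V \<Longrightarrow> (- 1) \<odot> x = \<ominus> x"
  using smult_add_left[of x "- 1" 1]
  by (metis M.add.inv_equality add.commute add.right_inverse smult_0_left smult_1 smult_closed')

lemma finsum_smult:
  "\<lbrakk>finite I; f \<in> I \<rightarrow> carrier V\<rbrakk> \<Longrightarrow> c \<odot> finsum V f I = (\<Oplus>i\<in>I. c \<odot> f i)"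
  using finsum_smult_ldistr[of I c f] by simp

lemma vnorm_zero [simp]: "vnorm V \<zero> = 0"
  by (simp add: vnorm_eq_zero)

lemma vnorm_minus [simp]: "x \<in> carrier V \<Longrightarrow> vnorm V (\<ominus> x) = vnorm V x"
  by (simp add: vnorm_smult flip: smult_minus1)

lemma vnorm_nonneg [simp]: "x \<in> carrier V \<Longrightarrow> 0 \<le> vnorm V x"
  using vnorm_triangle[of x "\<ominus> x"] by (simp add: M.r_neg)

lemma vnorm_diff_triangle:
  "\<lbrakk>x \<in> carrier V; y \<in> carrier V\<rbrakk> \<Longrightarrow> vnorm V (x \<ominus> y) \<le> vnorm V x + vnorm V y"
  using vnorm_triangle[of x "\<ominus> y"] by (simp add: a_minus_def)

lemma minus_minus_diff: "\<lbrakk>x \<in> carrier V; y \<in> carrier V\<rbrakk> \<Longrightarrow> \<ominus> (x \<ominus> y) = y \<ominus> x"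
  by (simp add: a_minus_def M.minus_add M.a_comm)

lemma vnorm_diff_commute:
  "\<lbrakk>x \<in> carrier V; y \<in> carrier V\<rbrakk> \<Longrightarrow> vnorm V (x \<ominus> y) = vnorm V (y \<ominus> x)"
  by (metis M.minus_closed minus_minus_diff vnorm_minus)

lemma diff_add_diff:
  "\<lbrakk>x \<in> carrier V; y \<in> carrier V; z \<in> carrier V\<rbrakk> \<Longrightarrow> (x \<ominus> y) \<oplus> (y \<ominus> z) = x \<ominus> z"
  by (simp add: a_minus_def M.a_assoc) (metis M.a_assoc M.add.inv_closed M.l_neg M.l_zero)

lemma add_diff_add:
  "\<lbrakk>x \<in> carrier V; y \<in> carrier V; z \<in> carrier V; w \<in> carrier V\<rbrakk>
    \<Longrightarrow> (x \<oplus> y) \<ominus> (z \<oplus> w) = (x \<ominus> z) \<oplus> (y \<ominus> w)"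
  by (simp add: a_minus_def M.minus_add M.a_ac)

lemma minus_add_cancel: "\<lbrakk>x \<in> carrier V; y \<in> carrier V\<rbrakk> \<Longrightarrow> (x \<ominus> y) \<oplus> y = x"
  by (simp add: a_minus_def M.a_assoc M.l_neg)

lemma add_diff_cancel_left:
  "\<lbrakk>x \<in> carrier V; y \<in> carrier V\<rbrakk> \<Longrightarrow> (x \<oplus> y) \<ominus> x = y"
  by (simp add: a_minus_def M.a_assoc M.a_lcomm[of x y] M.r_neg)

lemma smult_diff_left: "x \<in> carrier V \<Longrightarrow> a \<odot> x \<ominus> b \<odot> x = (a - b) \<odot> x"
  using smult_add_left[of x "a - b" b]
  by (metis M.a_comm add_diff_cancel_left smult_closed' diff_add_cancel)

lemma diff_self [simp]: "x \<in> carrier V \<Longrightarrow> x \<ominus> x = \<zero>"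
  by (simp add: a_minus_def M.r_neg)

lemma diff_eq_zero_iff: "\<lbrakk>x \<in> carrier V; y \<in> carrier V\<rbrakk> \<Longrightarrow> x \<ominus> y = \<zero> \<longleftrightarrow> x = y"
  by (metis M.l_zero minus_add_cancel diff_self)

lemma vnorm_dist_triangle:
  "\<lbrakk>x \<in> carrier V; y \<in> carrier V; z \<in> carrier V\<rbrakk>
    \<Longrightarrow> vnorm V (x \<ominus> z) \<le> vnorm V (x \<ominus> y) + vnorm V (y \<ominus> z)"
  using vnorm_triangle[of "x \<ominus> y" "y \<ominus> z"] by (simp add: diff_add_diff)

lemma vnorm_add_dist:
  "\<lbrakk>x \<in> carrier V; y \<in> carrier V; z \<in> carrier V; w \<in> carrier V\<rbrakk>
    \<Longrightarrow> vnorm V ((x \<oplus> y) \<ominus> (z \<oplus> w)) \<le> vnorm V (x \<ominus> z) + vnorm V (y \<ominus> w)"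
  using vnorm_triangle[of "x \<ominus> z" "y \<ominus> w"] by (simp add: add_diff_add)

lemma vnorm_le_dist_add:
  "\<lbrakk>x \<in> carrier V; y \<in> carrier V\<rbrakk> \<Longrightarrow> vnorm V x \<le> vnorm V (x \<ominus> y) + vnorm V y"
  using vnorm_triangle[of "x \<ominus> y" y] by (simp add: minus_add_cancel)

lemma finsum_lessThan_Suc:
  "f \<in> {..<Suc n} \<rightarrow> carrier V \<Longrightarrow> finsum V f {..<Suc n} = f n \<oplus> finsum V f {..<n}" for n :: nat
  by (simp add: lessThan_Suc Pi_iff)

text \<open>Serves where a term stands in front of a sum: at the head of a series of powers, and at
  index 0 in the binomial theorem.\<close>

lemma finsum_lessThan_Suc_shift:
  "f \<in> {..<Suc n} \<rightarrow> carrier V \<Longrightarrow> finsum V f {..<Suc n} = f 0 \<oplus> (\<Oplus>i\<in>{..<n}. f (Suc i))"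
  for n :: nat
proof (induction n)
  case (Suc n)
  have "finsum V f {..<Suc (Suc n)} = f (Suc n) \<oplus> finsum V f {..<Suc n}"
    using Suc.prems by (rule finsum_lessThan_Suc)
  with Suc show ?case
    by (simp add: finsum_lessThan_Suc Pi_iff M.a_lcomm)
qed (simp add: lessThan_Suc)

section \<open>The metric and the convergence given by a norm\<close>

lemma Metric_space_vnorm:
  "Metric_space (carrier V)
    (\<lambda>x y. if x \<in> carrier V \<and> y \<in> carrier V then vnorm V (x \<ominus> y) else 0)"
proof
  fix x y z
  assume "x \<in> carrier V" "y \<in> carrier V" "z \<in> carrier V"
  then show "(if x \<in> carrier V \<and> z \<in> carrier V then vnorm V (x \<ominus> z) else 0)
    \<le> (if x \<in> carrier V \<and> y \<in> carrier V then vnorm V (x \<ominus> y) else 0) +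
      (if y \<in> carrier V \<and> z \<in> carrier V then vnorm V (y \<ominus> z) else 0)"
    by (simp add: vnorm_dist_triangle)
qed (auto simp: vnorm_diff_commute vnorm_eq_zero diff_eq_zero_iff)

lemma mspace_norm_metric [simp]: "mspace (norm_metric V) = carrier V"
  unfolding norm_metric_def by (rule Metric_space.mspace_metric[OF Metric_space_vnorm])

lemma mdist_norm_metric:
  "\<lbrakk>x \<in> carrier V; y \<in> carrier V\<rbrakk> \<Longrightarrow> mdist (norm_metric V) x y = vnorm V (x \<ominus> y)"
  unfolding norm_metric_def Metric_space.mdist_metric[OF Metric_space_vnorm] by simp

lemma limitin_norm_topology:
  assumes "\<And>n. s n \<in> carrier V"
  shows "limitin (norm_topology V) s l sequentially
    \<longleftrightarrow> l \<in> carrier V \<and> (\<forall>\<epsilon>>0. \<exists>N. \<forall>n\<ge>N. vnorm V (s n \<ominus> l) < \<epsilon>)"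
proof -
  have "limitin (norm_topology V) s l sequentially
    \<longleftrightarrow> l \<in> carrier V \<and> (\<forall>\<epsilon>>0. \<exists>N. \<forall>n\<ge>N. s n \<in> carrier V \<and> mdist (norm_metric V) (s n) l < \<epsilon>)"
    using Metric_space.limit_metric_sequentially[OF Metric_space_mspace_mdist, of "norm_metric V" s l]
    by (simp add: mtopology_of_def)
  then show ?thesis
    using assms by (auto simp: mdist_norm_metric)
qed

end

section \<open>Bounded operators and the operator norm\<close>

lemma bounded_operatorsI:
  assumes "\<And>x. x \<in> carrier V \<Longrightarrow> T x \<in> carrier W"
    and "\<And>x y. \<lbrakk>x \<in> carrier V; y \<in> carrier V\<rbrakk> \<Longrightarrow> T (x \<oplus>\<^bsub>V\<^esub> y) = T x \<oplus>\<^bsub>W\<^esub> T y"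
    and "\<And>c x. x \<in> carrier V \<Longrightarrow> T (c \<odot>\<^bsub>V\<^esub> x) = c \<odot>\<^bsub>W\<^esub> T x"
    and "\<And>x. x \<in> carrier V \<Longrightarrow> vnorm W (T x) \<le> C * vnorm V x"
  shows "T \<in> bounded_operators V W"
  using assms unfolding bounded_operators_def by blast

lemma bounded_operators_closed:
  "\<lbrakk>T \<in> bounded_operators V W; x \<in> carrier V\<rbrakk> \<Longrightarrow> T x \<in> carrier W"
  by (auto simp: bounded_operators_def)

lemma bounded_operators_add:
  "\<lbrakk>T \<in> bounded_operators V W; x \<in> carrier V; y \<in> carrier V\<rbrakk>
    \<Longrightarrow> T (x \<oplus>\<^bsub>V\<^esub> y) = T x \<oplus>\<^bsub>W\<^esub> T y"
  by (auto simp: bounded_operators_def)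

lemma bounded_operators_smult:
  "\<lbrakk>T \<in> bounded_operators V W; x \<in> carrier V\<rbrakk> \<Longrightarrow> T (c \<odot>\<^bsub>V\<^esub> x) = c \<odot>\<^bsub>W\<^esub> T x"
  by (auto simp: bounded_operators_def)

lemma bounded_operators_zero:
  assumes "complex_normed_space V" "complex_normed_space W" "T \<in> bounded_operators V W"
  shows "T \<zero>\<^bsub>V\<^esub> = \<zero>\<^bsub>W\<^esub>"
proof -
  interpret V: complex_normed_space V by fact
  interpret W: complex_normed_space W by fact
  show ?thesis
    using bounded_operators_smult[OF assms(3), of "\<zero>\<^bsub>V\<^esub>" 0]
      bounded_operators_closed[OF assms(3)] by simp
qed

lemma bounded_operators_diff:
  assumes "complex_normed_space V" "complex_normed_space W" "T \<in> bounded_operators V W"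
    and "x \<in> carrier V" "y \<in> carrier V"
  shows "T (x \<ominus>\<^bsub>V\<^esub> y) = T x \<ominus>\<^bsub>W\<^esub> T y"
proof -
  interpret V: complex_normed_space V by fact
  interpret W: complex_normed_space W by fact
  note [simp] = bounded_operators_closed[OF assms(3)]
  have "T (x \<ominus>\<^bsub>V\<^esub> y) = T (x \<oplus>\<^bsub>V\<^esub> (- 1) \<odot>\<^bsub>V\<^esub> y)"
    using assms by (simp add: V.smult_minus1 a_minus_def)
  also have "\<dots> = T x \<oplus>\<^bsub>W\<^esub> (- 1) \<odot>\<^bsub>W\<^esub> T y"
    using assms by (simp add: bounded_operators_add bounded_operators_smult)
  finally show ?thesis
    using assms by (simp add: W.smult_minus1 a_minus_def)
qed

text \<open>The constant is made strictly positive because the estimates with \<epsilon> divide by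
  it.\<close>

lemma bounded_operators_bound:
  assumes "complex_normed_space V" "T \<in> bounded_operators V W"
  obtains C where "C > 0" "\<And>x. x \<in> carrier V \<Longrightarrow> vnorm W (T x) \<le> C * vnorm V x"
proof -
  interpret V: complex_normed_space V by fact
  obtain C where C: "\<forall>x\<in>carrier V. vnorm W (T x) \<le> C * vnorm V x"
    using assms(2) unfolding bounded_operators_def by blast
  have "vnorm W (T x) \<le> (\<bar>C\<bar> + 1) * vnorm V x" if "x \<in> carrier V" for x
  proof -
    have "C * vnorm V x \<le> (\<bar>C\<bar> + 1) * vnorm V x"
      using that by (intro mult_right_mono) auto
    then show ?thesis
      using C that by fastforce
  qed
  then show thesis
    by (intro that[of "\<bar>C\<bar> + 1"]) auto
qed

lemma bounded_operators_compose:
  assumes "complex_normed_space U" "complex_normed_space V" "complex_normed_space W"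
    and "S \<in> bounded_operators V W" "T \<in> bounded_operators U V"
  shows "(\<lambda>x. S (T x)) \<in> bounded_operators U W"
proof -
  interpret U: complex_normed_space U by fact
  interpret V: complex_normed_space V by fact
  obtain C where C: "C > 0" "\<And>x. x \<in> carrier V \<Longrightarrow> vnorm W (S x) \<le> C * vnorm V x"
    using bounded_operators_bound[OF assms(2,4)] by blast
  obtain D where D: "D > 0" "\<And>x. x \<in> carrier U \<Longrightarrow> vnorm V (T x) \<le> D * vnorm U x"
    using bounded_operators_bound[OF assms(1,5)] by blast
  note [simp] = bounded_operators_closed[OF assms(4)] bounded_operators_closed[OF assms(5)]
  show ?thesis
  proof (rule bounded_operatorsI)
    fix x assume x: "x \<in> carrier U"
    have "vnorm W (S (T x)) \<le> C * vnorm V (T x)"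
      using C x by simp
    also have "\<dots> \<le> C * (D * vnorm U x)"
      using C D x by (intro mult_left_mono) auto
    finally show "vnorm W (S (T x)) \<le> C * D * vnorm U x"
      by (simp add: mult.assoc)
  qed (use assms in \<open>simp_all add: bounded_operators_add bounded_operators_smult\<close>)
qed

lemma operator_norm_bound:
  assumes "complex_normed_space V" "complex_normed_space W" "T \<in> bounded_operators V W"
    and x: "x \<in> carrier V"
  shows "vnorm W (T x) \<le> operator_norm V W T * vnorm V x"
    and "0 \<le> operator_norm V W T"
proof -
  interpret V: complex_normed_space V by fact
  interpret W: complex_normed_space W by fact
  obtain C where C: "C > 0" "\<And>x. x \<in> carrier V \<Longrightarrow> vnorm W (T x) \<le> C * vnorm V x"
    using bounded_operators_bound[OF assms(1,3)] by blast
  \<comment> \<open>A supremum of reals carries information only for a set that is bounded above;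
    \<open>C\<close> bounds the values on the unit ball.\<close>
  have bdd: "bdd_above ((\<lambda>x. vnorm W (T x)) ` {x \<in> carrier V. vnorm V x \<le> 1})"
  proof (rule bdd_aboveI2)
    fix x assume "x \<in> {x \<in> carrier V. vnorm V x \<le> 1}"
    then show "vnorm W (T x) \<le> C"
      using order_trans[OF C(2)[of x] mult_left_mono[of "vnorm V x" 1 C]] C(1) by auto
  qed
  have upper: "vnorm W (T y) \<le> operator_norm V W T" if "y \<in> carrier V" "vnorm V y \<le> 1" for y
    unfolding operator_norm_def using that bdd by (intro cSUP_upper) auto
  show "0 \<le> operator_norm V W T"
    using upper[of "\<zero>\<^bsub>V\<^esub>"] bounded_operators_zero[OF assms(1-3)] by simp
  show "vnorm W (T x) \<le> operator_norm V W T * vnorm V x"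
  proof (cases "x = \<zero>\<^bsub>V\<^esub>")
    case True
    then show ?thesis
      using bounded_operators_zero[OF assms(1-3)] by simp
  next
    case False
    then have pos: "vnorm V x > 0"
      using x V.vnorm_eq_zero[of x] V.vnorm_nonneg[of x] by linarith
    \<comment> \<open>Scaling \<open>x\<close> to norm 1 brings it into the unit ball, where the
      supremum applies; linearity then scales the estimate back.\<close>
    let ?c = "complex_of_real (1 / vnorm V x)"
    have "vnorm V (?c \<odot>\<^bsub>V\<^esub> x) \<le> 1"
      using pos x by (simp add: V.vnorm_smult norm_divide)
    then have "vnorm W (T (?c \<odot>\<^bsub>V\<^esub> x)) \<le> operator_norm V W T"
      using x by (intro upper) auto
    then have "1 / vnorm V x * vnorm W (T x) \<le> operator_norm V W T"
      using pos x bounded_operators_closed[OF assms(3) x]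
      by (simp add: bounded_operators_smult[OF assms(3)] W.vnorm_smult norm_divide)
    then show ?thesis
      using pos by (simp add: field_simps)
  qed
qed

text \<open>A Cauchy sequence \<open>s\<close> of \<open>W\<close> is sent by \<open>h\<close> to a
  Cauchy sequence of \<open>V\<close>. If \<open>l\<close> is its limit there, then
  \<open>g l\<close> is the limit of \<open>s\<close>, because \<open>g (h (s n)) = s n\<close>.
  This gives completeness both for the new norm on \<open>E\<close> and for
  \<open>Inl_copy\<close>.\<close>

lemma mcomplete_of_transfer:
  assumes "complex_normed_space V" "complex_normed_space W"
    and h: "h \<in> bounded_operators W V" and g: "g \<in> bounded_operators V W"
    and gh: "\<And>w. w \<in> carrier W \<Longrightarrow> g (h w) = w"
    and complete: "mcomplete_of (norm_metric V)"
  shows "mcomplete_of (norm_metric W)"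
proof -
  interpret V: complex_normed_space V by fact
  interpret W: complex_normed_space W by fact
  obtain C where C: "C > 0" "\<And>x. x \<in> carrier W \<Longrightarrow> vnorm V (h x) \<le> C * vnorm W x"
    using bounded_operators_bound[OF assms(2) h] by blast
  obtain D where D: "D > 0" "\<And>x. x \<in> carrier V \<Longrightarrow> vnorm W (g x) \<le> D * vnorm V x"
    using bounded_operators_bound[OF assms(1) g] by blast
  note [simp] = bounded_operators_closed[OF h] bounded_operators_closed[OF g]
  interpret MV: Metric_space "carrier V" "mdist (norm_metric V)"
    using Metric_space_mspace_mdist[of "norm_metric V"] by simp
  interpret MW: Metric_space "carrier W" "mdist (norm_metric W)"
    using Metric_space_mspace_mdist[of "norm_metric W"] by simp
  have MVc: "MV.mcomplete"
    using complete by (simp add: mcomplete_of_def)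
  have "MW.mcomplete"
    unfolding MW.mcomplete_def
  proof (intro allI impI)
    fix s assume s: "MW.MCauchy s"
    then have sW [simp]: "s n \<in> carrier W" for n
      by (auto simp: MW.MCauchy_def)
    have "MV.MCauchy (\<lambda>n. h (s n))"
      unfolding MV.MCauchy_def
    proof (intro conjI allI impI)
      fix \<epsilon> :: real assume "\<epsilon> > 0"
      then have "\<epsilon> / C > 0"
        using C by simp
      then obtain N where N: "\<And>n n'. N \<le> n \<Longrightarrow> N \<le> n' \<Longrightarrow> mdist (norm_metric W) (s n) (s n') < \<epsilon> / C"
        using s unfolding MW.MCauchy_def by blast
      have "mdist (norm_metric V) (h (s n)) (h (s n')) < \<epsilon>" if "N \<le> n" "N \<le> n'" for n n'
      proof -
        have "vnorm V (h (s n) \<ominus>\<^bsub>V\<^esub> h (s n')) \<le> C * vnorm W (s n \<ominus>\<^bsub>W\<^esub> s n')"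
          using C(2)[of "s n \<ominus>\<^bsub>W\<^esub> s n'"] bounded_operators_diff[OF assms(2,1) h, of "s n" "s n'"]
          by simp
        also have "\<dots> < \<epsilon>"
          using N[OF that] C(1) by (simp add: W.mdist_norm_metric field_simps)
        finally show ?thesis
          by (simp add: V.mdist_norm_metric)
      qed
      then show "\<exists>N. \<forall>n n'. N \<le> n \<longrightarrow> N \<le> n' \<longrightarrow> mdist (norm_metric V) (h (s n)) (h (s n')) < \<epsilon>"
        by blast
    qed auto
    then obtain l where "limitin MV.mtopology (\<lambda>n. h (s n)) l sequentially"
      using MVc MV.mcomplete_def by blast
    then have l: "l \<in> carrier V"
      and lim: "\<And>\<epsilon>. \<epsilon> > 0 \<Longrightarrow> \<exists>N. \<forall>n\<ge>N. mdist (norm_metric V) (h (s n)) l < \<epsilon>"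
      by (auto simp: MV.limit_metric_sequentially)
    have "limitin MW.mtopology s (g l) sequentially"
      unfolding MW.limit_metric_sequentially
    proof (intro conjI allI impI)
      fix \<epsilon> :: real assume "\<epsilon> > 0"
      then obtain N where N: "\<forall>n\<ge>N. mdist (norm_metric V) (h (s n)) l < \<epsilon> / D"
        using lim[of "\<epsilon> / D"] D by auto
      have "mdist (norm_metric W) (s n) (g l) < \<epsilon>" if "n \<ge> N" for n
      proof -
        have "vnorm W (s n \<ominus>\<^bsub>W\<^esub> g l) \<le> D * vnorm V (h (s n) \<ominus>\<^bsub>V\<^esub> l)"
          using D(2)[of "h (s n) \<ominus>\<^bsub>V\<^esub> l"] bounded_operators_diff[OF assms(1,2) g, of "h (s n)" l] l
          by (simp add: gh)
        also have "\<dots> < \<epsilon>"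
          using N that l D(1) by (simp add: V.mdist_norm_metric field_simps)
        finally show ?thesis
          using l by (simp add: W.mdist_norm_metric)
      qed
      then show "\<exists>N. \<forall>n\<ge>N. s n \<in> carrier W \<and> mdist (norm_metric W) (s n) (g l) < \<epsilon>"
        by auto
    qed (use l in simp)
    then show "\<exists>x. limitin MW.mtopology s x sequentially"
      by blast
  qed
  then show ?thesis
    by (simp add: mcomplete_of_def)
qed

section \<open>Uniform approximation\<close>

text \<open>Closure under uniform convergence on \<open>K\<close>, put as inequalities and without a
  topology on functions. \<open>closure_of_continuous_functions\<close> identifies it with the
  topological closure for all sets that occur.\<close>

definition uniform_closure ::
    "'x set \<Rightarrow> (complex, 'b, 'm) normed_module_scheme \<Rightarrow> ('x \<Rightarrow> 'b) set \<Rightarrow> ('x \<Rightarrow> 'b) set"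
  where "uniform_closure K F G =
    {f \<in> K \<rightarrow>\<^sub>E carrier F. \<forall>\<epsilon>>0. \<exists>g\<in>G. \<forall>x\<in>K. vnorm F (f x \<ominus>\<^bsub>F\<^esub> g x) \<le> \<epsilon>}"

text \<open>Sums without scalar coefficients replace linear spans, since the generators absorb
  scalars themselves: a tensor monomial into its vector, a power of an operator by means of an n-th
  root of the scalar. The inductive form gives inductions that treat one generator at a
  time.\<close>

inductive_set fin_sums :: "'x set \<Rightarrow> ('b, 'm) ring_scheme \<Rightarrow> ('x \<Rightarrow> 'b) set \<Rightarrow> ('x \<Rightarrow> 'b) set"
  for K V G
  where
    zero: "(\<lambda>x\<in>K. \<zero>\<^bsub>V\<^esub>) \<in> fin_sums K V G"
  | add: "\<lbrakk>g \<in> G; f \<in> fin_sums K V G\<rbrakk> \<Longrightarrow> (\<lambda>x\<in>K. g x \<oplus>\<^bsub>V\<^esub> f x) \<in> fin_sums K V G"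

context complex_normed_space
begin

lemma fin_sums_subset:
  assumes "G \<subseteq> K \<rightarrow>\<^sub>E carrier V"
  shows "fin_sums K V G \<subseteq> K \<rightarrow>\<^sub>E carrier V"
proof
  fix f assume "f \<in> fin_sums K V G"
  then show "f \<in> K \<rightarrow>\<^sub>E carrier V"
  proof induction
    case (add g f)
    then have "g \<in> K \<rightarrow>\<^sub>E carrier V" "f \<in> K \<rightarrow>\<^sub>E carrier V"
      using assms by auto
    then show "(\<lambda>x\<in>K. g x \<oplus> f x) \<in> K \<rightarrow>\<^sub>E carrier V"
      by auto
  qed (rule restrict_PiE_iff[THEN iffD2], simp)
qed

lemma fin_sums_superset:
  assumes "G \<subseteq> K \<rightarrow>\<^sub>E carrier V"
  shows "G \<subseteq> fin_sums K V G"
proof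
  fix g assume g: "g \<in> G"
  then have gE: "g \<in> K \<rightarrow>\<^sub>E carrier V"
    using assms by blast
  have "(\<lambda>x\<in>K. g x \<oplus> (\<lambda>x\<in>K. \<zero>) x) = g"
    by (rule extensionalityI[of _ K]) (use gE in \<open>auto simp: PiE_iff\<close>)
  then show "g \<in> fin_sums K V G"
    using fin_sums.add[OF g fin_sums.zero, where K = K and V = V] by (simp only:)
qed

lemma fin_sums_add:
  assumes G: "G \<subseteq> K \<rightarrow>\<^sub>E carrier V" and f: "f \<in> fin_sums K V G" and h: "h \<in> fin_sums K V G"
  shows "(\<lambda>x\<in>K. f x \<oplus> h x) \<in> fin_sums K V G"
  using f
proof induction
  case zero
  have hE: "h \<in> K \<rightarrow>\<^sub>E carrier V"
    using h fin_sums_subset[OF G] by blast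
  have "(\<lambda>x\<in>K. (\<lambda>x\<in>K. \<zero>) x \<oplus> h x) = h"
    by (rule extensionalityI[of _ K]) (use hE in \<open>auto simp: PiE_iff\<close>)
  then show ?case
    using h by simp
next
  case (add g f)
  have "g \<in> K \<rightarrow>\<^sub>E carrier V" "f \<in> K \<rightarrow>\<^sub>E carrier V" "h \<in> K \<rightarrow>\<^sub>E carrier V"
    using add h G fin_sums_subset[OF G] by blast+
  then have "(\<lambda>x\<in>K. (\<lambda>x\<in>K. g x \<oplus> f x) x \<oplus> h x) = (\<lambda>x\<in>K. g x \<oplus> (\<lambda>x\<in>K. f x \<oplus> h x) x)"
    by (auto simp: fun_eq_iff M.a_assoc PiE_iff)
  then show ?case
    using fin_sums.add[OF add.hyps(1) add.IH] by (simp only:)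
qed

lemma fin_sums_smult:
  assumes G: "G \<subseteq> K \<rightarrow>\<^sub>E carrier V" and f: "f \<in> fin_sums K V G"
    and closed: "\<And>g. g \<in> G \<Longrightarrow> (\<lambda>x\<in>K. c \<odot> g x) \<in> G"
  shows "(\<lambda>x\<in>K. c \<odot> f x) \<in> fin_sums K V G"
  using f
proof induction
  case zero
  have "(\<lambda>x\<in>K. c \<odot> (\<lambda>x\<in>K. \<zero>) x) = (\<lambda>x\<in>K. \<zero>)"
    by auto
  then show ?case
    by (simp only: fin_sums.zero)
next
  case (add g f)
  have "g \<in> K \<rightarrow>\<^sub>E carrier V" "f \<in> K \<rightarrow>\<^sub>E carrier V"
    using add G fin_sums_subset[OF G] by blast+
  then have "(\<lambda>x\<in>K. c \<odot> (\<lambda>x\<in>K. g x \<oplus> f x) x)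
      = (\<lambda>x\<in>K. (\<lambda>x\<in>K. c \<odot> g x) x \<oplus> (\<lambda>x\<in>K. c \<odot> f x) x)"
    by (auto simp: fun_eq_iff smult_add_right PiE_iff)
  then show ?case
    using fin_sums.add[OF closed[OF add.hyps(1)] add.IH] by (simp only:)
qed

lemma uniform_closureI:
  assumes "f \<in> K \<rightarrow>\<^sub>E carrier V"
    and "\<And>\<epsilon>. \<epsilon> > 0 \<Longrightarrow> \<exists>g\<in>G. \<forall>x\<in>K. vnorm V (f x \<ominus> g x) \<le> \<epsilon>"
  shows "f \<in> uniform_closure K V G"
  using assms by (simp add: uniform_closure_def)

lemma uniform_closureD:
  assumes "f \<in> uniform_closure K V G" "\<epsilon> > 0"
  obtains g where "g \<in> G" "\<And>x. x \<in> K \<Longrightarrow> vnorm V (f x \<ominus> g x) \<le> \<epsilon>"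
  using assms unfolding uniform_closure_def by blast

lemma uniform_closure_closed: "f \<in> uniform_closure K V G \<Longrightarrow> f \<in> K \<rightarrow>\<^sub>E carrier V"
  by (simp add: uniform_closure_def)

lemma uniform_closure_superset:
  assumes "G \<subseteq> K \<rightarrow>\<^sub>E carrier V"
  shows "G \<subseteq> uniform_closure K V G"
proof
  fix g assume g: "g \<in> G"
  show "g \<in> uniform_closure K V G"
    by (rule uniform_closureI) (use g assms in \<open>auto intro!: bexI[of _ g] simp: subset_iff PiE_iff\<close>)
qed

lemma uniform_closure_mono: "G \<subseteq> H \<Longrightarrow> uniform_closure K V G \<subseteq> uniform_closure K V H"
  unfolding uniform_closure_def by blast

text \<open>Idempotence of the closure, with an error of \<epsilon> / 2 at each of the two stages.
  Combined with monotonicity it shows that a set between \<open>G\<close> and the closure of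
  \<open>G\<close> has the same closure as \<open>G\<close>.\<close>

lemma uniform_closure_absorb:
  assumes G: "G \<subseteq> K \<rightarrow>\<^sub>E carrier V" and H: "H \<subseteq> uniform_closure K V G"
  shows "uniform_closure K V H \<subseteq> uniform_closure K V G"
proof
  fix f assume f: "f \<in> uniform_closure K V H"
  show "f \<in> uniform_closure K V G"
  proof (rule uniform_closureI)
    fix \<epsilon> :: real assume "\<epsilon> > 0"
    then obtain h where h: "h \<in> H" "\<And>x. x \<in> K \<Longrightarrow> vnorm V (f x \<ominus> h x) \<le> \<epsilon> / 2"
      using uniform_closureD[OF f, of "\<epsilon> / 2"] by auto
    then obtain g where g: "g \<in> G" "\<And>x. x \<in> K \<Longrightarrow> vnorm V (h x \<ominus> g x) \<le> \<epsilon> / 2"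
      using uniform_closureD[of h K G "\<epsilon> / 2"] H \<open>\<epsilon> > 0\<close> by (metis half_gt_zero subsetD)
    have "vnorm V (f x \<ominus> g x) \<le> \<epsilon>" if x: "x \<in> K" for x
    proof -
      have "f x \<in> carrier V" "h x \<in> carrier V" "g x \<in> carrier V"
        using uniform_closure_closed[OF f] uniform_closure_closed[of h K G] h(1) g(1) G H x
        by (auto simp: PiE_iff subset_iff)
      then show ?thesis
        using vnorm_dist_triangle[of "f x" "h x" "g x"] h(2)[OF x] g(2)[OF x] by simp
    qed
    then show "\<exists>g\<in>G. \<forall>x\<in>K. vnorm V (f x \<ominus> g x) \<le> \<epsilon>"
      using g(1) by blast
  qed (rule uniform_closure_closed[OF f])
qed

lemma uniform_closure_add:
  assumes G: "G \<subseteq> K \<rightarrow>\<^sub>E carrier V"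
    and closed: "\<And>g h. \<lbrakk>g \<in> G; h \<in> G\<rbrakk> \<Longrightarrow> (\<lambda>x\<in>K. g x \<oplus> h x) \<in> G"
    and f: "f1 \<in> uniform_closure K V G" "f2 \<in> uniform_closure K V G"
  shows "(\<lambda>x\<in>K. f1 x \<oplus> f2 x) \<in> uniform_closure K V G"
proof (rule uniform_closureI)
  note f_closed = f[THEN uniform_closure_closed]
  then show "(\<lambda>x\<in>K. f1 x \<oplus> f2 x) \<in> K \<rightarrow>\<^sub>E carrier V"
    by auto
  fix \<epsilon> :: real assume "\<epsilon> > 0"
  then have "\<epsilon> / 2 > 0" by simp
  obtain g1 where g1: "g1 \<in> G" "\<And>x. x \<in> K \<Longrightarrow> vnorm V (f1 x \<ominus> g1 x) \<le> \<epsilon> / 2"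
    using uniform_closureD[OF f(1) \<open>\<epsilon> / 2 > 0\<close>] by metis
  obtain g2 where g2: "g2 \<in> G" "\<And>x. x \<in> K \<Longrightarrow> vnorm V (f2 x \<ominus> g2 x) \<le> \<epsilon> / 2"
    using uniform_closureD[OF f(2) \<open>\<epsilon> / 2 > 0\<close>] by metis
  have "vnorm V ((f1 x \<oplus> f2 x) \<ominus> (g1 x \<oplus> g2 x)) \<le> \<epsilon>" if x: "x \<in> K" for x
  proof -
    have "f1 x \<in> carrier V" "f2 x \<in> carrier V" "g1 x \<in> carrier V" "g2 x \<in> carrier V"
      using f_closed g1(1) g2(1) G x by (auto simp: PiE_iff subset_iff)
    then show ?thesis
      using vnorm_add_dist[of "f1 x" "f2 x" "g1 x" "g2 x"] g1(2)[OF x] g2(2)[OF x] by simp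
  qed
  then show "\<exists>g\<in>G. \<forall>x\<in>K. vnorm V ((\<lambda>x\<in>K. f1 x \<oplus> f2 x) x \<ominus> g x) \<le> \<epsilon>"
    using closed[OF g1(1) g2(1)] by (intro bexI[of _ "\<lambda>x\<in>K. g1 x \<oplus> g2 x"]) auto
qed

text \<open>The closure of a set that is stable under addition is again stable under addition, so it
  suffices to approximate the generators in \<open>H\<close>.\<close>

lemma uniform_closure_fin_sums:
  assumes G: "G \<subseteq> K \<rightarrow>\<^sub>E carrier V" and H: "H \<subseteq> uniform_closure K V (fin_sums K V G)"
  shows "fin_sums K V H \<subseteq> uniform_closure K V (fin_sums K V G)"
proof
  fix f assume "f \<in> fin_sums K V H"
  then show "f \<in> uniform_closure K V (fin_sums K V G)"
  proof induction
    case zero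
    then show ?case
      using uniform_closure_superset[OF fin_sums_subset[OF G]] fin_sums.zero by blast
  next
    case (add g f)
    then show ?case
      using H by (intro uniform_closure_add fin_sums_subset[OF G] fin_sums_add[OF G]) auto
  qed
qed

end

text \<open>A class that contains all generators, is stable under sums and products, and makes the
  two requirements of \<open>cfunspace\<close>, boundedness and continuity, visible in plain
  inequalities.\<close>

definition bounded_lipschitz ::
    "(complex, 'a, 'm) normed_module_scheme \<Rightarrow> 'a set \<Rightarrow> (complex, 'b, 'n) normed_module_scheme
      \<Rightarrow> ('a \<Rightarrow> 'b) set"
  where "bounded_lipschitz E K F = {f \<in> K \<rightarrow>\<^sub>E carrier F.
    \<exists>B L. \<forall>x\<in>K. vnorm F (f x) \<le> B
      \<and> (\<forall>y\<in>K. vnorm F (f x \<ominus>\<^bsub>F\<^esub> f y) \<le> L * vnorm E (x \<ominus>\<^bsub>E\<^esub> y))}"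

locale compact_pair = E: complex_normed_space E + F: complex_normed_space F
  for E :: "(complex, 'a, 'm) normed_module_scheme"
    and F :: "(complex, 'b, 'n) normed_module_scheme" +
  fixes K :: "'a set"
  assumes compact: "compactin (norm_topology E) K"
begin

lemma K_subset: "K \<subseteq> carrier E"
  using compactin_subset_topspace[OF compact] by simp

text \<open>This is how compactness enters the estimates: the bound makes operators bounded on
  \<open>K\<close> and series of powers uniformly convergent on it.\<close>

lemma K_bounded: obtains R where "R > 0" "\<And>x. x \<in> K \<Longrightarrow> vnorm E x \<le> R"
proof -
  interpret M: Metric_space "carrier E" "mdist (norm_metric E)"
    using Metric_space_mspace_mdist[of "norm_metric E"] by simp
  have "M.mbounded K"
    using compact M.compactin_imp_mbounded by (simp add: mtopology_of_def)
  then obtain c R where cR: "K \<subseteq> M.mcball c R"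
    unfolding M.mbounded_def by blast
  have "vnorm E x \<le> \<bar>R\<bar> + vnorm E c + 1" if "x \<in> K" for x
  proof -
    have "x \<in> carrier E" "c \<in> carrier E" "vnorm E (c \<ominus>\<^bsub>E\<^esub> x) \<le> R"
      using cR that by (auto simp: subset_iff E.mdist_norm_metric)
    then show ?thesis
      using E.vnorm_le_dist_add[of x c] by (simp add: E.vnorm_diff_commute[of x c])
  qed
  moreover have "0 < \<bar>R\<bar> + vnorm E c + 1" if "x \<in> K" for x
    using calculation[OF that] that K_subset E.vnorm_nonneg[of x] cR
    by (metis M.in_mcball abs_ge_zero add_nonneg_nonneg add_strict_increasing2 less_numeral_extra(1)
        subsetD E.vnorm_nonneg)
  \<comment> \<open>If \<open>K\<close> is empty, the centre \<open>c\<close> of the ball may lie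
    outside the carrier, where \<open>vnorm\<close> is arbitrary, so that case takes the radius
    1.\<close>
  ultimately show thesis
    using that[of 1] that[of "\<bar>R\<bar> + vnorm E c + 1"] by (cases "K = {}") auto
qed

lemma bounded_lipschitz_closed: "bounded_lipschitz E K F \<subseteq> K \<rightarrow>\<^sub>E carrier F"
  by (auto simp: bounded_lipschitz_def)

lemma bounded_lipschitzI:
  assumes "f \<in> K \<rightarrow>\<^sub>E carrier F" "\<And>x. x \<in> K \<Longrightarrow> vnorm F (f x) \<le> B"
    and "\<And>x y. \<lbrakk>x \<in> K; y \<in> K\<rbrakk> \<Longrightarrow> vnorm F (f x \<ominus>\<^bsub>F\<^esub> f y) \<le> L * vnorm E (x \<ominus>\<^bsub>E\<^esub> y)"
  shows "f \<in> bounded_lipschitz E K F"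
  using assms unfolding bounded_lipschitz_def by blast

lemma bounded_lipschitzD:
  assumes "f \<in> bounded_lipschitz E K F"
  obtains B L where "B \<ge> 0" "L \<ge> 0" "\<And>x. x \<in> K \<Longrightarrow> vnorm F (f x) \<le> B"
    "\<And>x y. \<lbrakk>x \<in> K; y \<in> K\<rbrakk> \<Longrightarrow> vnorm F (f x \<ominus>\<^bsub>F\<^esub> f y) \<le> L * vnorm E (x \<ominus>\<^bsub>E\<^esub> y)"
proof -
  obtain B L where BL: "\<And>x. x \<in> K \<Longrightarrow> vnorm F (f x) \<le> B"
    "\<And>x y. \<lbrakk>x \<in> K; y \<in> K\<rbrakk> \<Longrightarrow> vnorm F (f x \<ominus>\<^bsub>F\<^esub> f y) \<le> L * vnorm E (x \<ominus>\<^bsub>E\<^esub> y)"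
    using assms unfolding bounded_lipschitz_def by blast
  have "vnorm F (f x \<ominus>\<^bsub>F\<^esub> f y) \<le> \<bar>L\<bar> * vnorm E (x \<ominus>\<^bsub>E\<^esub> y)" if "x \<in> K" "y \<in> K" for x y
    using BL(2)[OF that] mult_right_mono[of L "\<bar>L\<bar>" "vnorm E (x \<ominus>\<^bsub>E\<^esub> y)"] that K_subset
    by (smt (verit) E.M.minus_closed E.vnorm_nonneg subsetD)
  moreover have "vnorm F (f x) \<le> \<bar>B\<bar>" if "x \<in> K" for x
    using BL(1)[OF that] by simp
  ultimately show thesis
    using that[of "\<bar>B\<bar>" "\<bar>L\<bar>"] by simp
qed

lemma carrier_Int_K [simp]: "carrier E \<inter> K = K"
  using K_subset by auto

lemma mspace_continuous_functions:
  "mspace (continuous_functions E K F) = {f \<in> K \<rightarrow>\<^sub>E carrier F.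
    Metric_space.mbounded (carrier F) (mdist (norm_metric F)) (f ` K)
      \<and> continuous_map (subtopology (norm_topology E) K) (norm_topology F) f}"
  by (auto simp: continuous_functions_def PiE_def)

text \<open>A uniform limit of Lipschitz functions is continuous, and a function at bounded distance
  from a bounded one is bounded; so uniform limits do not leave the function space.\<close>

lemma uniform_closure_bounded_lipschitz:
  "uniform_closure K F (bounded_lipschitz E K F) \<subseteq> mspace (continuous_functions E K F)"
proof
  interpret M: Metric_space "carrier F" "mdist (norm_metric F)"
    using Metric_space_mspace_mdist[of "norm_metric F"] by simp
  fix f assume f: "f \<in> uniform_closure K F (bounded_lipschitz E K F)"
  note f_closed = F.uniform_closure_closed[OF f]
  have "\<exists>g\<in>bounded_lipschitz E K F. \<forall>x\<in>K. vnorm F (f x \<ominus>\<^bsub>F\<^esub> g x) \<le> inverse (real (Suc n))" for n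
    using F.uniform_closureD[OF f, of "inverse (real (Suc n))"] by (metis inverse_positive_iff_positive of_nat_0_less_iff zero_less_Suc)
  then obtain g where g: "\<And>n. g n \<in> bounded_lipschitz E K F"
    and fg: "\<And>n x. x \<in> K \<Longrightarrow> vnorm F (f x \<ominus>\<^bsub>F\<^esub> g n x) \<le> inverse (real (Suc n))"
    by metis
  have g_closed: "g n \<in> K \<rightarrow>\<^sub>E carrier F" for n
    using g bounded_lipschitz_closed by blast
  have g_cont: "continuous_map (subtopology (norm_topology E) K) (norm_topology F) (g n)" for n
  proof -
    obtain L where L: "\<And>x y. \<lbrakk>x \<in> K; y \<in> K\<rbrakk> \<Longrightarrow> vnorm F (g n x \<ominus>\<^bsub>F\<^esub> g n y) \<le> L * vnorm E (x \<ominus>\<^bsub>E\<^esub> y)"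
      using bounded_lipschitzD[OF g[of n]] by metis
    have "Lipschitz_continuous_map (submetric (norm_metric E) K) (norm_metric F) (g n)"
      unfolding Lipschitz_continuous_map_def
      using g_closed[of n] K_subset L
      by (auto simp: subset_iff PiE_iff E.mdist_norm_metric F.mdist_norm_metric intro!: exI[of _ L])
    then show ?thesis
      using Lipschitz_continuous_imp_continuous_map by (force simp: mtopology_of_submetric)
  qed
  have "continuous_map (subtopology (norm_topology E) K) M.mtopology f"
  proof (rule M.continuous_map_uniform_limit[where F = sequentially and f = g])
    show "\<forall>\<^sub>F n in sequentially. continuous_map (subtopology (norm_topology E) K) M.mtopology (g n)"
      using g_cont by (simp add: mtopology_of_def)
    fix \<epsilon> :: real assume "\<epsilon> > 0"
    then have "\<forall>\<^sub>F n in sequentially. inverse (real (Suc n)) < \<epsilon>"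
      using LIMSEQ_inverse_real_of_nat by (auto dest: order_tendstoD)
    then show "\<forall>\<^sub>F n in sequentially. \<forall>x\<in>topspace (subtopology (norm_topology E) K).
        f x \<in> carrier F \<and> mdist (norm_metric F) (g n x) (f x) < \<epsilon>"
    proof eventually_elim
      case (elim n)
      have "mdist (norm_metric F) (g n x) (f x) < \<epsilon>" if x: "x \<in> K" for x
      proof -
        have "f x \<in> carrier F" "g n x \<in> carrier F"
          using f_closed g_closed x by (auto simp: PiE_iff)
        then show ?thesis
          using fg[OF x, of n] elim F.vnorm_diff_commute[of "f x" "g n x"]
          by (simp add: F.mdist_norm_metric)
      qed
      then show ?case
        using f_closed by (auto simp: PiE_iff)
    qed
  qed simp
  moreover have "M.mbounded (f ` K)"
  proof -
    \<comment> \<open>The approximant \<open>g 0\<close> is within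
      \<open>inverse (real (Suc 0))\<close>, that is 1, of \<open>f\<close>, which turns its bound
      \<open>B\<close> into \<open>1 + B\<close>.\<close>
    obtain B where B: "\<And>x. x \<in> K \<Longrightarrow> vnorm F (g 0 x) \<le> B"
      using bounded_lipschitzD[OF g[of 0]] by metis
    have "f ` K \<subseteq> M.mcball \<zero>\<^bsub>F\<^esub> (1 + B)"
    proof
      fix z assume "z \<in> f ` K"
      then obtain x where x: "x \<in> K" "z = f x"
        by blast
      have fgx: "f x \<in> carrier F" "g 0 x \<in> carrier F"
        using f_closed g_closed x by (auto simp: PiE_iff)
      then have "vnorm F (f x) \<le> 1 + B"
        using F.vnorm_le_dist_add[of "f x" "g 0 x"] fg[OF x(1), of 0] B[OF x(1)] by simp
      then show "z \<in> M.mcball \<zero>\<^bsub>F\<^esub> (1 + B)"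
        using fgx x by (simp add: F.mdist_norm_metric F.vnorm_diff_commute[of "\<zero>\<^bsub>F\<^esub>"] a_minus_def)
    qed
    then show ?thesis
      unfolding M.mbounded_def by blast
  qed
  ultimately show "f \<in> mspace (continuous_functions E K F)"
    using f_closed by (simp add: mspace_continuous_functions) (simp add: mtopology_of_def)
qed

lemma mdist_continuous_functions_le:
  assumes "f \<in> mspace (continuous_functions E K F)" "g \<in> mspace (continuous_functions E K F)"
    and "a \<ge> 0"
  shows "mdist (continuous_functions E K F) f g \<le> a
    \<longleftrightarrow> (\<forall>x\<in>K. vnorm F (f x \<ominus>\<^bsub>F\<^esub> g x) \<le> a)"
proof -
  have closed: "\<And>x. x \<in> K \<Longrightarrow> f x \<in> carrier F" "\<And>x. x \<in> K \<Longrightarrow> g x \<in> carrier F"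
    using assms(1,2) by (auto simp: mspace_continuous_functions)
  show ?thesis
  proof (cases "K = {}")
    case True
    \<comment> \<open>Extensional functions on the empty set coincide, so their distance is 0; the
      description of the metric as a supremum is used for nonempty \<open>K\<close> only.\<close>
    then have "mdist (continuous_functions E K F) f g = 0"
      using assms by (auto simp: continuous_functions_def)
    with True assms(3) show ?thesis by simp
  next
    case False
    then show ?thesis
      using assms(1,2) cfunspace_mdist_le[of f "subtopology (norm_topology E) K" "norm_metric F" g a]
      by (simp add: continuous_functions_def[symmetric] closed F.mdist_norm_metric del: mspace_cfunspace)
  qed
qed

text \<open>By the hypothesis both \<open>S\<close> and its uniform limits lie in the function
  space. Membership in a closed ball is there the same as the pointwise inequality on
  \<open>K\<close>, and so the two closures agree.\<close>

lemma closure_of_continuous_functions: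
  assumes S: "S \<subseteq> uniform_closure K F (bounded_lipschitz E K F)"
  shows "mtopology_of (continuous_functions E K F) closure_of S = uniform_closure K F S"
proof -
  let ?C = "mspace (continuous_functions E K F)"
  interpret M: Metric_space ?C "mdist (continuous_functions E K F)"
    by (rule Metric_space_mspace_mdist)
  have SC: "S \<subseteq> ?C"
    using S uniform_closure_bounded_lipschitz by blast
  have ucC: "uniform_closure K F S \<subseteq> ?C"
    using F.uniform_closure_absorb[OF bounded_lipschitz_closed S] uniform_closure_bounded_lipschitz
    by blast
  have C_closed: "?C \<subseteq> K \<rightarrow>\<^sub>E carrier F"
    by (auto simp: mspace_continuous_functions)
  have closure: "mtopology_of (continuous_functions E K F) closure_of S
    = {f \<in> ?C. \<forall>\<epsilon>>0. \<exists>g\<in>S. g \<in> M.mcball f \<epsilon>}"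
    unfolding mtopology_of_def by (rule M.metric_closure_of_alt)
  have mcball: "g \<in> M.mcball f \<epsilon> \<longleftrightarrow> (\<forall>x\<in>K. vnorm F (f x \<ominus>\<^bsub>F\<^esub> g x) \<le> \<epsilon>)"
    if "f \<in> ?C" "g \<in> S" "\<epsilon> > 0" for f g \<epsilon>
    using that SC mdist_continuous_functions_le[of f g \<epsilon>] by auto
  show ?thesis
  proof (intro equalityI subsetI)
    fix f assume "f \<in> mtopology_of (continuous_functions E K F) closure_of S"
    then have f: "f \<in> ?C" "\<And>\<epsilon>. \<epsilon> > 0 \<Longrightarrow> \<exists>g\<in>S. g \<in> M.mcball f \<epsilon>"
      unfolding closure by blast+
    show "f \<in> uniform_closure K F S"
    proof (rule F.uniform_closureI)
      fix \<epsilon> :: real assume "\<epsilon> > 0"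
      then show "\<exists>g\<in>S. \<forall>x\<in>K. vnorm F (f x \<ominus>\<^bsub>F\<^esub> g x) \<le> \<epsilon>"
        using f(2) mcball[OF f(1)] by meson
    qed (use f(1) C_closed in blast)
  next
    fix f assume f: "f \<in> uniform_closure K F S"
    then have fC: "f \<in> ?C"
      using ucC by blast
    have "\<exists>g\<in>S. g \<in> M.mcball f \<epsilon>" if "\<epsilon> > 0" for \<epsilon>
      using F.uniform_closureD[OF f that] mcball[OF fC _ that] by metis
    then show "f \<in> mtopology_of (continuous_functions E K F) closure_of S"
      unfolding closure using fC by blast
  qed
qed

lemma bounded_lipschitz_const:
  assumes "a \<in> carrier F"
  shows "(\<lambda>x\<in>K. a) \<in> bounded_lipschitz E K F"
  by (rule bounded_lipschitzI[where B = "vnorm F a" and L = 0]) (use assms in auto)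

lemma bounded_lipschitz_operator:
  assumes T: "T \<in> bounded_operators E F"
  shows "(\<lambda>x\<in>K. T x) \<in> bounded_lipschitz E K F"
proof -
  obtain C where C: "C > 0" "\<And>x. x \<in> carrier E \<Longrightarrow> vnorm F (T x) \<le> C * vnorm E x"
    using bounded_operators_bound[OF E.complex_normed_space_axioms T] by blast
  obtain R where R: "R > 0" "\<And>x. x \<in> K \<Longrightarrow> vnorm E x \<le> R"
    using K_bounded by blast
  show ?thesis
  proof (rule bounded_lipschitzI)
    fix x assume x: "x \<in> K"
    then have "vnorm F (T x) \<le> C * vnorm E x"
      using C K_subset by blast
    also have "\<dots> \<le> C * R"
      using R(2)[OF x] C(1) by simp
    finally show "vnorm F ((\<lambda>x\<in>K. T x) x) \<le> C * R"
      using x by simp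
  next
    fix x y assume xy: "x \<in> K" "y \<in> K"
    then have "vnorm F (T (x \<ominus>\<^bsub>E\<^esub> y)) \<le> C * vnorm E (x \<ominus>\<^bsub>E\<^esub> y)"
      using C K_subset by (auto simp: subset_iff)
    then show "vnorm F ((\<lambda>x\<in>K. T x) x \<ominus>\<^bsub>F\<^esub> (\<lambda>x\<in>K. T x) y) \<le> C * vnorm E (x \<ominus>\<^bsub>E\<^esub> y)"
      using bounded_operators_diff[OF E.complex_normed_space_axioms F.complex_normed_space_axioms T, of x y]
        xy K_subset by (simp add: subset_iff)
  qed (use bounded_operators_closed[OF T] K_subset in auto)
qed

lemma bounded_lipschitz_add:
  assumes "f \<in> bounded_lipschitz E K F" "g \<in> bounded_lipschitz E K F"
  shows "(\<lambda>x\<in>K. f x \<oplus>\<^bsub>F\<^esub> g x) \<in> bounded_lipschitz E K F"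
proof -
  obtain B L where f: "\<And>x. x \<in> K \<Longrightarrow> vnorm F (f x) \<le> B"
    "\<And>x y. \<lbrakk>x \<in> K; y \<in> K\<rbrakk> \<Longrightarrow> vnorm F (f x \<ominus>\<^bsub>F\<^esub> f y) \<le> L * vnorm E (x \<ominus>\<^bsub>E\<^esub> y)"
    using bounded_lipschitzD[OF assms(1)] by metis
  obtain B' L' where g: "\<And>x. x \<in> K \<Longrightarrow> vnorm F (g x) \<le> B'"
    "\<And>x y. \<lbrakk>x \<in> K; y \<in> K\<rbrakk> \<Longrightarrow> vnorm F (g x \<ominus>\<^bsub>F\<^esub> g y) \<le> L' * vnorm E (x \<ominus>\<^bsub>E\<^esub> y)"
    using bounded_lipschitzD[OF assms(2)] by metis
  have closed: "\<And>x. x \<in> K \<Longrightarrow> f x \<in> carrier F" "\<And>x. x \<in> K \<Longrightarrow> g x \<in> carrier F"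
    using assms bounded_lipschitz_closed by (auto simp: subset_iff PiE_iff)
  show ?thesis
  proof (rule bounded_lipschitzI[where B = "B + B'" and L = "L + L'"])
    fix x assume "x \<in> K"
    then show "vnorm F ((\<lambda>x\<in>K. f x \<oplus>\<^bsub>F\<^esub> g x) x) \<le> B + B'"
      using F.vnorm_triangle[of "f x" "g x"] f(1)[of x] g(1)[of x] closed by simp
  next
    fix x y assume "x \<in> K" "y \<in> K"
    then show "vnorm F ((\<lambda>x\<in>K. f x \<oplus>\<^bsub>F\<^esub> g x) x \<ominus>\<^bsub>F\<^esub> (\<lambda>x\<in>K. f x \<oplus>\<^bsub>F\<^esub> g x) y)
        \<le> (L + L') * vnorm E (x \<ominus>\<^bsub>E\<^esub> y)"
      using F.vnorm_add_dist[of "f x" "g x" "f y" "g y"] f(2)[of x y] g(2)[of x y] closed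
      by (simp add: distrib_right)
  qed (use closed in auto)
qed

lemma bounded_lipschitz_fin_sums:
  assumes "G \<subseteq> bounded_lipschitz E K F"
  shows "fin_sums K F G \<subseteq> bounded_lipschitz E K F"
proof
  fix f assume "f \<in> fin_sums K F G"
  then show "f \<in> bounded_lipschitz E K F"
  proof induction
    case zero
    then show ?case
      by (rule bounded_lipschitz_const) simp
  next
    case (add g f)
    then show ?case
      using assms by (intro bounded_lipschitz_add) auto
  qed
qed

end

section \<open>Banach algebras\<close>

lemma comm_unital_banach_algebraI:
  fixes A (structure)
  assumes "complex_normed_space A" and alg: "algebra complex_ring A"
    and complete: "mcomplete_of (norm_metric A)"
    and mult: "\<And>x y. \<lbrakk>x \<in> carrier A; y \<in> carrier A\<rbrakk> \<Longrightarrow> vnorm A (x \<otimes> y) \<le> vnorm A x * vnorm A y"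
    and one: "vnorm A \<one> = 1"
  shows "comm_unital_banach_algebra A"
proof -
  interpret complex_normed_space A by fact
  have "complex_banach_space A"
    by (intro complex_banach_space.intro complex_banach_space_axioms.intro module_axioms complete
        vnorm_eq_zero vnorm_triangle vnorm_smult)
  then show ?thesis
    by (intro comm_unital_banach_algebra.intro comm_unital_banach_algebra_axioms.intro alg mult one)
qed

lemma complex_alg_simps [simp]:
  "carrier complex_alg = UNIV" "\<zero>\<^bsub>complex_alg\<^esub> = 0" "\<one>\<^bsub>complex_alg\<^esub> = 1"
  "(\<oplus>\<^bsub>complex_alg\<^esub>) = (+)" "(\<otimes>\<^bsub>complex_alg\<^esub>) = (*)" "(\<odot>\<^bsub>complex_alg\<^esub>) = (*)"
  "vnorm complex_alg = cmod"
  by (simp_all add: complex_alg_def)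

lemma cring_complex_alg: "cring complex_alg"
proof -
  have "\<exists>y. x + y = 0" for x :: complex
    using add.right_inverse by blast
  moreover have "\<exists>y. y + x = 0 \<and> x + y = 0" for x :: complex
    by (rule exI[of _ "- x"]) simp
  ultimately show ?thesis
    by unfold_locales (auto simp: algebra_simps Units_def complex_alg_def)
qed

lemma complex_alg_diff [simp]: "x \<ominus>\<^bsub>complex_alg\<^esub> y = x - y"
proof -
  interpret cring complex_alg
    by (rule cring_complex_alg)
  have "\<ominus>\<^bsub>complex_alg\<^esub> y = - y"
    by (rule minus_equality) auto
  then show ?thesis
    by (simp add: a_minus_def)
qed

lemma complex_alg_pow [simp]: "x [^]\<^bsub>complex_alg\<^esub> (n :: nat) = x ^ n"
  by (induction n) simp_all

lemma comm_unital_banach_algebra_complex_alg: "comm_unital_banach_algebra complex_alg"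
proof -
  interpret cring complex_alg
    by (rule cring_complex_alg)
  interpret R: cring complex_ring
    by (rule cring_from_type_algebra)
  interpret algebra complex_ring complex_alg
    by unfold_locales (auto simp: algebra_simps complex_ring_one)
  interpret complex_normed_space complex_alg
    by unfold_locales (auto simp: norm_triangle_ineq norm_mult)
  have "norm_metric complex_alg = metric (UNIV, dist)"
    by (simp add: norm_metric_def dist_norm[abs_def])
  then have "mcomplete_of (norm_metric complex_alg)"
    using Met_TC.mcomplete_of[where 'a = complex] mcomplete_iff_complete complete_UNIV by metis
  then show ?thesis
    by (intro comm_unital_banach_algebraI complex_normed_space_axioms algebra_axioms)
      (auto simp: norm_mult_ineq)
qed

context comm_unital_banach_algebra
begin

lemma smult_mult_left:
  "\<lbrakk>x \<in> carrier A; y \<in> carrier A\<rbrakk> \<Longrightarrow> (c \<odot> x) \<otimes> y = c \<odot> (x \<otimes> y)"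
  using smult_assoc2[of c x y] by simp

lemma smult_mult_right:
  "\<lbrakk>x \<in> carrier A; y \<in> carrier A\<rbrakk> \<Longrightarrow> x \<otimes> (c \<odot> y) = c \<odot> (x \<otimes> y)"
  by (metis m_comm smult_mult_left smult_closed')

lemma smult_pow: "x \<in> carrier A \<Longrightarrow> (c \<odot> x) [^] n = c ^ n \<odot> x [^] n" for n :: nat
  by (induction n) (simp_all add: smult_mult_left smult_mult_right smult_smult)

lemma vnorm_pow: "x \<in> carrier A \<Longrightarrow> vnorm A (x [^] n) \<le> vnorm A x ^ n" for n :: nat
proof (induction n)
  case (Suc n)
  then have "vnorm A (x [^] Suc n) \<le> vnorm A (x [^] n) * vnorm A x"
    by (simp add: vnorm_mult)
  also have "\<dots> \<le> vnorm A x ^ n * vnorm A x"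
    using Suc by (intro mult_right_mono) auto
  finally show ?case
    by (simp add: mult.commute)
qed (simp add: vnorm_one)

lemma diff_mult_diff:
  assumes [simp]: "x \<in> carrier A" "y \<in> carrier A" "z \<in> carrier A" "w \<in> carrier A"
  shows "x \<otimes> y \<ominus> z \<otimes> w = (x \<ominus> z) \<otimes> y \<oplus> z \<otimes> (y \<ominus> w)"
proof -
  have "(x \<ominus> z) \<otimes> y = x \<otimes> y \<ominus> z \<otimes> y" "z \<otimes> (y \<ominus> w) = z \<otimes> y \<ominus> z \<otimes> w"
    by (simp_all add: a_minus_def l_distr r_distr l_minus r_minus)
  then show ?thesis
    by (simp add: diff_add_diff)
qed

text \<open>Splitting off the mixed product \<open>z \<otimes> y\<close> means that bounds are
  needed for \<open>y\<close> and \<open>z\<close> alone. This dictates the order of the choices in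
  \<open>uniform_closure_mult\<close>.\<close>

lemma vnorm_mult_dist:
  assumes [simp]: "x \<in> carrier A" "y \<in> carrier A" "z \<in> carrier A" "w \<in> carrier A"
  shows "vnorm A (x \<otimes> y \<ominus> z \<otimes> w)
    \<le> vnorm A (x \<ominus> z) * vnorm A y + vnorm A z * vnorm A (y \<ominus> w)"
proof -
  have "vnorm A (x \<otimes> y \<ominus> z \<otimes> w)
      \<le> vnorm A ((x \<ominus> z) \<otimes> y) + vnorm A (z \<otimes> (y \<ominus> w))"
    by (simp add: diff_mult_diff vnorm_triangle)
  also have "\<dots> \<le> vnorm A (x \<ominus> z) * vnorm A y + vnorm A z * vnorm A (y \<ominus> w)"
    by (intro add_mono vnorm_mult) auto
  finally show ?thesis .
qed

end

section \<open>Functions on \<open>K\<close> with values in an algebra\<close>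

locale compact_pair_algebra =
  E: complex_normed_space E + A: comm_unital_banach_algebra A
  for E :: "(complex, 'a, 'm) normed_module_scheme"
    and A :: "(complex, 'b, 'n) normed_module_scheme" +
  fixes K :: "'a set"
  assumes compact': "compactin (norm_topology E) K"

sublocale compact_pair_algebra \<subseteq> compact_pair E A K
  by unfold_locales (rule compact')

context compact_pair_algebra
begin

lemma bounded_lipschitz_mult:
  assumes "f \<in> bounded_lipschitz E K A" "g \<in> bounded_lipschitz E K A"
  shows "(\<lambda>x\<in>K. f x \<otimes>\<^bsub>A\<^esub> g x) \<in> bounded_lipschitz E K A"
proof -
  obtain B L where f: "B \<ge> 0" "\<And>x. x \<in> K \<Longrightarrow> vnorm A (f x) \<le> B"
    "\<And>x y. \<lbrakk>x \<in> K; y \<in> K\<rbrakk> \<Longrightarrow> vnorm A (f x \<ominus>\<^bsub>A\<^esub> f y) \<le> L * vnorm E (x \<ominus>\<^bsub>E\<^esub> y)"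
    using bounded_lipschitzD[OF assms(1)] by metis
  obtain B' L' where g: "B' \<ge> 0" "\<And>x. x \<in> K \<Longrightarrow> vnorm A (g x) \<le> B'"
    "\<And>x y. \<lbrakk>x \<in> K; y \<in> K\<rbrakk> \<Longrightarrow> vnorm A (g x \<ominus>\<^bsub>A\<^esub> g y) \<le> L' * vnorm E (x \<ominus>\<^bsub>E\<^esub> y)"
    using bounded_lipschitzD[OF assms(2)] by metis
  have closed: "\<And>x. x \<in> K \<Longrightarrow> f x \<in> carrier A" "\<And>x. x \<in> K \<Longrightarrow> g x \<in> carrier A"
    using assms bounded_lipschitz_closed by (auto simp: subset_iff PiE_iff)
  show ?thesis
  proof (rule bounded_lipschitzI[where B = "B * B'" and L = "L * B' + B * L'"])
    fix x assume x: "x \<in> K"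
    have "vnorm A (f x \<otimes>\<^bsub>A\<^esub> g x) \<le> vnorm A (f x) * vnorm A (g x)"
      using closed x by (simp add: A.vnorm_mult)
    also have "\<dots> \<le> B * B'"
      using f(1,2) g(2) closed x by (intro mult_mono) auto
    finally show "vnorm A ((\<lambda>x\<in>K. f x \<otimes>\<^bsub>A\<^esub> g x) x) \<le> B * B'"
      using x by simp
  next
    fix x y assume xy: "x \<in> K" "y \<in> K"
    have "vnorm A (f x \<otimes>\<^bsub>A\<^esub> g x \<ominus>\<^bsub>A\<^esub> f y \<otimes>\<^bsub>A\<^esub> g y)
      \<le> vnorm A (f x \<ominus>\<^bsub>A\<^esub> f y) * vnorm A (g x) + vnorm A (f y) * vnorm A (g x \<ominus>\<^bsub>A\<^esub> g y)"
      using closed xy by (simp add: A.vnorm_mult_dist)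
    also have "\<dots> \<le> (L * vnorm E (x \<ominus>\<^bsub>E\<^esub> y)) * B' + B * (L' * vnorm E (x \<ominus>\<^bsub>E\<^esub> y))"
      using f g closed xy order_trans[OF A.vnorm_nonneg f(3)[OF xy]]
      by (intro add_mono mult_mono) auto
    finally show "vnorm A ((\<lambda>x\<in>K. f x \<otimes>\<^bsub>A\<^esub> g x) x \<ominus>\<^bsub>A\<^esub> (\<lambda>x\<in>K. f x \<otimes>\<^bsub>A\<^esub> g x) y)
        \<le> (L * B' + B * L') * vnorm E (x \<ominus>\<^bsub>E\<^esub> y)"
      using xy by (simp add: algebra_simps)
  qed (use closed in auto)
qed

lemma bounded_lipschitz_pow:
  fixes n :: nat
  assumes "f \<in> bounded_lipschitz E K A"
  shows "(\<lambda>x\<in>K. f x [^]\<^bsub>A\<^esub> n) \<in> bounded_lipschitz E K A"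
proof (induction n)
  case 0
  have "(\<lambda>x\<in>K. f x [^]\<^bsub>A\<^esub> (0 :: nat)) = (\<lambda>x\<in>K. \<one>\<^bsub>A\<^esub>)"
    by simp
  then show ?case
    using bounded_lipschitz_const[OF A.one_closed] by (simp only:)
next
  case (Suc n)
  have "(\<lambda>x\<in>K. (\<lambda>x\<in>K. f x [^]\<^bsub>A\<^esub> n) x \<otimes>\<^bsub>A\<^esub> f x) = (\<lambda>x\<in>K. f x [^]\<^bsub>A\<^esub> Suc n)"
    by (auto simp: fun_eq_iff)
  then show ?case
    using bounded_lipschitz_mult[OF Suc assms] by (simp only:)
qed

lemma uniform_closure_mult:
  assumes G: "G \<subseteq> bounded_lipschitz E K A"
    and closed: "\<And>g h. \<lbrakk>g \<in> G; h \<in> G\<rbrakk> \<Longrightarrow> (\<lambda>x\<in>K. g x \<otimes>\<^bsub>A\<^esub> h x) \<in> G"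
    and f: "f1 \<in> uniform_closure K A G" "f2 \<in> uniform_closure K A G"
  shows "(\<lambda>x\<in>K. f1 x \<otimes>\<^bsub>A\<^esub> f2 x) \<in> uniform_closure K A G"
proof (rule A.uniform_closureI)
  note f_closed = f[THEN A.uniform_closure_closed]
  then show "(\<lambda>x\<in>K. f1 x \<otimes>\<^bsub>A\<^esub> f2 x) \<in> K \<rightarrow>\<^sub>E carrier A"
    by auto
  fix \<epsilon> :: real assume "\<epsilon> > 0"
  \<comment> \<open>An approximation with error 1 serves only to bound \<open>f2\<close> on
    \<open>K\<close>.\<close>
  obtain g2 where g2: "g2 \<in> G" "\<And>x. x \<in> K \<Longrightarrow> vnorm A (f2 x \<ominus>\<^bsub>A\<^esub> g2 x) \<le> 1"
    using A.uniform_closureD[OF f(2), of 1] by auto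
  obtain B2 where B2: "B2 \<ge> 0" "\<And>x. x \<in> K \<Longrightarrow> vnorm A (g2 x) \<le> B2"
    using bounded_lipschitzD[of g2] g2(1) G by (metis subsetD)
  define M where "M = B2 + 1"
  have M: "M > 0"
    using B2(1) by (simp add: M_def)
  have fM: "vnorm A (f2 x) \<le> M" if "x \<in> K" for x
  proof -
    have "f2 x \<in> carrier A" "g2 x \<in> carrier A"
      using f_closed g2(1) G bounded_lipschitz_closed that by (auto simp: PiE_iff subset_iff)
    then show ?thesis
      using A.vnorm_le_dist_add[of "f2 x" "g2 x"] g2(2)[OF that] B2(2)[OF that] by (simp add: M_def)
  qed
  have "\<epsilon> / (2 * M) > 0"
    using \<open>\<epsilon> > 0\<close> M by simp
  then obtain g1 where g1: "g1 \<in> G" "\<And>x. x \<in> K \<Longrightarrow> vnorm A (f1 x \<ominus>\<^bsub>A\<^esub> g1 x) \<le> \<epsilon> / (2 * M)"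
    using A.uniform_closureD[OF f(1)] by metis
  obtain B1 where B1: "B1 \<ge> 0" "\<And>x. x \<in> K \<Longrightarrow> vnorm A (g1 x) \<le> B1"
    using bounded_lipschitzD[of g1] g1(1) G by (metis subsetD)
  \<comment> \<open>\<open>B1\<close> depends on \<open>g1\<close>, so the approximation
    \<open>h\<close> of \<open>f2\<close> can be chosen only now. The summand 1 keeps the
    denominator positive.\<close>
  have "\<epsilon> / (2 * (B1 + 1)) > 0"
    using \<open>\<epsilon> > 0\<close> B1 by simp
  then obtain h where h: "h \<in> G" "\<And>x. x \<in> K \<Longrightarrow> vnorm A (f2 x \<ominus>\<^bsub>A\<^esub> h x) \<le> \<epsilon> / (2 * (B1 + 1))"
    using A.uniform_closureD[OF f(2)] by metis
  have "vnorm A (f1 x \<otimes>\<^bsub>A\<^esub> f2 x \<ominus>\<^bsub>A\<^esub> g1 x \<otimes>\<^bsub>A\<^esub> h x) \<le> \<epsilon>" if x: "x \<in> K" for x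
  proof -
    have [simp]: "f1 x \<in> carrier A" "f2 x \<in> carrier A" "g1 x \<in> carrier A" "h x \<in> carrier A"
      using f_closed g1(1) h(1) G bounded_lipschitz_closed x by (auto simp: PiE_iff subset_iff)
    have "vnorm A (f1 x \<otimes>\<^bsub>A\<^esub> f2 x \<ominus>\<^bsub>A\<^esub> g1 x \<otimes>\<^bsub>A\<^esub> h x)
      \<le> vnorm A (f1 x \<ominus>\<^bsub>A\<^esub> g1 x) * vnorm A (f2 x) + vnorm A (g1 x) * vnorm A (f2 x \<ominus>\<^bsub>A\<^esub> h x)"
      by (simp add: A.vnorm_mult_dist)
    also have "\<dots> \<le> \<epsilon> / (2 * M) * M + (B1 + 1) * (\<epsilon> / (2 * (B1 + 1)))"
      using g1(2)[OF x] fM[OF x] B1(1) B1(2)[OF x] h(2)[OF x] \<open>\<epsilon> / (2 * M) > 0\<close>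
      by (intro add_mono mult_mono) auto
    also have "\<dots> = \<epsilon>"
      using M B1(1) by (simp add: field_simps)
    finally show ?thesis .
  qed
  then show "\<exists>g\<in>G. \<forall>x\<in>K. vnorm A ((\<lambda>x\<in>K. f1 x \<otimes>\<^bsub>A\<^esub> f2 x) x \<ominus>\<^bsub>A\<^esub> g x) \<le> \<epsilon>"
    using closed[OF g1(1) h(1)] by (intro bexI[of _ "\<lambda>x\<in>K. g1 x \<otimes>\<^bsub>A\<^esub> h x"]) auto
qed

end

section \<open>Polynomials of finite type\<close>

text \<open>All constants are listed separately because a power with exponent 0 would contribute
  only the unit, whereas a homogeneous polynomial of degree 0 may have any value in
  \<open>A\<close>.\<close>

definition power_monomials ::
    "(complex, 'a, 'm) normed_module_scheme \<Rightarrow> 'a set \<Rightarrow> (complex, 'b, 'n) normed_module_scheme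
      \<Rightarrow> ('a \<Rightarrow> 'b) set"
  where "power_monomials E K A = {\<lambda>x\<in>K. a | a. a \<in> carrier A} \<union>
    {\<lambda>x\<in>K. T x [^]\<^bsub>A\<^esub> n | T (n :: nat). T \<in> bounded_operators E A \<and> 0 < n}"

text \<open>Exponent 0 is allowed and yields the constants: \<open>\<phi> x ^ 0 = 1\<close> even
  where \<open>\<phi>\<close> vanishes.\<close>

definition tensor_monomials ::
    "(complex, 'a, 'm) normed_module_scheme \<Rightarrow> 'a set \<Rightarrow> (complex, 'b, 'n) normed_module_scheme
      \<Rightarrow> ('a \<Rightarrow> 'b) set"
  where "tensor_monomials E K F =
    {\<lambda>x\<in>K. \<phi> x ^ n \<odot>\<^bsub>F\<^esub> a | \<phi> (n :: nat) a. \<phi> \<in> bounded_operators E complex_alg \<and> a \<in> carrier F}"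

abbreviation power_span ::
    "(complex, 'a, 'm) normed_module_scheme \<Rightarrow> 'a set \<Rightarrow> (complex, 'b, 'n) normed_module_scheme
      \<Rightarrow> ('a \<Rightarrow> 'b) set"
  where "power_span E K A \<equiv> fin_sums K A (power_monomials E K A)"

abbreviation tensor_span ::
    "(complex, 'a, 'm) normed_module_scheme \<Rightarrow> 'a set \<Rightarrow> (complex, 'b, 'n) normed_module_scheme
      \<Rightarrow> ('a \<Rightarrow> 'b) set"
  where "tensor_span E K F \<equiv> fin_sums K F (tensor_monomials E K F)"

context compact_pair_algebra
begin

lemma power_monomials_bounded_lipschitz: "power_monomials E K A \<subseteq> bounded_lipschitz E K A"
proof -
  have "(\<lambda>x\<in>K. T x [^]\<^bsub>A\<^esub> n) \<in> bounded_lipschitz E K A"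
    if "T \<in> bounded_operators E A" for T and n :: nat
  proof -
    have "(\<lambda>x\<in>K. (\<lambda>x\<in>K. T x) x [^]\<^bsub>A\<^esub> n) = (\<lambda>x\<in>K. T x [^]\<^bsub>A\<^esub> n)"
      by auto
    then show ?thesis
      using bounded_lipschitz_pow[OF bounded_lipschitz_operator[OF that], of n] by (simp only:)
  qed
  then show ?thesis
    unfolding power_monomials_def by (auto intro: bounded_lipschitz_const)
qed

lemma power_monomials_closed: "power_monomials E K A \<subseteq> K \<rightarrow>\<^sub>E carrier A"
  using power_monomials_bounded_lipschitz bounded_lipschitz_closed by blast

lemma power_span_bounded_lipschitz: "power_span E K A \<subseteq> bounded_lipschitz E K A"
  by (rule bounded_lipschitz_fin_sums[OF power_monomials_bounded_lipschitz])

lemma power_span_closed: "power_span E K A \<subseteq> K \<rightarrow>\<^sub>E carrier A"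
  using power_span_bounded_lipschitz bounded_lipschitz_closed by blast

end

context compact_pair
begin

lemma compact_pair_algebra_complex: "compact_pair_algebra E complex_alg K"
  by (intro compact_pair_algebra.intro compact_pair_algebra_axioms.intro compact
      E.complex_normed_space_axioms comm_unital_banach_algebra_complex_alg)

lemma bounded_lipschitz_smult_const:
  assumes f: "f \<in> bounded_lipschitz E K complex_alg" and a: "a \<in> carrier F"
  shows "(\<lambda>x\<in>K. f x \<odot>\<^bsub>F\<^esub> a) \<in> bounded_lipschitz E K F"
proof -
  interpret C: compact_pair_algebra E complex_alg K
    by (rule compact_pair_algebra_complex)
  obtain B L where BL: "\<And>x. x \<in> K \<Longrightarrow> cmod (f x) \<le> B"
    "\<And>x y. \<lbrakk>x \<in> K; y \<in> K\<rbrakk> \<Longrightarrow> cmod (f x - f y) \<le> L * vnorm E (x \<ominus>\<^bsub>E\<^esub> y)"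
    using C.bounded_lipschitzD[OF f] by (metis complex_alg_simps(7) complex_alg_diff)
  show ?thesis
  proof (rule bounded_lipschitzI[where B = "B * vnorm F a" and L = "L * vnorm F a"])
    fix x assume "x \<in> K"
    then show "vnorm F ((\<lambda>x\<in>K. f x \<odot>\<^bsub>F\<^esub> a) x) \<le> B * vnorm F a"
      using BL(1) a by (simp add: F.vnorm_smult mult_right_mono)
  next
    fix x y assume "x \<in> K" "y \<in> K"
    then show "vnorm F ((\<lambda>x\<in>K. f x \<odot>\<^bsub>F\<^esub> a) x \<ominus>\<^bsub>F\<^esub> (\<lambda>x\<in>K. f x \<odot>\<^bsub>F\<^esub> a) y)
        \<le> L * vnorm F a * vnorm E (x \<ominus>\<^bsub>E\<^esub> y)"
      using mult_right_mono[OF BL(2)[of x y], of "vnorm F a"] a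
      by (simp add: F.smult_diff_left F.vnorm_smult mult.commute mult.left_commute)
  qed (use a in auto)
qed

lemma tensor_monomials_bounded_lipschitz: "tensor_monomials E K F \<subseteq> bounded_lipschitz E K F"
proof
  interpret C: compact_pair_algebra E complex_alg K
    by (rule compact_pair_algebra_complex)
  fix g assume "g \<in> tensor_monomials E K F"
  then obtain \<phi> n a where g: "g = (\<lambda>x\<in>K. \<phi> x ^ n \<odot>\<^bsub>F\<^esub> a)"
    and \<phi>: "\<phi> \<in> bounded_operators E complex_alg" and a: "a \<in> carrier F"
    unfolding tensor_monomials_def by blast
  have "(\<lambda>x\<in>K. (\<lambda>x\<in>K. (\<lambda>x\<in>K. \<phi> x) x [^]\<^bsub>complex_alg\<^esub> n) x \<odot>\<^bsub>F\<^esub> a) = g"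
    by (auto simp: g)
  then show "g \<in> bounded_lipschitz E K F"
    using bounded_lipschitz_smult_const[OF C.bounded_lipschitz_pow[OF C.bounded_lipschitz_operator[OF \<phi>]] a]
    by metis
qed

lemma tensor_monomials_closed: "tensor_monomials E K F \<subseteq> K \<rightarrow>\<^sub>E carrier F"
  using tensor_monomials_bounded_lipschitz bounded_lipschitz_closed by blast

lemma tensor_span_bounded_lipschitz: "tensor_span E K F \<subseteq> bounded_lipschitz E K F"
  by (rule bounded_lipschitz_fin_sums[OF tensor_monomials_bounded_lipschitz])

lemma tensor_span_closed: "tensor_span E K F \<subseteq> K \<rightarrow>\<^sub>E carrier F"
  using tensor_span_bounded_lipschitz bounded_lipschitz_closed by blast

end

text \<open>Lets the homogeneous part of a given degree absorb a function that is added to a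
  polynomial.\<close>

lemma (in complex_normed_space) finsum_add_at:
  assumes "finite I" "m \<in> I" "f \<in> I \<rightarrow> carrier V" "c \<in> carrier V"
  shows "finsum V (f(m := c \<oplus> f m)) I = c \<oplus> finsum V f I"
proof -
  have eq: "finsum V (f(m := c \<oplus> f m)) (I - {m}) = finsum V f (I - {m})"
    using assms by (intro M.finsum_cong') auto
  have "finsum V (f(m := c \<oplus> f m)) (insert m (I - {m})) = (c \<oplus> f m) \<oplus> finsum V f (I - {m})"
    using assms by (subst M.finsum_insert) (auto simp: eq)
  moreover have "finsum V f (insert m (I - {m})) = f m \<oplus> finsum V f (I - {m})"
    using assms by (subst M.finsum_insert) auto
  moreover have "finsum V f (I - {m}) \<in> carrier V"
    using assms by (intro M.finsum_closed) auto
  ultimately show ?thesis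
    using assms by (simp add: insert_absorb M.a_assoc Pi_iff)
qed

section \<open>Restrictions of polynomials and the closure of \<open>power_span\<close>\<close>

context compact_pair_algebra
begin

lemma homogeneous_polys_closed:
  "P \<in> homogeneous_polys k E A \<Longrightarrow> P \<in> carrier E \<rightarrow>\<^sub>E carrier A"
  by (auto simp: homogeneous_polys_def split: if_splits)

lemma homogeneous_polysI:
  assumes "0 < n" "P \<in> carrier E \<rightarrow>\<^sub>E carrier A" "\<And>i. T i \<in> bounded_operators E A"
    and "summable (\<lambda>i. operator_norm E A (T i) ^ n)"
    and "\<And>x. x \<in> carrier E \<Longrightarrow>
      limitin (norm_topology A) (\<lambda>N. \<Oplus>\<^bsub>A\<^esub>i\<in>{..<N}. T i x [^]\<^bsub>A\<^esub> n) (P x) sequentially"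
  shows "P \<in> homogeneous_polys n E A"
  using assms by (auto simp: homogeneous_polys_def)

lemma homogeneous_polysE:
  assumes "P \<in> homogeneous_polys n E A" "0 < n"
  obtains T where "\<And>i. T i \<in> bounded_operators E A"
    "summable (\<lambda>i. operator_norm E A (T i) ^ n)"
    "\<And>x. x \<in> carrier E \<Longrightarrow>
      limitin (norm_topology A) (\<lambda>N. \<Oplus>\<^bsub>A\<^esub>i\<in>{..<N}. T i x [^]\<^bsub>A\<^esub> n) (P x) sequentially"
  using assms by (auto simp: homogeneous_polys_def)

lemma bounded_operators_closed' [simp]:
  "\<lbrakk>T \<in> bounded_operators E A; x \<in> carrier E\<rbrakk> \<Longrightarrow> T x \<in> carrier A"
  by (rule bounded_operators_closed)

text \<open>Supplies the parts of a polynomial in degrees beyond those it was given with.\<close>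

lemma homogeneous_polys_zero: "(\<lambda>x\<in>carrier E. \<zero>\<^bsub>A\<^esub>) \<in> homogeneous_polys n E A"
proof (cases "n = 0")
  case True
  then show ?thesis
    by (auto simp: homogeneous_polys_def)
next
  case False
  \<comment> \<open>The supremum of a constant function equals that constant only over a nonempty
    set; the zero vector is in the unit ball.\<close>
  have "{x \<in> carrier E. vnorm E x \<le> 1} \<noteq> {}"
    using E.M.zero_closed E.vnorm_zero by (metis (mono_tags, lifting) empty_iff mem_Collect_eq zero_le_one)
  then have norm: "operator_norm E A (\<lambda>_. \<zero>\<^bsub>A\<^esub>) = 0"
    by (simp add: operator_norm_def)
  have pow: "\<zero>\<^bsub>A\<^esub> [^]\<^bsub>A\<^esub> n = \<zero>\<^bsub>A\<^esub>"
    using False by (simp add: A.nat_pow_zero)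
  show ?thesis
  proof (rule homogeneous_polysI[where T = "\<lambda>_ _. \<zero>\<^bsub>A\<^esub>"])
    show "(\<lambda>_. \<zero>\<^bsub>A\<^esub>) \<in> bounded_operators E A"
      by (rule bounded_operatorsI[where C = 0]) auto
    show "limitin (norm_topology A) (\<lambda>N. \<Oplus>\<^bsub>A\<^esub>i\<in>{..<N}. \<zero>\<^bsub>A\<^esub> [^]\<^bsub>A\<^esub> n)
        ((\<lambda>x\<in>carrier E. \<zero>\<^bsub>A\<^esub>) x) sequentially" if "x \<in> carrier E" for x
      using that by (simp add: pow A.limitin_norm_topology)
  qed (use False norm in \<open>auto simp: power_0_left\<close>)
qed

lemma homogeneous_polys_add_const:
  assumes "a \<in> carrier A" "P \<in> homogeneous_polys 0 E A"
  shows "(\<lambda>x\<in>carrier E. a \<oplus>\<^bsub>A\<^esub> P x) \<in> homogeneous_polys 0 E A"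
proof -
  obtain b where b: "b \<in> carrier A" "P = (\<lambda>x\<in>carrier E. b)"
    using assms(2) by (auto simp: homogeneous_polys_def)
  have "(\<lambda>x\<in>carrier E. a \<oplus>\<^bsub>A\<^esub> P x) = (\<lambda>x\<in>carrier E. a \<oplus>\<^bsub>A\<^esub> b)"
    by (auto simp: b)
  moreover have "a \<oplus>\<^bsub>A\<^esub> b \<in> carrier A"
    using assms(1) b by simp
  ultimately show ?thesis
    by (auto simp: homogeneous_polys_def)
qed

text \<open>\<open>T\<close> is put in front of the sequence of operators that represents
  \<open>P\<close>. Summability survives the addition of one term, and every partial sum grows by
  \<open>T x\<close> to the power \<open>n\<close>.\<close>

lemma homogeneous_polys_add_power:
  assumes T: "T \<in> bounded_operators E A" and n: "0 < n" and P: "P \<in> homogeneous_polys n E A"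
  shows "(\<lambda>x\<in>carrier E. T x [^]\<^bsub>A\<^esub> n \<oplus>\<^bsub>A\<^esub> P x) \<in> homogeneous_polys n E A"
proof -
  obtain S where S: "\<And>i. S i \<in> bounded_operators E A"
    and sum: "summable (\<lambda>i. operator_norm E A (S i) ^ n)"
    and lim: "\<And>x. x \<in> carrier E \<Longrightarrow>
      limitin (norm_topology A) (\<lambda>N. \<Oplus>\<^bsub>A\<^esub>i\<in>{..<N}. S i x [^]\<^bsub>A\<^esub> n) (P x) sequentially"
    using homogeneous_polysE[OF P n] by blast
  have Px [simp]: "P x \<in> carrier A" if "x \<in> carrier E" for x
    using homogeneous_polys_closed[OF P] that by (auto simp: PiE_iff)
  have Tx [simp]: "T x \<in> carrier A" "S i x \<in> carrier A" if "x \<in> carrier E" for x i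
    using T S that by simp_all
  define T' where "T' i = (case i of 0 \<Rightarrow> T | Suc i \<Rightarrow> S i)" for i
  have T'_simps [simp]: "T' 0 = T" "\<And>i. T' (Suc i) = S i"
    by (simp_all add: T'_def)
  have T': "T' i \<in> bounded_operators E A" for i
    using T S by (cases i) simp_all
  show ?thesis
  proof (rule homogeneous_polysI[where T = T'])
    show "summable (\<lambda>i. operator_norm E A (T' i) ^ n)"
      using sum by (subst summable_Suc_iff[symmetric]) simp
    fix x assume x: "x \<in> carrier E"
    have T'x [simp]: "T' i x \<in> carrier A" for i
      using T' x by simp
    show "limitin (norm_topology A) (\<lambda>N. \<Oplus>\<^bsub>A\<^esub>i\<in>{..<N}. T' i x [^]\<^bsub>A\<^esub> n)
        ((\<lambda>x\<in>carrier E. T x [^]\<^bsub>A\<^esub> n \<oplus>\<^bsub>A\<^esub> P x) x) sequentially"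
      unfolding A.limitin_norm_topology[OF A.M.finsum_closed[OF funcsetI[OF A.nat_pow_closed[OF T'x]]]]
    proof (intro conjI allI impI)
      fix \<epsilon> :: real assume "\<epsilon> > 0"
      then obtain N where N: "\<And>m. m \<ge> N \<Longrightarrow>
          vnorm A ((\<Oplus>\<^bsub>A\<^esub>i\<in>{..<m}. S i x [^]\<^bsub>A\<^esub> n) \<ominus>\<^bsub>A\<^esub> P x) < \<epsilon>"
        using lim[OF x] x by (subst (asm) A.limitin_norm_topology) (auto intro!: A.M.finsum_closed)
      \<comment> \<open>The first \<open>m\<close> terms of the new series contain
        \<open>m - 1\<close> terms of the old one, hence the threshold \<open>Suc N\<close>.\<close>
      have "vnorm A ((\<Oplus>\<^bsub>A\<^esub>i\<in>{..<m}. T' i x [^]\<^bsub>A\<^esub> n) \<ominus>\<^bsub>A\<^esub> (T x [^]\<^bsub>A\<^esub> n \<oplus>\<^bsub>A\<^esub> P x)) < \<epsilon>"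
        if m: "m \<ge> Suc N" for m
      proof -
        obtain m' where m': "m = Suc m'" "m' \<ge> N"
          using m by (cases m) auto
        let ?s = "\<Oplus>\<^bsub>A\<^esub>i\<in>{..<m'}. S i x [^]\<^bsub>A\<^esub> n"
        have s: "?s \<in> carrier A"
          using x by (intro A.M.finsum_closed) auto
        have "(\<Oplus>\<^bsub>A\<^esub>i\<in>{..<m}. T' i x [^]\<^bsub>A\<^esub> n) = T x [^]\<^bsub>A\<^esub> n \<oplus>\<^bsub>A\<^esub> ?s"
          unfolding m' by (subst A.finsum_lessThan_Suc_shift) auto
        then show ?thesis
          using A.vnorm_add_dist[of "T x [^]\<^bsub>A\<^esub> n" ?s "T x [^]\<^bsub>A\<^esub> n" "P x"] s x N[OF m'(2)] by simp
      qed
      then show "\<exists>N. \<forall>m\<ge>N. vnorm A ((\<Oplus>\<^bsub>A\<^esub>i\<in>{..<m}. T' i x [^]\<^bsub>A\<^esub> n)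
          \<ominus>\<^bsub>A\<^esub> (\<lambda>x\<in>carrier E. T x [^]\<^bsub>A\<^esub> n \<oplus>\<^bsub>A\<^esub> P x) x) < \<epsilon>"
        using x by (intro exI[of _ "Suc N"]) simp
    qed (use x in simp)
  qed (use n T' in auto)
qed

lemma polys_zero: "(\<lambda>x\<in>carrier E. \<zero>\<^bsub>A\<^esub>) \<in> polys E A"
proof -
  have "(\<lambda>x\<in>carrier E. \<Oplus>\<^bsub>A\<^esub>k\<in>{..0::nat}. (\<lambda>x\<in>carrier E. \<zero>\<^bsub>A\<^esub>) x) = (\<lambda>x\<in>carrier E. \<zero>\<^bsub>A\<^esub>)"
    by auto
  then show ?thesis
    unfolding polys_def using homogeneous_polys_zero
    by (intro CollectI exI[of _ 0] exI[of _ "\<lambda>_. \<lambda>x\<in>carrier E. \<zero>\<^bsub>A\<^esub>"]) auto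
qed

text \<open>The part of degree \<open>m\<close> absorbs \<open>h\<close>; zero parts are first
  appended, as \<open>m\<close> may exceed the degree of the given representation. With
  \<open>h\<close> abstract, constants and powers of operators are handled alike.\<close>

lemma polys_add:
  assumes P: "P \<in> polys E A" and h: "h \<in> carrier E \<rightarrow> carrier A"
    and add: "\<And>Q. Q \<in> homogeneous_polys m E A \<Longrightarrow>
      (\<lambda>x\<in>carrier E. h x \<oplus>\<^bsub>A\<^esub> Q x) \<in> homogeneous_polys m E A"
  shows "(\<lambda>x\<in>carrier E. h x \<oplus>\<^bsub>A\<^esub> P x) \<in> polys E A"
proof -
  obtain n Q where P_eq: "P = (\<lambda>x\<in>carrier E. \<Oplus>\<^bsub>A\<^esub>k\<in>{..n}. Q k x)"
    and Q: "\<And>k. k \<le> n \<Longrightarrow> Q k \<in> homogeneous_polys k E A"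
    using P unfolding polys_def by blast
  define Q' where "Q' k = (if k \<le> n then Q k else (\<lambda>x\<in>carrier E. \<zero>\<^bsub>A\<^esub>))" for k
  define R where "R = Q'(m := \<lambda>x\<in>carrier E. h x \<oplus>\<^bsub>A\<^esub> Q' m x)"
  have Q': "Q' k \<in> homogeneous_polys k E A" for k
    using Q homogeneous_polys_zero by (simp add: Q'_def)
  have R: "R k \<in> homogeneous_polys k E A" for k
    using Q' add by (simp add: R_def)
  have Q'x: "Q' k x \<in> carrier A" if "x \<in> carrier E" for k x
    using homogeneous_polys_closed[OF Q'[of k]] that by (auto simp: PiE_iff)
  have "(\<Oplus>\<^bsub>A\<^esub>k\<in>{..max n m}. R k x) = h x \<oplus>\<^bsub>A\<^esub> P x" if x: "x \<in> carrier E" for x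
  proof -
    have "(\<Oplus>\<^bsub>A\<^esub>k\<in>{..max n m}. R k x)
        = finsum A ((\<lambda>k. Q' k x)(m := h x \<oplus>\<^bsub>A\<^esub> Q' m x)) {..max n m}"
      using Q'x[OF x] h x by (intro A.M.finsum_cong') (auto simp: R_def Pi_iff)
    also have "\<dots> = h x \<oplus>\<^bsub>A\<^esub> (\<Oplus>\<^bsub>A\<^esub>k\<in>{..max n m}. Q' k x)"
      using Q'x[OF x] h x by (intro A.finsum_add_at) auto
    also have "(\<Oplus>\<^bsub>A\<^esub>k\<in>{..max n m}. Q' k x) = (\<Oplus>\<^bsub>A\<^esub>k\<in>{..n}. Q' k x)"
      using Q'x[OF x] x by (intro A.M.add.finprod_mono_neutral_cong_right) (auto simp: Q'_def)
    also have "\<dots> = (\<Oplus>\<^bsub>A\<^esub>k\<in>{..n}. Q k x)"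
      using homogeneous_polys_closed[OF Q] x by (intro A.M.finsum_cong') (auto simp: Q'_def PiE_iff)
    finally show ?thesis
      using x by (simp add: P_eq)
  qed
  then have "(\<lambda>x\<in>carrier E. h x \<oplus>\<^bsub>A\<^esub> P x) = (\<lambda>x\<in>carrier E. \<Oplus>\<^bsub>A\<^esub>k\<in>{..max n m}. R k x)"
    by (intro restrict_ext) simp
  then show ?thesis
    unfolding polys_def using R by blast
qed

lemma power_span_subset_polys: "power_span E K A \<subseteq> (\<lambda>P. restrict P K) ` polys E A"
proof
  fix f assume "f \<in> power_span E K A"
  then show "f \<in> (\<lambda>P. restrict P K) ` polys E A"
  proof induction
    case zero
    have "(\<lambda>x\<in>K. \<zero>\<^bsub>A\<^esub>) = restrict (\<lambda>x\<in>carrier E. \<zero>\<^bsub>A\<^esub>) K"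
      using K_subset by (auto simp: fun_eq_iff)
    then show "(\<lambda>x\<in>K. \<zero>\<^bsub>A\<^esub>) \<in> (\<lambda>P. restrict P K) ` polys E A"
      using polys_zero by (simp only: image_eqI)
  next
    case (add g f)
    then obtain P where P: "P \<in> polys E A" "f = restrict P K"
      by blast
    consider a where "a \<in> carrier A" "g = (\<lambda>x\<in>K. a)"
      | T n where "T \<in> bounded_operators E A" "0 < n" "g = (\<lambda>x\<in>K. T x [^]\<^bsub>A\<^esub> (n :: nat))"
      using add.hyps(1) unfolding power_monomials_def by blast
    \<comment> \<open>Either kind of generator extends to a function \<open>h\<close> on the whole
      carrier that can be added to homogeneous polynomials of one degree \<open>m\<close>; for a
      constant this degree is 0.\<close>
    then obtain h m where h: "h \<in> carrier E \<rightarrow> carrier A" "g = restrict h K"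
      "\<And>Q. Q \<in> homogeneous_polys m E A \<Longrightarrow>
        (\<lambda>x\<in>carrier E. h x \<oplus>\<^bsub>A\<^esub> Q x) \<in> homogeneous_polys m E A"
    proof cases
      case 1
      then show thesis
        by (intro that[of "\<lambda>_. a" 0]) (auto intro: homogeneous_polys_add_const)
    next
      case 2
      then show thesis
        by (intro that[of "\<lambda>x. T x [^]\<^bsub>A\<^esub> n" n]) (auto intro: homogeneous_polys_add_power)
    qed
    have "(\<lambda>x\<in>K. g x \<oplus>\<^bsub>A\<^esub> f x) = restrict (\<lambda>x\<in>carrier E. h x \<oplus>\<^bsub>A\<^esub> P x) K"
      using K_subset by (auto simp: fun_eq_iff h P)
    then show "(\<lambda>x\<in>K. g x \<oplus>\<^bsub>A\<^esub> f x) \<in> (\<lambda>P. restrict P K) ` polys E A"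
      using polys_add[OF P(1) h(1,3)] by (simp only: image_eqI)
  qed
qed

lemma power_span_sum:
  fixes n N :: nat
  assumes "\<And>i. T i \<in> bounded_operators E A" "0 < n"
  shows "(\<lambda>x\<in>K. \<Oplus>\<^bsub>A\<^esub>i\<in>{..<N}. T i x [^]\<^bsub>A\<^esub> n) \<in> power_span E K A"
proof (induction N)
  case 0
  have "(\<lambda>x\<in>K. \<Oplus>\<^bsub>A\<^esub>i\<in>{..<0::nat}. T i x [^]\<^bsub>A\<^esub> n) = (\<lambda>x\<in>K. \<zero>\<^bsub>A\<^esub>)"
    by auto
  then show ?case
    by (simp only: fin_sums.zero)
next
  case (Suc N)
  have "(\<lambda>x\<in>K. (\<lambda>x\<in>K. T N x [^]\<^bsub>A\<^esub> n) x \<oplus>\<^bsub>A\<^esub> (\<lambda>x\<in>K. \<Oplus>\<^bsub>A\<^esub>i\<in>{..<N}. T i x [^]\<^bsub>A\<^esub> n) x)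
      = (\<lambda>x\<in>K. \<Oplus>\<^bsub>A\<^esub>i\<in>{..<Suc N}. T i x [^]\<^bsub>A\<^esub> n)"
  proof (rule restrict_ext)
    fix x assume "x \<in> K"
    then have "T i x \<in> carrier A" for i
      using assms K_subset by auto
    with \<open>x \<in> K\<close> show "(\<lambda>x\<in>K. T N x [^]\<^bsub>A\<^esub> n) x \<oplus>\<^bsub>A\<^esub> (\<lambda>x\<in>K. \<Oplus>\<^bsub>A\<^esub>i\<in>{..<N}. T i x [^]\<^bsub>A\<^esub> n) x
        = (\<Oplus>\<^bsub>A\<^esub>i\<in>{..<Suc N}. T i x [^]\<^bsub>A\<^esub> n)"
      by (subst A.finsum_lessThan_Suc) auto
  qed
  moreover have mono: "(\<lambda>x\<in>K. T N x [^]\<^bsub>A\<^esub> n) \<in> power_monomials E K A"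
    using assms unfolding power_monomials_def by blast
  ultimately show ?case
    using fin_sums.add[OF mono Suc] by (simp only:)
qed

text \<open>The Weierstrass test: on \<open>K\<close> the i-th term is at most ||T_i||^n R^n, which
  is summable. So the partial sums, which lie in \<open>power_span\<close>, are uniformly Cauchy
  there, and their pointwise limit \<open>P\<close> is a uniform limit.\<close>

lemma restrict_homogeneous_polys:
  assumes P: "P \<in> homogeneous_polys n E A"
  shows "restrict P K \<in> uniform_closure K A (power_span E K A)"
proof (cases "n = 0")
  case True
  then obtain a where a: "a \<in> carrier A" "P = (\<lambda>x\<in>carrier E. a)"
    using P by (auto simp: homogeneous_polys_def)
  then have "restrict P K = (\<lambda>x\<in>K. a)"
    using K_subset by (auto simp: fun_eq_iff)
  then have "restrict P K \<in> power_monomials E K A"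
    using a(1) unfolding power_monomials_def by blast
  then show ?thesis
    using A.fin_sums_superset[OF power_monomials_closed] A.uniform_closure_superset[OF power_span_closed]
    by blast
next
  case False
  then have n: "0 < n" by simp
  obtain T where T: "\<And>i. T i \<in> bounded_operators E A"
    and sum: "summable (\<lambda>i. operator_norm E A (T i) ^ n)"
    and lim: "\<And>x. x \<in> carrier E \<Longrightarrow>
      limitin (norm_topology A) (\<lambda>N. \<Oplus>\<^bsub>A\<^esub>i\<in>{..<N}. T i x [^]\<^bsub>A\<^esub> n) (P x) sequentially"
    using homogeneous_polysE[OF P n] by blast
  obtain R where R: "R > 0" "\<And>x. x \<in> K \<Longrightarrow> vnorm E x \<le> R"
    using K_bounded by blast
  define b where "b i = operator_norm E A (T i) ^ n * R ^ n" for i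
  have "summable b"
    unfolding b_def by (rule summable_mult2[OF sum])
  have b: "vnorm A (T i x [^]\<^bsub>A\<^esub> n) \<le> b i" if "x \<in> K" for i x
  proof -
    have x: "x \<in> carrier E"
      using that K_subset by blast
    have "vnorm A (T i x [^]\<^bsub>A\<^esub> n) \<le> vnorm A (T i x) ^ n"
      using T x by (intro A.vnorm_pow) simp
    also have "\<dots> \<le> (operator_norm E A (T i) * vnorm E x) ^ n"
      using T x by (intro power_mono operator_norm_bound(1)) (auto intro: E.complex_normed_space_axioms A.complex_normed_space_axioms)
    also have "\<dots> \<le> (operator_norm E A (T i) * R) ^ n"
      using x R(2)[OF that] operator_norm_bound(2)[OF E.complex_normed_space_axioms A.complex_normed_space_axioms T x]
      by (intro power_mono mult_left_mono mult_nonneg_nonneg) auto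
    finally show ?thesis
      by (simp add: b_def power_mult_distrib)
  qed
  let ?S = "\<lambda>N x. \<Oplus>\<^bsub>A\<^esub>i\<in>{..<N}. T i x [^]\<^bsub>A\<^esub> n"
  have Tx [simp]: "T i x \<in> carrier A" if "x \<in> carrier E" for i x
    using T that by simp
  have S_closed [simp]: "?S N x \<in> carrier A" if "x \<in> carrier E" for N x
    using that by (intro A.M.finsum_closed) auto
  have S_diff: "vnorm A (?S N x \<ominus>\<^bsub>A\<^esub> ?S M x) \<le> sum b {M..<N}" if "x \<in> K" "M \<le> N" for M N x
    using \<open>M \<le> N\<close>
  proof (induction N rule: dec_induct)
    case base
    then show ?case
      using \<open>x \<in> K\<close> K_subset by (simp add: subset_iff)
  next
    case (step N)
    have x: "x \<in> carrier E"
      using \<open>x \<in> K\<close> K_subset by blast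
    \<comment> \<open>The inserted zero is the partner of the new term, so that
      \<open>vnorm_add_dist\<close> separates this term from the difference in the induction
      hypothesis.\<close>
    have "vnorm A (?S (Suc N) x \<ominus>\<^bsub>A\<^esub> ?S M x)
      = vnorm A ((T N x [^]\<^bsub>A\<^esub> n \<oplus>\<^bsub>A\<^esub> ?S N x) \<ominus>\<^bsub>A\<^esub> (\<zero>\<^bsub>A\<^esub> \<oplus>\<^bsub>A\<^esub> ?S M x))"
      using x by (subst A.finsum_lessThan_Suc) auto
    also have "\<dots> \<le> vnorm A (T N x [^]\<^bsub>A\<^esub> n \<ominus>\<^bsub>A\<^esub> \<zero>\<^bsub>A\<^esub>) + vnorm A (?S N x \<ominus>\<^bsub>A\<^esub> ?S M x)"
      using x by (intro A.vnorm_add_dist) auto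
    also have "\<dots> \<le> b N + sum b {M..<N}"
      using step.IH b[OF \<open>x \<in> K\<close>, of N] x by (intro add_mono) (auto simp: a_minus_def)
    finally show ?case
      using step.hyps by simp
  qed
  show ?thesis
  proof (rule A.uniform_closureI)
    show "restrict P K \<in> K \<rightarrow>\<^sub>E carrier A"
      using homogeneous_polys_closed[OF P] K_subset by (auto simp: PiE_iff)
    fix \<epsilon> :: real assume "\<epsilon> > 0"
    then obtain M where M: "\<And>m N. m \<ge> M \<Longrightarrow> norm (sum b {m..<N}) < \<epsilon> / 2"
      using \<open>summable b\<close> unfolding summable_Cauchy by (meson half_gt_zero)
    have "vnorm A (P x \<ominus>\<^bsub>A\<^esub> ?S M x) \<le> \<epsilon>" if "x \<in> K" for x
    proof -
      have x: "x \<in> carrier E"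
        using that K_subset by blast
      \<comment> \<open>This \<open>N\<close> depends on \<open>x\<close>, but \<open>M\<close> does
        not: the distance from the partial sum at \<open>M\<close> to any later one is bounded by a
        tail of \<open>b\<close>, the same for all \<open>x\<close> in \<open>K\<close>.\<close>
      obtain N where N: "P x \<in> carrier A" "\<And>m. m \<ge> N \<Longrightarrow> vnorm A (?S m x \<ominus>\<^bsub>A\<^esub> P x) < \<epsilon> / 2"
        using lim[OF x] \<open>\<epsilon> > 0\<close> unfolding A.limitin_norm_topology[OF S_closed[OF x]]
        by (meson half_gt_zero)
      let ?N = "max M N"
      have "vnorm A (P x \<ominus>\<^bsub>A\<^esub> ?S M x) \<le> vnorm A (P x \<ominus>\<^bsub>A\<^esub> ?S ?N x) + vnorm A (?S ?N x \<ominus>\<^bsub>A\<^esub> ?S M x)"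
        using x N(1) by (intro A.vnorm_dist_triangle) auto
      also have "\<dots> \<le> \<epsilon> / 2 + \<epsilon> / 2"
        using N(2)[of ?N] S_diff[OF that, of M ?N] M[of M ?N] x N(1)
        by (simp add: A.vnorm_diff_commute[of "P x"])
      finally show ?thesis
        by simp
    qed
    then show "\<exists>g\<in>power_span E K A. \<forall>x\<in>K. vnorm A (restrict P K x \<ominus>\<^bsub>A\<^esub> g x) \<le> \<epsilon>"
      by (intro bexI[OF _ power_span_sum[OF T n, where N = M]]) auto
  qed
qed

lemma restrict_polys:
  assumes P: "P \<in> polys E A"
  shows "restrict P K \<in> uniform_closure K A (power_span E K A)"
proof -
  obtain n Q where P_eq: "P = (\<lambda>x\<in>carrier E. \<Oplus>\<^bsub>A\<^esub>k\<in>{..n}. Q k x)"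
    and Q: "\<And>k. k \<le> n \<Longrightarrow> Q k \<in> homogeneous_polys k E A"
    using P unfolding polys_def by blast
  have Qx: "Q k x \<in> carrier A" if "x \<in> K" "k \<le> n" for k x
    using homogeneous_polys_closed[OF Q[OF that(2)]] that K_subset by (auto simp: PiE_iff)
  have "(\<lambda>x\<in>K. \<Oplus>\<^bsub>A\<^esub>k\<in>{..m}. Q k x) \<in> uniform_closure K A (power_span E K A)" if "m \<le> n" for m
    using that
  proof (induction m)
    case 0
    have "(\<lambda>x\<in>K. \<Oplus>\<^bsub>A\<^esub>k\<in>{..0}. Q k x) = restrict (Q 0) K"
      using Qx by (auto simp: fun_eq_iff)
    then show ?case
      using restrict_homogeneous_polys[OF Q[OF le0]] by (simp only:)
  next
    case (Suc m)
    have "(\<lambda>x\<in>K. restrict (Q (Suc m)) K x \<oplus>\<^bsub>A\<^esub> (\<lambda>x\<in>K. \<Oplus>\<^bsub>A\<^esub>k\<in>{..m}. Q k x) x)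
        \<in> uniform_closure K A (power_span E K A)"
      using Suc.prems
      by (intro A.uniform_closure_add[OF power_span_closed A.fin_sums_add[OF power_monomials_closed]]
          restrict_homogeneous_polys[OF Q[OF Suc.prems]] Suc.IH) auto
    also have "(\<lambda>x\<in>K. restrict (Q (Suc m)) K x \<oplus>\<^bsub>A\<^esub> (\<lambda>x\<in>K. \<Oplus>\<^bsub>A\<^esub>k\<in>{..m}. Q k x) x)
        = (\<lambda>x\<in>K. \<Oplus>\<^bsub>A\<^esub>k\<in>{..Suc m}. Q k x)"
    proof (rule restrict_ext)
      fix x assume "x \<in> K"
      then show "restrict (Q (Suc m)) K x \<oplus>\<^bsub>A\<^esub> (\<lambda>x\<in>K. \<Oplus>\<^bsub>A\<^esub>k\<in>{..m}. Q k x) x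
          = (\<Oplus>\<^bsub>A\<^esub>k\<in>{..Suc m}. Q k x)"
        using Qx Suc.prems by (subst A.M.finsum_Suc) auto
    qed
    finally show ?case .
  qed
  moreover have "restrict P K = (\<lambda>x\<in>K. \<Oplus>\<^bsub>A\<^esub>k\<in>{..n}. Q k x)"
    using K_subset by (auto simp: P_eq fun_eq_iff)
  ultimately show ?thesis
    by simp
qed

text \<open>The restrictions of polynomials lie between \<open>power_span\<close> and its uniform
  closure, so they have the same closure.\<close>

lemma closed_polys_eq: "closed_polys E K A = uniform_closure K A (power_span E K A)"
proof -
  have sub: "(\<lambda>P. restrict P K) ` polys E A \<subseteq> uniform_closure K A (power_span E K A)"
    using restrict_polys by blast
  have "closed_polys E K A = uniform_closure K A ((\<lambda>P. restrict P K) ` polys E A)"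
    unfolding closed_polys_def
    using sub A.uniform_closure_mono[OF power_span_bounded_lipschitz]
    by (intro closure_of_continuous_functions) blast
  also have "\<dots> = uniform_closure K A (power_span E K A)"
    using A.uniform_closure_absorb[OF power_span_closed sub]
      A.uniform_closure_mono[OF power_span_subset_polys] by blast
  finally show ?thesis .
qed

end

section \<open>The tensor product and the closure of \<open>tensor_span\<close>\<close>

context compact_pair
begin

lemma tensor_monomialsI:
  "\<lbrakk>\<phi> \<in> bounded_operators E complex_alg; a \<in> carrier F\<rbrakk>
    \<Longrightarrow> (\<lambda>x\<in>K. \<phi> x ^ n \<odot>\<^bsub>F\<^esub> a) \<in> tensor_monomials E K F"
  unfolding tensor_monomials_def by blast

text \<open>Its power \<open>0 ^ 0 = 1\<close> writes constant functions as tensor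
  monomials.\<close>

lemma zero_functional: "(\<lambda>_. 0) \<in> bounded_operators E complex_alg"
  by (rule bounded_operatorsI[where C = 0]) auto

lemma nuclear_closed_polys_eq:
  "nuclear_closed_polys E K = uniform_closure K complex_alg (power_span E K complex_alg)"
  by (rule compact_pair_algebra.closed_polys_eq[OF compact_pair_algebra_complex])

lemma power_functional_nuclear:
  assumes "\<phi> \<in> bounded_operators E complex_alg"
  shows "(\<lambda>x\<in>K. \<phi> x ^ n) \<in> nuclear_closed_polys E K"
proof -
  interpret C: compact_pair_algebra E complex_alg K
    by (rule compact_pair_algebra_complex)
  have "(\<lambda>x\<in>K. \<phi> x ^ n) \<in> power_monomials E K complex_alg"
    using assms unfolding power_monomials_def by (cases "n = 0") auto
  then show ?thesis
    unfolding nuclear_closed_polys_eq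
    using C.A.fin_sums_superset[OF C.power_monomials_closed] C.A.uniform_closure_superset[OF C.power_span_closed]
    by blast
qed

lemma power_span_smult_const:
  assumes "g \<in> power_span E K complex_alg" and a: "a \<in> carrier F"
  shows "(\<lambda>x\<in>K. g x \<odot>\<^bsub>F\<^esub> a) \<in> tensor_span E K F"
  using assms(1)
proof induction
  case zero
  have "(\<lambda>x\<in>K. (\<lambda>x\<in>K. \<zero>\<^bsub>complex_alg\<^esub>) x \<odot>\<^bsub>F\<^esub> a) = (\<lambda>x\<in>K. \<zero>\<^bsub>F\<^esub>)"
    using a by auto
  then show "(\<lambda>x\<in>K. (\<lambda>x\<in>K. \<zero>\<^bsub>complex_alg\<^esub>) x \<odot>\<^bsub>F\<^esub> a) \<in> tensor_span E K F"
    by (simp only: fin_sums.zero)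
next
  case (add g f)
  have mono: "(\<lambda>x\<in>K. g x \<odot>\<^bsub>F\<^esub> a) \<in> tensor_monomials E K F"
  proof -
    consider c where "g = (\<lambda>x\<in>K. c)"
      | T n where "T \<in> bounded_operators E complex_alg" "g = (\<lambda>x\<in>K. T x ^ n)"
      using add.hyps(1) unfolding power_monomials_def by auto
    then show ?thesis
    proof cases
      case 1
      have "(\<lambda>x\<in>K. g x \<odot>\<^bsub>F\<^esub> a) = (\<lambda>x\<in>K. 0 ^ 0 \<odot>\<^bsub>F\<^esub> (c \<odot>\<^bsub>F\<^esub> a))"
        using a by (auto simp: 1)
      then show ?thesis
        using tensor_monomialsI[OF zero_functional F.smult_closed'[OF a]] by (simp only:)
    next
      case 2
      then have "(\<lambda>x\<in>K. g x \<odot>\<^bsub>F\<^esub> a) = (\<lambda>x\<in>K. T x ^ n \<odot>\<^bsub>F\<^esub> a)"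
        by auto
      then show ?thesis
        using tensor_monomialsI[OF 2(1) a] by (simp only:)
    qed
  qed
  have "(\<lambda>x\<in>K. (\<lambda>x\<in>K. g x \<oplus>\<^bsub>complex_alg\<^esub> f x) x \<odot>\<^bsub>F\<^esub> a)
      = (\<lambda>x\<in>K. (\<lambda>x\<in>K. g x \<odot>\<^bsub>F\<^esub> a) x \<oplus>\<^bsub>F\<^esub> (\<lambda>x\<in>K. f x \<odot>\<^bsub>F\<^esub> a) x)"
    using a by (auto simp: F.smult_add_left)
  then show "(\<lambda>x\<in>K. (\<lambda>x\<in>K. g x \<oplus>\<^bsub>complex_alg\<^esub> f x) x \<odot>\<^bsub>F\<^esub> a) \<in> tensor_span E K F"
    using fin_sums.add[OF mono add.IH] by (simp only:)
qed

lemma nuclear_smult_const: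
  assumes f: "f \<in> nuclear_closed_polys E K" and a: "a \<in> carrier F"
  shows "(\<lambda>x\<in>K. f x \<odot>\<^bsub>F\<^esub> a) \<in> uniform_closure K F (tensor_span E K F)"
proof (rule F.uniform_closureI)
  interpret C: compact_pair_algebra E complex_alg K
    by (rule compact_pair_algebra_complex)
  show "(\<lambda>x\<in>K. f x \<odot>\<^bsub>F\<^esub> a) \<in> K \<rightarrow>\<^sub>E carrier F"
    using a by auto
  fix \<epsilon> :: real assume "\<epsilon> > 0"
  \<comment> \<open>The summand 1 allows division also when \<open>a\<close> is zero.\<close>
  have pos: "vnorm F a + 1 > 0"
    using F.vnorm_nonneg[OF a] by linarith
  then obtain g where g: "g \<in> power_span E K complex_alg"
    "\<And>x. x \<in> K \<Longrightarrow> cmod (f x - g x) \<le> \<epsilon> / (vnorm F a + 1)"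
    using C.A.uniform_closureD[OF f[unfolded nuclear_closed_polys_eq], of "\<epsilon> / (vnorm F a + 1)"] \<open>\<epsilon> > 0\<close>
    by auto
  have "vnorm F (f x \<odot>\<^bsub>F\<^esub> a \<ominus>\<^bsub>F\<^esub> g x \<odot>\<^bsub>F\<^esub> a) \<le> \<epsilon>" if "x \<in> K" for x
  proof -
    have "vnorm F (f x \<odot>\<^bsub>F\<^esub> a \<ominus>\<^bsub>F\<^esub> g x \<odot>\<^bsub>F\<^esub> a) = cmod (f x - g x) * vnorm F a"
      using a by (simp add: F.smult_diff_left F.vnorm_smult)
    also have "\<dots> \<le> \<epsilon> / (vnorm F a + 1) * (vnorm F a + 1)"
      using g(2)[OF that] a \<open>\<epsilon> > 0\<close> pos by (intro mult_mono) auto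
    finally show ?thesis
      using pos by simp
  qed
  then show "\<exists>h\<in>tensor_span E K F. \<forall>x\<in>K. vnorm F ((\<lambda>x\<in>K. f x \<odot>\<^bsub>F\<^esub> a) x \<ominus>\<^bsub>F\<^esub> h x) \<le> \<epsilon>"
    by (intro bexI[OF _ power_span_smult_const[OF g(1) a]]) auto
qed

text \<open>The finite sums of products in the definition lie between \<open>tensor_span\<close> and
  its closure: a nuclear function times a vector is approximated by tensor monomials, and a power of
  a functional is itself a nuclear polynomial.\<close>

lemma nuclear_tensor_eq: "nuclear_tensor E K F = uniform_closure K F (tensor_span E K F)"
proof -
  let ?S = "{\<lambda>x\<in>K. \<Oplus>\<^bsub>F\<^esub>i\<in>{..<n}. f i x \<odot>\<^bsub>F\<^esub> a i | (n :: nat) f a.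
    \<forall>i<n. f i \<in> nuclear_closed_polys E K \<and> a i \<in> carrier F}"
  let ?U = "uniform_closure K F (tensor_span E K F)"
  have sub: "?S \<subseteq> ?U"
  proof
    fix h assume "h \<in> ?S"
    then obtain n :: nat and f a where h: "h = (\<lambda>x\<in>K. \<Oplus>\<^bsub>F\<^esub>i\<in>{..<n}. f i x \<odot>\<^bsub>F\<^esub> a i)"
      and fa': "\<forall>i<n. f i \<in> nuclear_closed_polys E K \<and> a i \<in> carrier F"
      by blast
    then have fa: "\<And>i. i < n \<Longrightarrow> f i \<in> nuclear_closed_polys E K" "\<And>i. i < n \<Longrightarrow> a i \<in> carrier F"
      by simp_all
    have "(\<lambda>x\<in>K. \<Oplus>\<^bsub>F\<^esub>i\<in>{..<m}. f i x \<odot>\<^bsub>F\<^esub> a i) \<in> ?U" if "m \<le> n" for m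
      using that
    proof (induction m)
      case 0
      have "(\<lambda>x\<in>K. \<Oplus>\<^bsub>F\<^esub>i\<in>{..<0}. f i x \<odot>\<^bsub>F\<^esub> a i) = (\<lambda>x\<in>K. \<zero>\<^bsub>F\<^esub>)"
        by auto
      moreover have "(\<lambda>x\<in>K. \<zero>\<^bsub>F\<^esub>) \<in> ?U"
        using F.uniform_closure_superset[OF tensor_span_closed] fin_sums.zero by blast
      ultimately show ?case
        by (simp only:)
    next
      case (Suc m)
      have "(\<lambda>x\<in>K. (\<lambda>x\<in>K. f m x \<odot>\<^bsub>F\<^esub> a m) x \<oplus>\<^bsub>F\<^esub> (\<lambda>x\<in>K. \<Oplus>\<^bsub>F\<^esub>i\<in>{..<m}. f i x \<odot>\<^bsub>F\<^esub> a i) x) \<in> ?U"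
        using Suc fa
        by (intro F.uniform_closure_add tensor_span_closed F.fin_sums_add[OF tensor_monomials_closed]
            nuclear_smult_const) auto
      also have "(\<lambda>x\<in>K. (\<lambda>x\<in>K. f m x \<odot>\<^bsub>F\<^esub> a m) x \<oplus>\<^bsub>F\<^esub> (\<lambda>x\<in>K. \<Oplus>\<^bsub>F\<^esub>i\<in>{..<m}. f i x \<odot>\<^bsub>F\<^esub> a i) x)
          = (\<lambda>x\<in>K. \<Oplus>\<^bsub>F\<^esub>i\<in>{..<Suc m}. f i x \<odot>\<^bsub>F\<^esub> a i)"
      proof (rule restrict_ext)
        fix x assume "x \<in> K"
        then show "(\<lambda>x\<in>K. f m x \<odot>\<^bsub>F\<^esub> a m) x \<oplus>\<^bsub>F\<^esub> (\<lambda>x\<in>K. \<Oplus>\<^bsub>F\<^esub>i\<in>{..<m}. f i x \<odot>\<^bsub>F\<^esub> a i) x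
            = (\<Oplus>\<^bsub>F\<^esub>i\<in>{..<Suc m}. f i x \<odot>\<^bsub>F\<^esub> a i)"
          using fa Suc.prems by (subst F.finsum_lessThan_Suc) auto
      qed
      finally show ?case .
    qed
    then show "h \<in> ?U"
      by (simp add: h)
  qed
  have sup: "tensor_span E K F \<subseteq> ?S"
  proof
    fix h assume "h \<in> tensor_span E K F"
    then show "h \<in> ?S"
    proof induction
      case zero
      have "(\<lambda>x\<in>K. \<zero>\<^bsub>F\<^esub>) = (\<lambda>x\<in>K. \<Oplus>\<^bsub>F\<^esub>i\<in>{..<0::nat}. (\<lambda>i x. 0) i x \<odot>\<^bsub>F\<^esub> (\<lambda>i. \<zero>\<^bsub>F\<^esub>) i)"
        by simp
      then show "(\<lambda>x\<in>K. \<zero>\<^bsub>F\<^esub>) \<in> ?S"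
        by (intro CollectI exI[of _ 0] exI[of _ "\<lambda>i x. 0"] exI[of _ "\<lambda>i. \<zero>\<^bsub>F\<^esub>"]) simp
    next
      case (add g h)
      obtain n :: nat and f a where h: "h = (\<lambda>x\<in>K. \<Oplus>\<^bsub>F\<^esub>i\<in>{..<n}. f i x \<odot>\<^bsub>F\<^esub> a i)"
        and fa': "\<forall>i<n. f i \<in> nuclear_closed_polys E K \<and> a i \<in> carrier F"
        using add.IH by blast
      then have fa: "\<And>i. i < n \<Longrightarrow> f i \<in> nuclear_closed_polys E K" "\<And>i. i < n \<Longrightarrow> a i \<in> carrier F"
        by simp_all
      obtain \<phi> m c where g: "g = (\<lambda>x\<in>K. \<phi> x ^ m \<odot>\<^bsub>F\<^esub> c)"
        and \<phi>: "\<phi> \<in> bounded_operators E complex_alg" and c: "c \<in> carrier F"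
        using add.hyps(1) unfolding tensor_monomials_def by blast
      \<comment> \<open>The new summand takes the free index \<open>n\<close>, so the values at
        smaller indices are kept.\<close>
      define f' where "f' = f(n := \<lambda>x\<in>K. \<phi> x ^ m)"
      define a' where "a' = a(n := c)"
      have "(\<lambda>x\<in>K. g x \<oplus>\<^bsub>F\<^esub> h x) = (\<lambda>x\<in>K. \<Oplus>\<^bsub>F\<^esub>i\<in>{..<Suc n}. f' i x \<odot>\<^bsub>F\<^esub> a' i)"
      proof (rule restrict_ext)
        fix x assume x: "x \<in> K"
        have "(\<Oplus>\<^bsub>F\<^esub>i\<in>{..<Suc n}. f' i x \<odot>\<^bsub>F\<^esub> a' i)
            = f' n x \<odot>\<^bsub>F\<^esub> a' n \<oplus>\<^bsub>F\<^esub> (\<Oplus>\<^bsub>F\<^esub>i\<in>{..<n}. f' i x \<odot>\<^bsub>F\<^esub> a' i)"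
          using fa c by (subst F.finsum_lessThan_Suc) (auto simp: a'_def)
        also have "(\<Oplus>\<^bsub>F\<^esub>i\<in>{..<n}. f' i x \<odot>\<^bsub>F\<^esub> a' i) = (\<Oplus>\<^bsub>F\<^esub>i\<in>{..<n}. f i x \<odot>\<^bsub>F\<^esub> a i)"
          using fa by (intro F.M.finsum_cong') (auto simp: a'_def f'_def)
        finally show "g x \<oplus>\<^bsub>F\<^esub> h x = (\<Oplus>\<^bsub>F\<^esub>i\<in>{..<Suc n}. f' i x \<odot>\<^bsub>F\<^esub> a' i)"
          using x by (simp add: g h a'_def f'_def)
      qed
      moreover have "\<forall>i<Suc n. f' i \<in> nuclear_closed_polys E K \<and> a' i \<in> carrier F"
        using fa c power_functional_nuclear[OF \<phi>, of m] by (auto simp: f'_def a'_def less_Suc_eq)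
      ultimately show "(\<lambda>x\<in>K. g x \<oplus>\<^bsub>F\<^esub> h x) \<in> ?S"
        by blast
    qed
  qed
  have "nuclear_tensor E K F = uniform_closure K F ?S"
    unfolding nuclear_tensor_def
    using sub F.uniform_closure_mono[OF tensor_span_bounded_lipschitz]
    by (intro closure_of_continuous_functions) blast
  also have "\<dots> = ?U"
    using F.uniform_closure_absorb[OF tensor_span_closed sub] F.uniform_closure_mono[OF sup] by blast
  finally show ?thesis .
qed

text \<open>\<open>S\<close> commutes with the scalar factor of a tensor monomial and so maps
  monomials to monomials; boundedness extends this to the closure. It lets operators act on the
  identity of \<open>E\<close>, exchanges equivalent norms, and leads back from
  \<open>Inl_copy\<close> to \<open>E\<close>.\<close>

lemma nuclear_tensor_image:
  assumes G: "complex_normed_space G" and S: "S \<in> bounded_operators F G"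
    and f: "f \<in> nuclear_tensor E K F"
  shows "(\<lambda>x\<in>K. S (f x)) \<in> nuclear_tensor E K G"
proof -
  interpret G: complex_normed_space G by fact
  interpret G: compact_pair E G K
    by (intro compact_pair.intro compact_pair_axioms.intro compact E.complex_normed_space_axioms G)
  note [simp] = bounded_operators_closed[OF S]
  have span: "(\<lambda>x\<in>K. S (g x)) \<in> tensor_span E K G" if "g \<in> tensor_span E K F" for g
    using that
  proof induction
    case zero
    have "(\<lambda>x\<in>K. S ((\<lambda>x\<in>K. \<zero>\<^bsub>F\<^esub>) x)) = (\<lambda>x\<in>K. \<zero>\<^bsub>G\<^esub>)"
      using bounded_operators_zero[OF F.complex_normed_space_axioms G S] by auto
    then show "(\<lambda>x\<in>K. S ((\<lambda>x\<in>K. \<zero>\<^bsub>F\<^esub>) x)) \<in> tensor_span E K G"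
      by (simp only: fin_sums.zero)
  next
    case (add g h)
    obtain \<phi> n a where g: "g = (\<lambda>x\<in>K. \<phi> x ^ n \<odot>\<^bsub>F\<^esub> a)"
      and \<phi>: "\<phi> \<in> bounded_operators E complex_alg" and a: "a \<in> carrier F"
      using add.hyps(1) unfolding tensor_monomials_def by blast
    have mono: "(\<lambda>x\<in>K. \<phi> x ^ n \<odot>\<^bsub>G\<^esub> S a) \<in> tensor_monomials E K G"
      using \<phi> a by (intro G.tensor_monomialsI) auto
    have hx: "h x \<in> carrier F" if "x \<in> K" for x
      using add.hyps(2) tensor_span_closed that by (auto simp: PiE_iff)
    have "(\<lambda>x\<in>K. S ((\<lambda>x\<in>K. g x \<oplus>\<^bsub>F\<^esub> h x) x))
        = (\<lambda>x\<in>K. (\<lambda>x\<in>K. \<phi> x ^ n \<odot>\<^bsub>G\<^esub> S a) x \<oplus>\<^bsub>G\<^esub> (\<lambda>x\<in>K. S (h x)) x)"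
      using a hx by (intro restrict_ext)
        (simp add: g bounded_operators_add[OF S] bounded_operators_smult[OF S])
    then show "(\<lambda>x\<in>K. S ((\<lambda>x\<in>K. g x \<oplus>\<^bsub>F\<^esub> h x) x)) \<in> tensor_span E K G"
      using fin_sums.add[OF mono add.IH] by (simp only:)
  qed
  obtain C where C: "C > 0" "\<And>x. x \<in> carrier F \<Longrightarrow> vnorm G (S x) \<le> C * vnorm F x"
    using bounded_operators_bound[OF F.complex_normed_space_axioms S] by blast
  have f': "f \<in> uniform_closure K F (tensor_span E K F)"
    using f by (simp add: nuclear_tensor_eq)
  have fx: "f x \<in> carrier F" if "x \<in> K" for x
    using F.uniform_closure_closed[OF f'] that by (auto simp: PiE_iff)
  show ?thesis
    unfolding G.nuclear_tensor_eq
  proof (rule G.uniform_closureI)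
    show "(\<lambda>x\<in>K. S (f x)) \<in> K \<rightarrow>\<^sub>E carrier G"
      using fx by auto
    fix \<epsilon> :: real assume "\<epsilon> > 0"
    then obtain g where g: "g \<in> tensor_span E K F" "\<And>x. x \<in> K \<Longrightarrow> vnorm F (f x \<ominus>\<^bsub>F\<^esub> g x) \<le> \<epsilon> / C"
      using F.uniform_closureD[OF f', of "\<epsilon> / C"] C(1) by auto
    have "vnorm G (S (f x) \<ominus>\<^bsub>G\<^esub> S (g x)) \<le> \<epsilon>" if x: "x \<in> K" for x
    proof -
      have gx: "g x \<in> carrier F"
        using g(1) tensor_span_closed x by (auto simp: PiE_iff)
      have "vnorm G (S (f x) \<ominus>\<^bsub>G\<^esub> S (g x)) \<le> C * vnorm F (f x \<ominus>\<^bsub>F\<^esub> g x)"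
        using C(2)[of "f x \<ominus>\<^bsub>F\<^esub> g x"] fx[OF x] gx
          bounded_operators_diff[OF F.complex_normed_space_axioms G S, of "f x" "g x"] by simp
      also have "\<dots> \<le> \<epsilon>"
        using g(2)[OF x] C(1) by (simp add: field_simps)
      finally show ?thesis .
    qed
    then show "\<exists>h\<in>tensor_span E K G. \<forall>x\<in>K. vnorm G ((\<lambda>x\<in>K. S (f x)) x \<ominus>\<^bsub>G\<^esub> h x) \<le> \<epsilon>"
      by (intro bexI[OF _ span[OF g(1)]]) auto
  qed
qed

end

section \<open>Polarization\<close>

lemma (in complex_normed_space) finsum_smult_left:
  "\<lbrakk>finite I; a \<in> carrier V\<rbrakk> \<Longrightarrow> (\<Oplus>i\<in>I. s i \<odot> a) = (\<Sum>i\<in>I. s i) \<odot> a"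
  by (induction I rule: finite_induct) (simp_all add: smult_add_left)

text \<open>
  If \<open>q t\<close> denotes the sum of the \<open>t ^ i \<odot> c i\<close> over \<open>i \<le> n\<close>, the leading coefficient does not
  occur in \<open>q (2 * t) - 2 ^ n \<odot> q t\<close>, so the lower coefficients are obtained by induction.
\<close>

lemma (in complex_normed_space) coefficients_mem:
  assumes add: "\<And>f g. \<lbrakk>f \<in> D; g \<in> D\<rbrakk> \<Longrightarrow> (\<lambda>x\<in>K. f x \<oplus> g x) \<in> D"
    and smult: "\<And>c f. f \<in> D \<Longrightarrow> (\<lambda>x\<in>K. c \<odot> f x) \<in> D"
    and c: "\<And>i x. x \<in> K \<Longrightarrow> c i x \<in> carrier V"
    and D: "\<And>t. (\<lambda>x\<in>K. \<Oplus>i\<in>{..<N}. t ^ i \<odot> c i x) \<in> D"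
    and "k < N"
  shows "(\<lambda>x\<in>K. c k x) \<in> D"
  using c D \<open>k < N\<close>
proof (induction N arbitrary: c k)
  case (Suc n)
  note c [simp] = Suc.prems(1)
  define q where "q t = (\<lambda>x\<in>K. \<Oplus>i\<in>{..<Suc n}. t ^ i \<odot> c i x)" for t
  have q: "q t \<in> D" for t
    unfolding q_def by (rule Suc.prems(2))
  have low: "(\<lambda>x\<in>K. c i x) \<in> D" if i: "i < n" for i
  proof -
    let ?d = "\<lambda>i. 2 ^ i - 2 ^ n :: complex"
    have "(\<lambda>x\<in>K. ?d i \<odot> c i x) \<in> D"
    proof (rule Suc.IH[OF _ _ i])
      fix t
      have "(\<lambda>x\<in>K. q (2 * t) x \<oplus> (\<lambda>x\<in>K. (- (2 ^ n)) \<odot> q t x) x) \<in> D"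
        by (intro add smult q)
      also have "(\<lambda>x\<in>K. q (2 * t) x \<oplus> (\<lambda>x\<in>K. (- (2 ^ n)) \<odot> q t x) x)
        = (\<lambda>x\<in>K. \<Oplus>i\<in>{..<n}. t ^ i \<odot> (?d i \<odot> c i x))"
      proof (rule restrict_ext)
        fix x assume x: "x \<in> K"
        have "q (2 * t) x \<oplus> (- (2 ^ n)) \<odot> q t x
          = (\<Oplus>i\<in>{..<Suc n}. (2 * t) ^ i \<odot> c i x \<oplus> (- (2 ^ n)) \<odot> (t ^ i \<odot> c i x))"
          using x by (simp add: q_def finsum_smult Pi_iff)
        also have "\<dots> = (\<Oplus>i\<in>{..<Suc n}. t ^ i \<odot> (?d i \<odot> c i x))"
          using x by (intro M.finsum_cong')
            (auto simp: smult_smult power_mult_distrib algebra_simps simp flip: smult_add_left)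
        also have "\<dots> = (\<Oplus>i\<in>{..<n}. t ^ i \<odot> (?d i \<odot> c i x))"
          using x by (subst finsum_lessThan_Suc) auto
        finally show "q (2 * t) x \<oplus> (\<lambda>x\<in>K. (- (2 ^ n)) \<odot> q t x) x
            = (\<Oplus>i\<in>{..<n}. t ^ i \<odot> (?d i \<odot> c i x))"
          using x by simp
      qed
      finally show "(\<lambda>x\<in>K. \<Oplus>i\<in>{..<n}. t ^ i \<odot> (?d i \<odot> c i x)) \<in> D" .
    qed simp
    then have "(\<lambda>x\<in>K. (1 / ?d i) \<odot> (\<lambda>x\<in>K. ?d i \<odot> c i x) x) \<in> D"
      by (rule smult)
    \<comment> \<open>The moduli differ, hence so do the powers themselves, and the factor
      \<open>?d i\<close> can be divided out.\<close>
    moreover have "cmod (2 ^ i) < cmod (2 ^ n)"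
      using i by (simp add: norm_power)
    then have "?d i \<noteq> 0"
      by auto
    then have "(\<lambda>x\<in>K. (1 / ?d i) \<odot> (\<lambda>x\<in>K. ?d i \<odot> c i x) x) = (\<lambda>x\<in>K. c i x)"
      by (intro restrict_ext) (simp add: smult_smult)
    ultimately show ?thesis
      by (simp only:)
  qed
  \<comment> \<open>At \<open>t = 1\<close> every coefficient occurs with factor 1; taking away the
    lower ones, one after another, leaves the leading one.\<close>
  have "(\<lambda>x\<in>K. q 1 x \<oplus> (\<Oplus>i\<in>{..<m}. (- 1) \<odot> c i x)) \<in> D" if "m \<le> n" for m
    using that
  proof (induction m)
    case 0
    have "(\<lambda>x\<in>K. q 1 x \<oplus> (\<Oplus>i\<in>{..<0}. (- 1) \<odot> c i x)) = q 1"
      by (auto simp: q_def fun_eq_iff)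
    then show ?case
      using q by (simp only:)
  next
    case (Suc m)
    have "(\<lambda>x\<in>K. (\<lambda>x\<in>K. (- 1) \<odot> (\<lambda>x\<in>K. c m x) x) x
        \<oplus> (\<lambda>x\<in>K. q 1 x \<oplus> (\<Oplus>i\<in>{..<m}. (- 1) \<odot> c i x)) x) \<in> D"
      using Suc.prems by (intro add[OF smult[OF low]] Suc.IH) auto
    also have "(\<lambda>x\<in>K. (\<lambda>x\<in>K. (- 1) \<odot> (\<lambda>x\<in>K. c m x) x) x
        \<oplus> (\<lambda>x\<in>K. q 1 x \<oplus> (\<Oplus>i\<in>{..<m}. (- 1) \<odot> c i x)) x)
      = (\<lambda>x\<in>K. q 1 x \<oplus> (\<Oplus>i\<in>{..<Suc m}. (- 1) \<odot> c i x))"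
    proof (rule restrict_ext)
      fix x assume x: "x \<in> K"
      then have "q 1 x \<in> carrier V"
        by (auto simp: q_def intro!: M.finsum_closed)
      with x show "(\<lambda>x\<in>K. (- 1) \<odot> (\<lambda>x\<in>K. c m x) x) x
          \<oplus> (\<lambda>x\<in>K. q 1 x \<oplus> (\<Oplus>i\<in>{..<m}. (- 1) \<odot> c i x)) x
        = q 1 x \<oplus> (\<Oplus>i\<in>{..<Suc m}. (- 1) \<odot> c i x)"
        by (subst finsum_lessThan_Suc) (auto simp: M.a_lcomm intro!: M.finsum_closed)
    qed
    finally show ?case .
  qed
  from this[of n] have "(\<lambda>x\<in>K. q 1 x \<oplus> (\<Oplus>i\<in>{..<n}. (- 1) \<odot> c i x)) \<in> D"
    by simp
  also have "(\<lambda>x\<in>K. q 1 x \<oplus> (\<Oplus>i\<in>{..<n}. (- 1) \<odot> c i x)) = (\<lambda>x\<in>K. c n x)"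
  proof (rule restrict_ext)
    fix x assume x: "x \<in> K"
    let ?s = "\<Oplus>i\<in>{..<n}. c i x"
    have s: "?s \<in> carrier V"
      using x by (intro M.finsum_closed) auto
    have "q 1 x = c n x \<oplus> ?s"
      using x by (simp add: q_def) (subst finsum_lessThan_Suc, auto intro!: arg_cong2[where f = "(\<oplus>)"] M.finsum_cong')
    moreover have "(\<Oplus>i\<in>{..<n}. (- 1) \<odot> c i x) = \<ominus> ?s"
      using x s finsum_smult[of "{..<n}" "\<lambda>i. c i x" "- 1"] by (simp add: smult_minus1 Pi_iff)
    ultimately show "q 1 x \<oplus> (\<Oplus>i\<in>{..<n}. (- 1) \<odot> c i x) = c n x"
      using x s by (simp add: M.a_assoc M.r_neg)
  qed
  finally have "(\<lambda>x\<in>K. c n x) \<in> D" .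
  with low show "(\<lambda>x\<in>K. c k x) \<in> D"
    using Suc.prems(3) by (cases "k = n") auto
qed simp

text \<open>The binomial theorem with the powers of \<open>t\<close> pulled to the front, which is
  the shape \<open>coefficients_mem\<close> expects.\<close>

lemma (in comm_unital_banach_algebra) power_one_add_smult:
  fixes n :: nat
  assumes a: "a \<in> carrier A"
  shows "(\<one> \<oplus> t \<odot> a) [^] n = (\<Oplus>i\<in>{..<Suc n}. t ^ i \<odot> (of_nat (n choose i) \<odot> a [^] i))"
proof (induction n)
  case 0
  show ?case
    by (simp add: lessThan_Suc)
next
  case (Suc n)
  let ?f = "\<lambda>m i. t ^ i \<odot> (of_nat (m choose i) \<odot> a [^] i)"
  let ?S = "\<Oplus>i\<in>{..<Suc n}. ?f n i"
  have S: "?S \<in> carrier A"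
    using a by (intro M.finsum_closed) auto
  have "(\<one> \<oplus> t \<odot> a) [^] Suc n = ?S \<otimes> (\<one> \<oplus> t \<odot> a)"
    using Suc by simp
  also have "\<dots> = ?S \<otimes> (t \<odot> a) \<oplus> ?S"
    using S a by (simp add: r_distr M.a_comm)
  also have "?S \<otimes> (t \<odot> a) = (\<Oplus>i\<in>{..<Suc n}. ?f n i \<otimes> (t \<odot> a))"
    using a by (intro finsum_ldistr) auto
  also have "\<dots> = (\<Oplus>i\<in>{..<Suc n}. t ^ Suc i \<odot> (of_nat (n choose i) \<odot> a [^] Suc i))"
    using a by (intro M.finsum_cong')
      (auto simp: smult_mult_left smult_mult_right smult_smult mult_ac)
  \<comment> \<open>A term of index \<open>Suc n\<close> is added, which vanishes since
    \<open>n choose Suc n = 0\<close>. After removal of index 0 the sum has the same index range as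
    the shifted one, and Pascal's rule applies term by term.\<close>
  also have "?S = ?f n 0 \<oplus> (\<Oplus>i\<in>{..<Suc n}. ?f n (Suc i))"
  proof -
    have "?S = (\<Oplus>i\<in>{..<Suc (Suc n)}. ?f n i)"
      using a S by (subst (2) finsum_lessThan_Suc) (auto simp: binomial_eq_0)
    also have "\<dots> = ?f n 0 \<oplus> (\<Oplus>i\<in>{..<Suc n}. ?f n (Suc i))"
      using a by (intro finsum_lessThan_Suc_shift) auto
    finally show ?thesis .
  qed
  also have "(\<Oplus>i\<in>{..<Suc n}. t ^ Suc i \<odot> (of_nat (n choose i) \<odot> a [^] Suc i)) \<oplus>
      (?f n 0 \<oplus> (\<Oplus>i\<in>{..<Suc n}. ?f n (Suc i)))
    = ?f n 0 \<oplus> ((\<Oplus>i\<in>{..<Suc n}. t ^ Suc i \<odot> (of_nat (n choose i) \<odot> a [^] Suc i)) \<oplus>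
      (\<Oplus>i\<in>{..<Suc n}. ?f n (Suc i)))"
    using a by (intro M.a_lcomm M.finsum_closed) auto
  also have "(\<Oplus>i\<in>{..<Suc n}. t ^ Suc i \<odot> (of_nat (n choose i) \<odot> a [^] Suc i)) \<oplus>
      (\<Oplus>i\<in>{..<Suc n}. ?f n (Suc i))
    = (\<Oplus>i\<in>{..<Suc n}. t ^ Suc i \<odot> (of_nat (n choose i) \<odot> a [^] Suc i) \<oplus> ?f n (Suc i))"
    using a by (subst M.finsum_addf) auto
  also have "\<dots> = (\<Oplus>i\<in>{..<Suc n}. ?f (Suc n) (Suc i))"
    using a by (intro M.finsum_cong') (auto simp: smult_add_left smult_add_right)
  also have "?f n 0 \<oplus> \<dots> = (\<Oplus>i\<in>{..<Suc (Suc n)}. ?f (Suc n) i)"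
    using a by (subst (2) finsum_lessThan_Suc_shift) auto
  finally show ?case .
qed

section \<open>Products of powers of functionals\<close>

context compact_pair
begin

lemma tensor_span_smult:
  assumes "f \<in> tensor_span E K F"
  shows "(\<lambda>x\<in>K. c \<odot>\<^bsub>F\<^esub> f x) \<in> tensor_span E K F"
proof (rule F.fin_sums_smult[OF tensor_monomials_closed assms])
  fix g assume "g \<in> tensor_monomials E K F"
  then obtain \<phi> n a where g: "g = (\<lambda>x\<in>K. \<phi> x ^ n \<odot>\<^bsub>F\<^esub> a)"
    and \<phi>: "\<phi> \<in> bounded_operators E complex_alg" and a: "a \<in> carrier F"
    unfolding tensor_monomials_def by blast
  have "(\<lambda>x\<in>K. c \<odot>\<^bsub>F\<^esub> g x) = (\<lambda>x\<in>K. \<phi> x ^ n \<odot>\<^bsub>F\<^esub> (c \<odot>\<^bsub>F\<^esub> a))"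
    using a by (intro restrict_ext) (simp add: g F.smult_smult mult.commute)
  then show "(\<lambda>x\<in>K. c \<odot>\<^bsub>F\<^esub> g x) \<in> tensor_monomials E K F"
    using tensor_monomialsI[OF \<phi> F.smult_closed'[OF a]] by (simp only:)
qed

lemma functional_add_smult:
  assumes "\<phi> \<in> bounded_operators E complex_alg" "\<psi> \<in> bounded_operators E complex_alg"
  shows "(\<lambda>x. t * \<psi> x + \<phi> x) \<in> bounded_operators E complex_alg"
proof -
  obtain C where C: "\<And>x. x \<in> carrier E \<Longrightarrow> cmod (\<phi> x) \<le> C * vnorm E x"
    using bounded_operators_bound[OF E.complex_normed_space_axioms assms(1)] by auto
  obtain D where D: "\<And>x. x \<in> carrier E \<Longrightarrow> cmod (\<psi> x) \<le> D * vnorm E x"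
    using bounded_operators_bound[OF E.complex_normed_space_axioms assms(2)] by auto
  show ?thesis
  proof (rule bounded_operatorsI)
    fix x assume x: "x \<in> carrier E"
    have "cmod (t * \<psi> x + \<phi> x) \<le> cmod t * cmod (\<psi> x) + cmod (\<phi> x)"
      by (metis norm_mult norm_triangle_ineq)
    also have "\<dots> \<le> cmod t * (D * vnorm E x) + C * vnorm E x"
      using C[OF x] D[OF x] by (intro add_mono mult_left_mono) auto
    finally show "vnorm complex_alg (t * \<psi> x + \<phi> x) \<le> (cmod t * D + C) * vnorm E x"
      by (simp add: algebra_simps)
  qed (use assms in \<open>auto simp: bounded_operators_add bounded_operators_smult algebra_simps\<close>)
qed

text \<open>For each \<open>t\<close> the function
  \<open>(t * \<psi> x + \<phi> x) ^ (n + m)\<close> times \<open>a\<close> is a tensor monomial.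
  Its coefficient at \<open>t ^ m\<close> is the wanted function times the nonzero number
  \<open>n + m choose m\<close>.\<close>

lemma tensor_span_product_functionals:
  assumes \<phi>: "\<phi> \<in> bounded_operators E complex_alg" and \<psi>: "\<psi> \<in> bounded_operators E complex_alg"
    and a: "a \<in> carrier F"
  shows "(\<lambda>x\<in>K. (\<phi> x ^ n * \<psi> x ^ m) \<odot>\<^bsub>F\<^esub> a) \<in> tensor_span E K F"
proof -
  let ?b = "of_nat (n + m choose m) :: complex"
  have "(\<lambda>x\<in>K. (of_nat (n + m choose m) * \<psi> x ^ m * \<phi> x ^ (n + m - m)) \<odot>\<^bsub>F\<^esub> a) \<in> tensor_span E K F"
  proof (rule F.coefficients_mem[where N = "Suc (n + m)" and k = m and
        c = "\<lambda>i x. (of_nat (n + m choose i) * \<psi> x ^ i * \<phi> x ^ (n + m - i)) \<odot>\<^bsub>F\<^esub> a"])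
    fix t
    have "(\<lambda>x\<in>K. (t * \<psi> x + \<phi> x) ^ (n + m) \<odot>\<^bsub>F\<^esub> a) \<in> tensor_span E K F"
      using F.fin_sums_superset[OF tensor_monomials_closed]
        tensor_monomialsI[OF functional_add_smult[OF \<phi> \<psi>] a] by blast
    also have "(\<lambda>x\<in>K. (t * \<psi> x + \<phi> x) ^ (n + m) \<odot>\<^bsub>F\<^esub> a)
      = (\<lambda>x\<in>K. \<Oplus>\<^bsub>F\<^esub>i\<in>{..<Suc (n + m)}.
          t ^ i \<odot>\<^bsub>F\<^esub> ((of_nat (n + m choose i) * \<psi> x ^ i * \<phi> x ^ (n + m - i)) \<odot>\<^bsub>F\<^esub> a))"
    proof (rule restrict_ext)
      fix x assume x: "x \<in> K"
      have "(\<Oplus>\<^bsub>F\<^esub>i\<in>{..<Suc (n + m)}.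
          t ^ i \<odot>\<^bsub>F\<^esub> ((of_nat (n + m choose i) * \<psi> x ^ i * \<phi> x ^ (n + m - i)) \<odot>\<^bsub>F\<^esub> a))
        = (\<Oplus>\<^bsub>F\<^esub>i\<in>{..<Suc (n + m)}.
          (of_nat (n + m choose i) * (t * \<psi> x) ^ i * \<phi> x ^ (n + m - i)) \<odot>\<^bsub>F\<^esub> a)"
        using a by (intro F.M.finsum_cong') (auto simp: F.smult_smult power_mult_distrib mult_ac)
      also have "\<dots> = (\<Sum>i<Suc (n + m). of_nat (n + m choose i) * (t * \<psi> x) ^ i * \<phi> x ^ (n + m - i)) \<odot>\<^bsub>F\<^esub> a"
        using a by (intro F.finsum_smult_left) auto
      also have "\<dots> = (t * \<psi> x + \<phi> x) ^ (n + m) \<odot>\<^bsub>F\<^esub> a"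
        by (simp only: binomial_ring lessThan_Suc_atMost)
      finally show "(t * \<psi> x + \<phi> x) ^ (n + m) \<odot>\<^bsub>F\<^esub> a = (\<Oplus>\<^bsub>F\<^esub>i\<in>{..<Suc (n + m)}.
          t ^ i \<odot>\<^bsub>F\<^esub> ((of_nat (n + m choose i) * \<psi> x ^ i * \<phi> x ^ (n + m - i)) \<odot>\<^bsub>F\<^esub> a))"
        by simp
    qed
    finally show "(\<lambda>x\<in>K. \<Oplus>\<^bsub>F\<^esub>i\<in>{..<Suc (n + m)}. t ^ i \<odot>\<^bsub>F\<^esub>
        ((of_nat (n + m choose i) * \<psi> x ^ i * \<phi> x ^ (n + m - i)) \<odot>\<^bsub>F\<^esub> a)) \<in> tensor_span E K F" .
  qed (use a in \<open>auto intro: tensor_span_smult F.fin_sums_add[OF tensor_monomials_closed]\<close>)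
  then have "(\<lambda>x\<in>K. (1 / ?b) \<odot>\<^bsub>F\<^esub>
      (\<lambda>x\<in>K. (of_nat (n + m choose m) * \<psi> x ^ m * \<phi> x ^ (n + m - m)) \<odot>\<^bsub>F\<^esub> a) x) \<in> tensor_span E K F"
    by (rule tensor_span_smult)
  moreover have "(\<lambda>x\<in>K. (1 / ?b) \<odot>\<^bsub>F\<^esub>
      (\<lambda>x\<in>K. (of_nat (n + m choose m) * \<psi> x ^ m * \<phi> x ^ (n + m - m)) \<odot>\<^bsub>F\<^esub> a) x)
    = (\<lambda>x\<in>K. (\<phi> x ^ n * \<psi> x ^ m) \<odot>\<^bsub>F\<^esub> a)"
    using a by (intro restrict_ext) (simp add: F.smult_smult mult_ac)
  ultimately show ?thesis
    by (simp only:)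
qed

end

context compact_pair_algebra
begin

text \<open>By distributivity it is enough to multiply two monomials. Their vectors multiply in
  \<open>A\<close>, and the product of their scalar factors is treated by
  \<open>tensor_span_product_functionals\<close>.\<close>

lemma tensor_span_mult:
  assumes "f \<in> tensor_span E K A" and h: "h \<in> tensor_span E K A"
  shows "(\<lambda>x\<in>K. f x \<otimes>\<^bsub>A\<^esub> h x) \<in> tensor_span E K A"
proof -
  have closed: "f x \<in> carrier A" if "f \<in> tensor_span E K A" "x \<in> K" for f x
    using tensor_span_closed that by (auto simp: PiE_iff)
  have monomial: "(\<lambda>x\<in>K. g x \<otimes>\<^bsub>A\<^esub> h x) \<in> tensor_span E K A" if "g \<in> tensor_monomials E K A" for g
    using h
  proof induction
    obtain \<phi> n a where g: "g = (\<lambda>x\<in>K. \<phi> x ^ n \<odot>\<^bsub>A\<^esub> a)"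
      and \<phi>: "\<phi> \<in> bounded_operators E complex_alg" and a: "a \<in> carrier A"
      using \<open>g \<in> tensor_monomials E K A\<close> unfolding tensor_monomials_def by blast
    case zero
    have "(\<lambda>x\<in>K. g x \<otimes>\<^bsub>A\<^esub> (\<lambda>x\<in>K. \<zero>\<^bsub>A\<^esub>) x) = (\<lambda>x\<in>K. \<zero>\<^bsub>A\<^esub>)"
      using a by (intro restrict_ext) (simp add: g)
    then show "(\<lambda>x\<in>K. g x \<otimes>\<^bsub>A\<^esub> (\<lambda>x\<in>K. \<zero>\<^bsub>A\<^esub>) x) \<in> tensor_span E K A"
      by (simp only: fin_sums.zero)
  next
    obtain \<phi> n a where g: "g = (\<lambda>x\<in>K. \<phi> x ^ n \<odot>\<^bsub>A\<^esub> a)"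
      and \<phi>: "\<phi> \<in> bounded_operators E complex_alg" and a: "a \<in> carrier A"
      using \<open>g \<in> tensor_monomials E K A\<close> unfolding tensor_monomials_def by blast
    case (add g' h)
    obtain \<psi> m b where g': "g' = (\<lambda>x\<in>K. \<psi> x ^ m \<odot>\<^bsub>A\<^esub> b)"
      and \<psi>: "\<psi> \<in> bounded_operators E complex_alg" and b: "b \<in> carrier A"
      using add.hyps(1) unfolding tensor_monomials_def by blast
    have "(\<lambda>x\<in>K. (\<lambda>x\<in>K. (\<phi> x ^ n * \<psi> x ^ m) \<odot>\<^bsub>A\<^esub> (a \<otimes>\<^bsub>A\<^esub> b)) x \<oplus>\<^bsub>A\<^esub> (\<lambda>x\<in>K. g x \<otimes>\<^bsub>A\<^esub> h x) x)
        \<in> tensor_span E K A"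
      using a b by (intro A.fin_sums_add[OF tensor_monomials_closed] add.IH
          tensor_span_product_functionals \<phi> \<psi>) auto
    also have "(\<lambda>x\<in>K. (\<lambda>x\<in>K. (\<phi> x ^ n * \<psi> x ^ m) \<odot>\<^bsub>A\<^esub> (a \<otimes>\<^bsub>A\<^esub> b)) x \<oplus>\<^bsub>A\<^esub> (\<lambda>x\<in>K. g x \<otimes>\<^bsub>A\<^esub> h x) x)
      = (\<lambda>x\<in>K. g x \<otimes>\<^bsub>A\<^esub> (\<lambda>x\<in>K. g' x \<oplus>\<^bsub>A\<^esub> h x) x)"
      using a b closed[OF add.hyps(2)]
      by (intro restrict_ext)
        (simp add: g g' A.r_distr A.smult_mult_left A.smult_mult_right A.smult_smult mult.commute)
    finally show "(\<lambda>x\<in>K. g x \<otimes>\<^bsub>A\<^esub> (\<lambda>x\<in>K. g' x \<oplus>\<^bsub>A\<^esub> h x) x) \<in> tensor_span E K A" .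
  qed
  show ?thesis
    using assms(1)
  proof induction
    case zero
    have "(\<lambda>x\<in>K. (\<lambda>x\<in>K. \<zero>\<^bsub>A\<^esub>) x \<otimes>\<^bsub>A\<^esub> h x) = (\<lambda>x\<in>K. \<zero>\<^bsub>A\<^esub>)"
      using closed[OF h] by (intro restrict_ext) simp
    then show "(\<lambda>x\<in>K. (\<lambda>x\<in>K. \<zero>\<^bsub>A\<^esub>) x \<otimes>\<^bsub>A\<^esub> h x) \<in> tensor_span E K A"
      by (simp only: fin_sums.zero)
  next
    case (add g f)
    have g: "g x \<in> carrier A" if "x \<in> K" for x
      using tensor_monomials_closed add.hyps(1) that by (auto simp: PiE_iff)
    have "(\<lambda>x\<in>K. (\<lambda>x\<in>K. g x \<otimes>\<^bsub>A\<^esub> h x) x \<oplus>\<^bsub>A\<^esub> (\<lambda>x\<in>K. f x \<otimes>\<^bsub>A\<^esub> h x) x) \<in> tensor_span E K A"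
      by (intro A.fin_sums_add[OF tensor_monomials_closed] add.IH monomial add.hyps(1))
    also have "(\<lambda>x\<in>K. (\<lambda>x\<in>K. g x \<otimes>\<^bsub>A\<^esub> h x) x \<oplus>\<^bsub>A\<^esub> (\<lambda>x\<in>K. f x \<otimes>\<^bsub>A\<^esub> h x) x)
      = (\<lambda>x\<in>K. (\<lambda>x\<in>K. g x \<oplus>\<^bsub>A\<^esub> f x) x \<otimes>\<^bsub>A\<^esub> h x)"
      using g closed[OF add.hyps(2)] closed[OF h] by (intro restrict_ext) (simp add: A.l_distr)
    finally show "(\<lambda>x\<in>K. (\<lambda>x\<in>K. g x \<oplus>\<^bsub>A\<^esub> f x) x \<otimes>\<^bsub>A\<^esub> h x) \<in> tensor_span E K A" .
  qed
qed

section \<open>Comparison of \<open>power_span\<close> with the tensor product\<close>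

lemma power_monomialsI:
  "\<lbrakk>T \<in> bounded_operators E A; 0 < n\<rbrakk> \<Longrightarrow> (\<lambda>x\<in>K. T x [^]\<^bsub>A\<^esub> (n :: nat)) \<in> power_monomials E K A"
  unfolding power_monomials_def by blast

text \<open>A complex number \<open>c\<close> has an \<open>n\<close>-th root \<open>d\<close>, and
  \<open>c\<close> times the \<open>n\<close>-th power of \<open>T\<close> is the
  \<open>n\<close>-th power of \<open>d\<close> times \<open>T\<close>. Thus scalars are absorbed
  although \<open>fin_sums\<close> has none.\<close>

lemma power_span_smult:
  assumes "f \<in> power_span E K A"
  shows "(\<lambda>x\<in>K. c \<odot>\<^bsub>A\<^esub> f x) \<in> power_span E K A"
proof (rule A.fin_sums_smult[OF power_monomials_closed assms])
  fix g assume "g \<in> power_monomials E K A"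
  then consider a where "a \<in> carrier A" "g = (\<lambda>x\<in>K. a)"
    | T n where "T \<in> bounded_operators E A" "0 < n" "g = (\<lambda>x\<in>K. T x [^]\<^bsub>A\<^esub> (n :: nat))"
    unfolding power_monomials_def by blast
  then show "(\<lambda>x\<in>K. c \<odot>\<^bsub>A\<^esub> g x) \<in> power_monomials E K A"
  proof cases
    case 1
    then have "(\<lambda>x\<in>K. c \<odot>\<^bsub>A\<^esub> g x) = (\<lambda>x\<in>K. c \<odot>\<^bsub>A\<^esub> a)" "c \<odot>\<^bsub>A\<^esub> a \<in> carrier A"
      by auto
    then show ?thesis
      unfolding power_monomials_def by blast
  next
    case 2
    obtain d where d: "d ^ n = c"
    proof (cases "c = 0")
      case True
      then show thesis
        using that[of 0] 2(2) by simp
    next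
      case False
      then show thesis
        using that[of "exp (Ln c / of_nat n)"] 2(2) by (simp flip: exp_of_nat_mult)
    qed
    have dT: "(\<lambda>x. d \<odot>\<^bsub>A\<^esub> T x) \<in> bounded_operators E A"
    proof (rule bounded_operators_compose[OF E.complex_normed_space_axioms A.complex_normed_space_axioms
          A.complex_normed_space_axioms _ 2(1)])
      show "(\<lambda>x. d \<odot>\<^bsub>A\<^esub> x) \<in> bounded_operators A A"
        by (rule bounded_operatorsI[where C = "cmod d"])
          (simp_all add: A.smult_add_right A.smult_smult mult.commute A.vnorm_smult)
    qed
    have "(\<lambda>x\<in>K. c \<odot>\<^bsub>A\<^esub> g x) = (\<lambda>x\<in>K. (d \<odot>\<^bsub>A\<^esub> T x) [^]\<^bsub>A\<^esub> n)"
      using 2 K_subset by (intro restrict_ext) (simp add: A.smult_pow d subset_iff)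
    then show ?thesis
      using power_monomialsI[OF dT 2(2)] by (simp only:)
  qed
qed

text \<open>For every \<open>t\<close>, multiplying \<open>\<phi>\<close> by the vector
  \<open>?b\<close>, which is 1 + t a, gives an operator into \<open>A\<close>. The coefficient of
  \<open>t\<close> in its \<open>n\<close>-th power is \<open>n\<close> times the given monomial,
  and \<open>n\<close> can be divided out.\<close>

lemma tensor_monomials_subset_power_span: "tensor_monomials E K A \<subseteq> power_span E K A"
proof
  fix g assume "g \<in> tensor_monomials E K A"
  then obtain \<phi> n a where g: "g = (\<lambda>x\<in>K. \<phi> x ^ n \<odot>\<^bsub>A\<^esub> a)"
    and \<phi>: "\<phi> \<in> bounded_operators E complex_alg" and a: "a \<in> carrier A"
    unfolding tensor_monomials_def by blast
  show "g \<in> power_span E K A"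
  proof (cases "n = 0")
    case True
    \<comment> \<open>In degree 0 there is no coefficient of \<open>t\<close> to extract, but the
      monomial is then a constant and hence a generator.\<close>
    then have "g = (\<lambda>x\<in>K. a)"
      using a by (auto simp: g)
    then have "g \<in> power_monomials E K A"
      unfolding power_monomials_def using a by blast
    then show ?thesis
      using A.fin_sums_superset[OF power_monomials_closed] by blast
  next
    case False
    have "(\<lambda>x\<in>K. \<phi> x ^ n \<odot>\<^bsub>A\<^esub> (of_nat (n choose 1) \<odot>\<^bsub>A\<^esub> a [^]\<^bsub>A\<^esub> (1 :: nat))) \<in> power_span E K A"
    proof (rule A.coefficients_mem[where N = "Suc n" and k = 1 and
          c = "\<lambda>i x. \<phi> x ^ n \<odot>\<^bsub>A\<^esub> (of_nat (n choose i) \<odot>\<^bsub>A\<^esub> a [^]\<^bsub>A\<^esub> i)"])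
      fix t
      let ?b = "\<one>\<^bsub>A\<^esub> \<oplus>\<^bsub>A\<^esub> t \<odot>\<^bsub>A\<^esub> a"
      have b: "?b \<in> carrier A"
        using a by simp
      have "(\<lambda>x. \<phi> x \<odot>\<^bsub>A\<^esub> ?b) \<in> bounded_operators E A"
      proof -
        interpret C: comm_unital_banach_algebra complex_alg
          by (rule comm_unital_banach_algebra_complex_alg)
        have "(\<lambda>z. z \<odot>\<^bsub>A\<^esub> ?b) \<in> bounded_operators complex_alg A"
          by (rule bounded_operatorsI[where C = "vnorm A ?b"])
            (use b in \<open>simp_all add: A.smult_add_left A.smult_smult A.vnorm_smult\<close>)
        then show ?thesis
          by (rule bounded_operators_compose[OF E.complex_normed_space_axioms
                C.complex_normed_space_axioms A.complex_normed_space_axioms _ \<phi>])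
      qed
      then have "(\<lambda>x\<in>K. (\<phi> x \<odot>\<^bsub>A\<^esub> ?b) [^]\<^bsub>A\<^esub> n) \<in> power_monomials E K A"
        using False by (intro power_monomialsI) auto
      then have "(\<lambda>x\<in>K. (\<phi> x \<odot>\<^bsub>A\<^esub> ?b) [^]\<^bsub>A\<^esub> n) \<in> power_span E K A"
        using A.fin_sums_superset[OF power_monomials_closed] by blast
      also have "(\<lambda>x\<in>K. (\<phi> x \<odot>\<^bsub>A\<^esub> ?b) [^]\<^bsub>A\<^esub> n) = (\<lambda>x\<in>K. \<Oplus>\<^bsub>A\<^esub>i\<in>{..<Suc n}.
          t ^ i \<odot>\<^bsub>A\<^esub> (\<phi> x ^ n \<odot>\<^bsub>A\<^esub> (of_nat (n choose i) \<odot>\<^bsub>A\<^esub> a [^]\<^bsub>A\<^esub> i)))"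
      proof (rule restrict_ext)
        fix x assume "x \<in> K"
        have "(\<phi> x \<odot>\<^bsub>A\<^esub> ?b) [^]\<^bsub>A\<^esub> n = \<phi> x ^ n \<odot>\<^bsub>A\<^esub>
            (\<Oplus>\<^bsub>A\<^esub>i\<in>{..<Suc n}. t ^ i \<odot>\<^bsub>A\<^esub> (of_nat (n choose i) \<odot>\<^bsub>A\<^esub> a [^]\<^bsub>A\<^esub> i))"
          using a b by (simp only: A.smult_pow A.power_one_add_smult)
        also have "\<dots> = (\<Oplus>\<^bsub>A\<^esub>i\<in>{..<Suc n}.
            \<phi> x ^ n \<odot>\<^bsub>A\<^esub> (t ^ i \<odot>\<^bsub>A\<^esub> (of_nat (n choose i) \<odot>\<^bsub>A\<^esub> a [^]\<^bsub>A\<^esub> i)))"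
          using a by (intro A.finsum_smult) auto
        also have "\<dots> = (\<Oplus>\<^bsub>A\<^esub>i\<in>{..<Suc n}.
            t ^ i \<odot>\<^bsub>A\<^esub> (\<phi> x ^ n \<odot>\<^bsub>A\<^esub> (of_nat (n choose i) \<odot>\<^bsub>A\<^esub> a [^]\<^bsub>A\<^esub> i)))"
          using a by (intro A.M.finsum_cong') (auto simp: A.smult_smult mult_ac)
        finally show "(\<phi> x \<odot>\<^bsub>A\<^esub> ?b) [^]\<^bsub>A\<^esub> n = (\<Oplus>\<^bsub>A\<^esub>i\<in>{..<Suc n}.
            t ^ i \<odot>\<^bsub>A\<^esub> (\<phi> x ^ n \<odot>\<^bsub>A\<^esub> (of_nat (n choose i) \<odot>\<^bsub>A\<^esub> a [^]\<^bsub>A\<^esub> i)))" .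
      qed
      finally show "(\<lambda>x\<in>K. \<Oplus>\<^bsub>A\<^esub>i\<in>{..<Suc n}.
          t ^ i \<odot>\<^bsub>A\<^esub> (\<phi> x ^ n \<odot>\<^bsub>A\<^esub> (of_nat (n choose i) \<odot>\<^bsub>A\<^esub> a [^]\<^bsub>A\<^esub> i))) \<in> power_span E K A" .
    qed (use a False in \<open>auto intro: power_span_smult A.fin_sums_add[OF power_monomials_closed]\<close>)
    then have "(\<lambda>x\<in>K. (1 / of_nat n) \<odot>\<^bsub>A\<^esub> (\<lambda>x\<in>K. \<phi> x ^ n \<odot>\<^bsub>A\<^esub>
        (of_nat (n choose 1) \<odot>\<^bsub>A\<^esub> a [^]\<^bsub>A\<^esub> (1 :: nat))) x) \<in> power_span E K A"
      by (rule power_span_smult)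
    moreover have "(\<lambda>x\<in>K. (1 / of_nat n) \<odot>\<^bsub>A\<^esub> (\<lambda>x\<in>K. \<phi> x ^ n \<odot>\<^bsub>A\<^esub>
        (of_nat (n choose 1) \<odot>\<^bsub>A\<^esub> a [^]\<^bsub>A\<^esub> (1 :: nat))) x) = g"
      using a False by (auto simp: g A.smult_smult fun_eq_iff)
    ultimately show ?thesis
      by (simp only:)
  qed
qed

lemma nuclear_tensor_subset_closed_polys: "nuclear_tensor E K A \<subseteq> closed_polys E K A"
proof -
  have "tensor_monomials E K A \<subseteq> uniform_closure K A (power_span E K A)"
    using tensor_monomials_subset_power_span A.uniform_closure_superset[OF power_span_closed] by blast
  then have "tensor_span E K A \<subseteq> uniform_closure K A (power_span E K A)"
    by (rule A.uniform_closure_fin_sums[OF power_monomials_closed])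
  then show ?thesis
    unfolding nuclear_tensor_eq closed_polys_eq by (rule A.uniform_closure_absorb[OF power_span_closed])
qed

lemma nuclear_tensor_const:
  assumes "a \<in> carrier A"
  shows "(\<lambda>x\<in>K. a) \<in> nuclear_tensor E K A"
proof -
  have "(\<lambda>x\<in>K. a) = (\<lambda>x\<in>K. 0 ^ 0 \<odot>\<^bsub>A\<^esub> a)"
    using assms by auto
  then have "(\<lambda>x\<in>K. a) \<in> tensor_monomials E K A"
    using tensor_monomialsI[OF zero_functional assms, of 0] by (simp only:)
  then show ?thesis
    unfolding nuclear_tensor_eq
    using A.fin_sums_superset[OF tensor_monomials_closed] A.uniform_closure_superset[OF tensor_span_closed]
    by blast
qed

lemma nuclear_tensor_pow:
  assumes f: "f \<in> nuclear_tensor E K A"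
  shows "(\<lambda>x\<in>K. f x [^]\<^bsub>A\<^esub> (n :: nat)) \<in> nuclear_tensor E K A"
proof (induction n)
  case 0
  have "(\<lambda>x\<in>K. f x [^]\<^bsub>A\<^esub> (0 :: nat)) = (\<lambda>x\<in>K. \<one>\<^bsub>A\<^esub>)"
    by simp
  then show ?case
    using nuclear_tensor_const[OF A.one_closed] by (simp only:)
next
  case (Suc n)
  have "(\<lambda>x\<in>K. (\<lambda>x\<in>K. f x [^]\<^bsub>A\<^esub> n) x \<otimes>\<^bsub>A\<^esub> f x) = (\<lambda>x\<in>K. f x [^]\<^bsub>A\<^esub> Suc n)"
    by (intro restrict_ext) simp
  moreover have "(\<lambda>x\<in>K. (\<lambda>x\<in>K. f x [^]\<^bsub>A\<^esub> n) x \<otimes>\<^bsub>A\<^esub> f x) \<in> nuclear_tensor E K A"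
    using Suc f tensor_span_mult unfolding nuclear_tensor_eq
    by (intro uniform_closure_mult tensor_span_bounded_lipschitz)
  ultimately show ?case
    by (simp only:)
qed

lemma closed_polys_subset_nuclear_tensor:
  assumes id: "(\<lambda>x\<in>K. x) \<in> nuclear_tensor E K E"
  shows "closed_polys E K A \<subseteq> nuclear_tensor E K A"
proof -
  \<comment> \<open>\<open>E\<close> is also taken as the space of values here, because
    \<open>T\<close> is written as the composition of \<open>T\<close> with the identity on
    \<open>K\<close>.\<close>
  interpret EE: compact_pair E E K
    by unfold_locales (rule compact)
  have T: "(\<lambda>x\<in>K. T x) \<in> nuclear_tensor E K A" if "T \<in> bounded_operators E A" for T
  proof -
    have "(\<lambda>x\<in>K. T ((\<lambda>x\<in>K. x) x)) = (\<lambda>x\<in>K. T x)"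
      by auto
    then show ?thesis
      using EE.nuclear_tensor_image[OF A.complex_normed_space_axioms that id] by (simp only:)
  qed
  have "(\<lambda>x\<in>K. T x [^]\<^bsub>A\<^esub> n) \<in> nuclear_tensor E K A" if "T \<in> bounded_operators E A" for T and n :: nat
  proof -
    have "(\<lambda>x\<in>K. (\<lambda>x\<in>K. T x) x [^]\<^bsub>A\<^esub> n) = (\<lambda>x\<in>K. T x [^]\<^bsub>A\<^esub> n)"
      by auto
    then show ?thesis
      using nuclear_tensor_pow[OF T[OF that], of n] by (simp only:)
  qed
  then have "power_monomials E K A \<subseteq> nuclear_tensor E K A"
    using nuclear_tensor_const unfolding power_monomials_def by blast
  then have "power_span E K A \<subseteq> nuclear_tensor E K A"
    unfolding nuclear_tensor_eq by (rule A.uniform_closure_fin_sums[OF tensor_monomials_closed])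
  then show ?thesis
    unfolding nuclear_tensor_eq closed_polys_eq by (rule A.uniform_closure_absorb[OF tensor_span_closed])
qed

lemma operator_closed_polys:
  assumes "T \<in> bounded_operators E A"
  shows "(\<lambda>x\<in>K. T x) \<in> closed_polys E K A"
proof -
  have "(\<lambda>x\<in>K. T x) = (\<lambda>x\<in>K. T x [^]\<^bsub>A\<^esub> (1 :: nat))"
    using assms K_subset by (intro restrict_ext) (simp add: subset_iff)
  then have "(\<lambda>x\<in>K. T x) \<in> power_monomials E K A"
    using power_monomialsI[OF assms zero_less_one] by (simp only:)
  then show ?thesis
    unfolding closed_polys_eq
    using A.fin_sums_superset[OF power_monomials_closed] A.uniform_closure_superset[OF power_span_closed]
    by blast
qed

end

section \<open>The Banach algebra structure on a Banach space\<close>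

locale pointed_banach_space = complex_banach_space E
  for E :: "(complex, 'a) normed_module" (structure) +
  fixes \<psi> :: "'a \<Rightarrow> complex" and e :: 'a
  assumes functional: "\<psi> \<in> bounded_operators E complex_alg"
    and e_closed [simp]: "e \<in> carrier E"
    and functional_e [simp]: "\<psi> e = 1"
begin

abbreviation \<kappa> :: "'a \<Rightarrow> 'a"
  where "\<kappa> \<equiv> kernel_part E \<psi> e"

abbreviation B :: "(complex, 'a) normed_module"
  where "B \<equiv> banach_algebra_on E \<psi> e"

lemma functional_add [simp]:
  "\<lbrakk>x \<in> carrier E; y \<in> carrier E\<rbrakk> \<Longrightarrow> \<psi> (x \<oplus> y) = \<psi> x + \<psi> y"
  using bounded_operators_add[OF functional] by simp

lemma functional_smult [simp]: "x \<in> carrier E \<Longrightarrow> \<psi> (c \<odot> x) = c * \<psi> x"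
  using bounded_operators_smult[OF functional] by simp

lemma functional_zero [simp]: "\<psi> \<zero> = 0"
  using functional_smult[of \<zero> 0] by simp

lemma kernel_part_eq: "x \<in> carrier E \<Longrightarrow> \<kappa> x = x \<oplus> (- \<psi> x) \<odot> e"
proof -
  have "\<ominus> (\<psi> x \<odot> e) = (- \<psi> x) \<odot> e"
    by (simp add: smult_smult flip: smult_minus1)
  then show ?thesis
    by (simp add: kernel_part_def a_minus_def)
qed

lemma kernel_part_closed [simp]: "x \<in> carrier E \<Longrightarrow> \<kappa> x \<in> carrier E"
  by (simp add: kernel_part_eq)

lemma functional_kernel_part [simp]: "x \<in> carrier E \<Longrightarrow> \<psi> (\<kappa> x) = 0"
  by (simp add: kernel_part_eq)

lemma kernel_part_decomp: "x \<in> carrier E \<Longrightarrow> \<kappa> x \<oplus> \<psi> x \<odot> e = x"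
  by (simp add: kernel_part_def minus_add_cancel)

lemma kernel_part_add [simp]:
  "\<lbrakk>x \<in> carrier E; y \<in> carrier E\<rbrakk> \<Longrightarrow> \<kappa> (x \<oplus> y) = \<kappa> x \<oplus> \<kappa> y"
  using smult_add_left[of e "- \<psi> x" "- \<psi> y"] by (simp add: kernel_part_eq M.a_ac)

lemma kernel_part_smult [simp]: "x \<in> carrier E \<Longrightarrow> \<kappa> (c \<odot> x) = c \<odot> \<kappa> x"
  by (simp add: kernel_part_eq smult_add_right smult_smult)

lemma kernel_part_idem [simp]: "x \<in> carrier E \<Longrightarrow> \<kappa> (\<kappa> x) = \<kappa> x"
  using kernel_part_eq[of "\<kappa> x"] by simp

lemma kernel_part_e [simp]: "\<kappa> e = \<zero>"
  by (simp add: kernel_part_def)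

text \<open>The algebra laws of \<open>B\<close> are checked on these two components. There
  \<open>\<psi>\<close> is multiplicative and \<open>\<kappa>\<close> satisfies a product rule,
  \<open>\<kappa> (x y) = \<psi> y \<kappa> x + \<psi> x \<kappa> y\<close>, so each law becomes an
  identity in the module \<open>E\<close>.\<close>

lemma eqI_functional_kernel_part:
  "\<lbrakk>x \<in> carrier E; y \<in> carrier E; \<psi> x = \<psi> y; \<kappa> x = \<kappa> y\<rbrakk> \<Longrightarrow> x = y"
  by (metis kernel_part_decomp)

lemma B_simps [simp]:
  "carrier B = carrier E" "\<zero>\<^bsub>B\<^esub> = \<zero>" "\<one>\<^bsub>B\<^esub> = e" "(\<oplus>\<^bsub>B\<^esub>) = (\<oplus>)" "(\<odot>\<^bsub>B\<^esub>) = (\<odot>)"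
  by (simp_all add: banach_algebra_on_def)

lemma vnorm_B: "vnorm B x = cmod (\<psi> x) + vnorm E (\<kappa> x)"
  by (simp add: banach_algebra_on_def)

lemma mult_B: "x \<otimes>\<^bsub>B\<^esub> y = \<psi> y \<odot> \<kappa> x \<oplus> \<psi> x \<odot> \<kappa> y \<oplus> (\<psi> x * \<psi> y) \<odot> e"
  by (simp add: banach_algebra_on_def)

lemma mult_B_closed [simp]: "\<lbrakk>x \<in> carrier E; y \<in> carrier E\<rbrakk> \<Longrightarrow> x \<otimes>\<^bsub>B\<^esub> y \<in> carrier E"
  by (simp add: mult_B)

lemma functional_mult_B [simp]:
  "\<lbrakk>x \<in> carrier E; y \<in> carrier E\<rbrakk> \<Longrightarrow> \<psi> (x \<otimes>\<^bsub>B\<^esub> y) = \<psi> x * \<psi> y"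
  by (simp add: mult_B)

lemma kernel_part_mult_B [simp]:
  "\<lbrakk>x \<in> carrier E; y \<in> carrier E\<rbrakk> \<Longrightarrow> \<kappa> (x \<otimes>\<^bsub>B\<^esub> y) = \<psi> y \<odot> \<kappa> x \<oplus> \<psi> x \<odot> \<kappa> y"
  by (simp add: mult_B)

lemma algebra_B: "algebra complex_ring B"
proof (rule algebraI)
  show "cring complex_ring"
    by (rule R.is_cring)
  have "abelian_group B"
  proof (rule abelian_groupI)
    fix x assume "x \<in> carrier B"
    then show "\<exists>y\<in>carrier B. y \<oplus>\<^bsub>B\<^esub> x = \<zero>\<^bsub>B\<^esub>"
      by (intro bexI[of _ "\<ominus> x"]) (simp_all add: M.l_neg)
  qed (simp_all add: M.a_ac)
  moreover have "comm_monoid B"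
  proof (rule comm_monoidI)
    fix x y z assume "x \<in> carrier B" "y \<in> carrier B" "z \<in> carrier B"
    then show "(x \<otimes>\<^bsub>B\<^esub> y) \<otimes>\<^bsub>B\<^esub> z = x \<otimes>\<^bsub>B\<^esub> (y \<otimes>\<^bsub>B\<^esub> z)"
      by - (rule eqI_functional_kernel_part, simp_all add: M.a_ac smult_add_right smult_smult mult_ac)
  next
    fix x y assume "x \<in> carrier B" "y \<in> carrier B"
    then show "x \<otimes>\<^bsub>B\<^esub> y = y \<otimes>\<^bsub>B\<^esub> x"
      by - (rule eqI_functional_kernel_part, simp_all add: M.a_comm mult.commute)
  next
    fix x assume "x \<in> carrier B"
    then show "\<one>\<^bsub>B\<^esub> \<otimes>\<^bsub>B\<^esub> x = x"
      by - (rule eqI_functional_kernel_part, simp_all)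
  qed simp_all
  ultimately show "cring B"
  proof (rule cringI)
    fix x y z assume "x \<in> carrier B" "y \<in> carrier B" "z \<in> carrier B"
    then show "(x \<oplus>\<^bsub>B\<^esub> y) \<otimes>\<^bsub>B\<^esub> z = x \<otimes>\<^bsub>B\<^esub> z \<oplus>\<^bsub>B\<^esub> y \<otimes>\<^bsub>B\<^esub> z"
      by - (rule eqI_functional_kernel_part, simp_all add: smult_add_right smult_add_left M.a_ac distrib_right)
  qed
  fix c x y assume "x \<in> carrier B" "y \<in> carrier B"
  then show "(c \<odot>\<^bsub>B\<^esub> x) \<otimes>\<^bsub>B\<^esub> y = c \<odot>\<^bsub>B\<^esub> (x \<otimes>\<^bsub>B\<^esub> y)"
    by - (rule eqI_functional_kernel_part, simp_all add: smult_add_right smult_smult mult_ac)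
qed (simp_all add: smult_add_left smult_add_right smult_smult complex_ring_one)

lemma complex_normed_space_B: "complex_normed_space B"
proof -
  interpret B: algebra complex_ring B
    by (rule algebra_B)
  show ?thesis
  proof (intro complex_normed_space.intro complex_normed_space_axioms.intro)
    show "module complex_ring B"
      by (rule B.module)
  next
    fix x assume x: "x \<in> carrier B"
    then show "vnorm B x = 0 \<longleftrightarrow> x = \<zero>\<^bsub>B\<^esub>"
      \<comment> \<open>The instance with scalar 0 yields that \<open>\<kappa>\<close> maps zero to
        zero, as needed for the norm of zero.\<close>
      using kernel_part_smult[of \<zero> 0] eqI_functional_kernel_part[of x \<zero>]
      by (auto simp: vnorm_B add_nonneg_eq_0_iff vnorm_eq_zero)
    show "vnorm B (c \<odot>\<^bsub>B\<^esub> x) = cmod c * vnorm B x" for c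
      using x by (simp add: vnorm_B vnorm_smult norm_mult distrib_left)
  next
    fix x y assume "x \<in> carrier B" "y \<in> carrier B"
    then show "vnorm B (x \<oplus>\<^bsub>B\<^esub> y) \<le> vnorm B x + vnorm B y"
      using norm_triangle_ineq[of "\<psi> x" "\<psi> y"] vnorm_triangle[of "\<kappa> x" "\<kappa> y"]
      by (simp add: vnorm_B)
  qed
qed

text \<open>Continuity of \<open>\<psi>\<close> controls both parts of the new norm:
  \<open>\<psi> x\<close> directly, and \<open>\<kappa> x\<close> as the difference of
  \<open>x\<close> and a multiple of \<open>e\<close>. Together with \<open>id_from_B\<close> this
  is the equivalence of the two norms.\<close>

lemma id_to_B: "(\<lambda>x. x) \<in> bounded_operators E B"
proof -
  obtain C where C: "C > 0" "\<And>x. x \<in> carrier E \<Longrightarrow> cmod (\<psi> x) \<le> C * vnorm E x"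
    using bounded_operators_bound[OF complex_normed_space_axioms functional] by auto
  show ?thesis
  proof (rule bounded_operatorsI)
    fix x assume x: "x \<in> carrier E"
    have "vnorm E (\<kappa> x) \<le> vnorm E x + cmod (\<psi> x) * vnorm E e"
      using x vnorm_diff_triangle[of x "\<psi> x \<odot> e"] by (simp add: kernel_part_def vnorm_smult)
    also have "\<dots> \<le> vnorm E x + (C * vnorm E x) * vnorm E e"
      using C(2)[OF x] by (intro add_mono mult_right_mono) auto
    finally show "vnorm B x \<le> (C + 1 + C * vnorm E e) * vnorm E x"
      using C(2)[OF x] by (simp add: vnorm_B algebra_simps)
  qed auto
qed

lemma id_from_B: "(\<lambda>x. x) \<in> bounded_operators B E"
proof (rule bounded_operatorsI)
  fix x assume "x \<in> carrier B"
  then have x: "x \<in> carrier E"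
    by simp
  have "vnorm E x \<le> vnorm E (\<kappa> x) + cmod (\<psi> x) * vnorm E e"
    using x vnorm_triangle[of "\<kappa> x" "\<psi> x \<odot> e"] by (simp add: kernel_part_decomp vnorm_smult)
  also have "\<dots> \<le> (1 + vnorm E e) * vnorm B x"
    using x by (simp add: vnorm_B algebra_simps)
  finally show "vnorm E x \<le> (1 + vnorm E e) * vnorm B x" .
qed auto

lemma comm_unital_banach_algebra_B: "comm_unital_banach_algebra B"
proof (rule comm_unital_banach_algebraI[OF complex_normed_space_B algebra_B])
  show "mcomplete_of (norm_metric B)"
    by (rule mcomplete_of_transfer[OF complex_normed_space_axioms complex_normed_space_B
          id_from_B id_to_B refl complete])
  show "vnorm B \<one>\<^bsub>B\<^esub> = 1"
    by (simp add: vnorm_B)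
next
  fix x y assume "x \<in> carrier B" "y \<in> carrier B"
  then have xy: "x \<in> carrier E" "y \<in> carrier E"
    by simp_all
  have "vnorm E (\<kappa> (x \<otimes>\<^bsub>B\<^esub> y)) \<le> cmod (\<psi> y) * vnorm E (\<kappa> x) + cmod (\<psi> x) * vnorm E (\<kappa> y)"
    using xy vnorm_triangle[of "\<psi> y \<odot> \<kappa> x" "\<psi> x \<odot> \<kappa> y"] by (simp add: vnorm_smult)
  \<comment> \<open>This is the surplus in the product of the two norms: the product of the kernel
    parts is absent from \<open>x y\<close> because the kernel of \<open>\<psi>\<close> squares to
    zero.\<close>
  moreover have "0 \<le> vnorm E (\<kappa> x) * vnorm E (\<kappa> y)"
    using xy by simp
  moreover have "vnorm B (x \<otimes>\<^bsub>B\<^esub> y) = cmod (\<psi> x) * cmod (\<psi> y) + vnorm E (\<kappa> (x \<otimes>\<^bsub>B\<^esub> y))"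
    using xy by (simp add: vnorm_B norm_mult)
  moreover have "vnorm B x * vnorm B y = cmod (\<psi> x) * cmod (\<psi> y) + cmod (\<psi> y) * vnorm E (\<kappa> x)
      + cmod (\<psi> x) * vnorm E (\<kappa> y) + vnorm E (\<kappa> x) * vnorm E (\<kappa> y)"
    by (simp add: vnorm_B algebra_simps)
  ultimately show "vnorm B (x \<otimes>\<^bsub>B\<^esub> y) \<le> vnorm B x * vnorm B y"
    by linarith
qed

end

text \<open>
  The copy provides an algebra whose elements have the type over which the quantifier of
  statement (i) ranges.
\<close>

definition Inl_copy :: "(complex, 'a) normed_module \<Rightarrow> (complex, 'a + 'b) normed_module"
  where "Inl_copy A =
    \<lparr>carrier = Inl ` carrier A, mult = (\<lambda>x y. Inl (projl x \<otimes>\<^bsub>A\<^esub> projl y)), one = Inl \<one>\<^bsub>A\<^esub>,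
     zero = Inl \<zero>\<^bsub>A\<^esub>, add = (\<lambda>x y. Inl (projl x \<oplus>\<^bsub>A\<^esub> projl y)),
     smult = (\<lambda>c x. Inl (c \<odot>\<^bsub>A\<^esub> projl x)), vnorm = (\<lambda>x. vnorm A (projl x))\<rparr>"

lemma Inl_copy_simps [simp]:
  "carrier (Inl_copy A) = Inl ` carrier A"
  "\<one>\<^bsub>Inl_copy A\<^esub> = Inl \<one>\<^bsub>A\<^esub>" "\<zero>\<^bsub>Inl_copy A\<^esub> = Inl \<zero>\<^bsub>A\<^esub>"
  "x \<otimes>\<^bsub>Inl_copy A\<^esub> y = Inl (projl x \<otimes>\<^bsub>A\<^esub> projl y)"
  "x \<oplus>\<^bsub>Inl_copy A\<^esub> y = Inl (projl x \<oplus>\<^bsub>A\<^esub> projl y)"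
  "c \<odot>\<^bsub>Inl_copy A\<^esub> x = Inl (c \<odot>\<^bsub>A\<^esub> projl x)"
  "vnorm (Inl_copy A) x = vnorm A (projl x)"
  by (simp_all add: Inl_copy_def)

lemma Inl_bounded_operator: "Inl \<in> bounded_operators A (Inl_copy A)"
  by (rule bounded_operatorsI[where C = 1]) auto

lemma projl_bounded_operator: "projl \<in> bounded_operators (Inl_copy A) A"
  by (rule bounded_operatorsI[where C = 1]) auto

lemma comm_unital_banach_algebra_Inl_copy:
  assumes "comm_unital_banach_algebra A"
  shows "comm_unital_banach_algebra (Inl_copy A :: (complex, 'a + 'b) normed_module)"
proof -
  interpret comm_unital_banach_algebra A by fact
  let ?C = "Inl_copy A :: (complex, 'a + 'b) normed_module"
  have alg: "algebra complex_ring ?C"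
  proof (rule algebraI)
    show "cring complex_ring"
      by (rule R_cring)
    have "abelian_group ?C"
    proof (rule abelian_groupI)
      fix x assume "x \<in> carrier ?C"
      then show "\<exists>y\<in>carrier ?C. y \<oplus>\<^bsub>?C\<^esub> x = \<zero>\<^bsub>?C\<^esub>"
        by (auto simp: M.l_neg intro: M.a_inv_closed)
    qed (auto simp: M.a_ac)
    moreover have "comm_monoid ?C"
      by (rule comm_monoidI) (auto simp: m_ac)
    ultimately show "cring ?C"
      by (rule cringI) (auto simp: l_distr)
  qed (auto simp: smult_add_left smult_add_right smult_smult smult_mult_left complex_ring_one)
  interpret C: algebra complex_ring ?C
    by (rule alg)
  have normed: "complex_normed_space ?C"
    by (intro complex_normed_space.intro complex_normed_space_axioms.intro C.module)
      (auto simp: vnorm_eq_zero vnorm_triangle vnorm_smult)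
  show ?thesis
  proof (rule comm_unital_banach_algebraI[OF normed alg])
    show "mcomplete_of (norm_metric ?C)"
      by (rule mcomplete_of_transfer[OF complex_normed_space_axioms normed
            projl_bounded_operator Inl_bounded_operator _ complete]) auto
  qed (auto simp: vnorm_mult vnorm_one)
qed

section \<open>The equivalence of the three statements\<close>

theorem theorem2p4:
  fixes E :: "(complex, 'e) normed_module" and K :: "'e set"
    and \<psi> :: "'e \<Rightarrow> complex" and e :: 'e
  assumes "complex_banach_space E" and "carrier E \<noteq> {\<zero>\<^bsub>E\<^esub>}"
    and "compactin (norm_topology E) K"
    and "\<psi> \<in> bounded_operators E complex_alg"
    and "e \<in> carrier E" and "vnorm E e = 1" and "\<psi> e = 1"
  shows
    "((\<forall>A :: (complex, 'e + 'u) normed_module.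
         comm_unital_banach_algebra A \<longrightarrow> closed_polys E K A = nuclear_tensor E K A)
       \<longleftrightarrow> closed_polys E K (banach_algebra_on E \<psi> e) = nuclear_tensor E K E)
     \<and> (closed_polys E K (banach_algebra_on E \<psi> e) = nuclear_tensor E K E
       \<longleftrightarrow> (\<lambda>x\<in>K. x) \<in> nuclear_tensor E K E)"
proof -
  let ?B = "banach_algebra_on E \<psi> e"
  let ?C = "Inl_copy ?B :: (complex, 'e + 'u) normed_module"
  interpret E: complex_banach_space E by fact
  interpret E: pointed_banach_space E \<psi> e
    by unfold_locales (use assms in auto)
  note normed = E.complex_normed_space_axioms
  note B = E.comm_unital_banach_algebra_B
  note C = comm_unital_banach_algebra_Inl_copy[OF B, where 'b = 'u]
  interpret EE: compact_pair E E K
    by (intro compact_pair.intro compact_pair_axioms.intro normed assms(3))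
  interpret EB: compact_pair_algebra E ?B K
    by (intro compact_pair_algebra.intro compact_pair_algebra_axioms.intro normed assms(3) B)
  interpret EC: compact_pair_algebra E ?C K
    by (intro compact_pair_algebra.intro compact_pair_algebra_axioms.intro normed assms(3) C)
  \<comment> \<open>Statement (ii) takes polynomials with values in \<open>?B\<close> but the tensor
    product with the original norm of \<open>E\<close>. The identity is bounded in both directions,
    so either norm gives the same functions.\<close>
  have tensor_B: "nuclear_tensor E K ?B = nuclear_tensor E K E"
  proof (intro equalityI subsetI)
    fix f assume f: "f \<in> nuclear_tensor E K ?B"
    \<comment> \<open>\<open>nuclear_tensor_image\<close> returns a function restricted to
      \<open>K\<close>; an extensional function is not changed by that.\<close>
    then have "(\<lambda>x\<in>K. f x) = f"
      using EB.A.uniform_closure_closed unfolding EB.nuclear_tensor_eq by (intro extensional_restrict) (auto simp: PiE_iff)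
    then show "f \<in> nuclear_tensor E K E"
      using EB.nuclear_tensor_image[OF normed E.id_from_B f] by (simp only:)
  next
    fix f assume f: "f \<in> nuclear_tensor E K E"
    then have "(\<lambda>x\<in>K. f x) = f"
      using E.uniform_closure_closed unfolding EE.nuclear_tensor_eq by (intro extensional_restrict) (auto simp: PiE_iff)
    then show "f \<in> nuclear_tensor E K ?B"
      using EE.nuclear_tensor_image[OF E.complex_normed_space_B E.id_to_B f] by (simp only:)
  qed
  have iii_i: "closed_polys E K A = nuclear_tensor E K A"
    if "(\<lambda>x\<in>K. x) \<in> nuclear_tensor E K E" "comm_unital_banach_algebra A"
    for A :: "(complex, 'e + 'u) normed_module"
  proof -
    interpret compact_pair_algebra E A K
      by (intro compact_pair_algebra.intro compact_pair_algebra_axioms.intro normed assms(3) that(2))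
    show ?thesis
      using nuclear_tensor_subset_closed_polys closed_polys_subset_nuclear_tensor[OF that(1)] by blast
  qed
  have iii_ii: "closed_polys E K ?B = nuclear_tensor E K E" if "(\<lambda>x\<in>K. x) \<in> nuclear_tensor E K E"
    using EB.nuclear_tensor_subset_closed_polys EB.closed_polys_subset_nuclear_tensor[OF that] tensor_B
    by blast
  have ii_iii: "(\<lambda>x\<in>K. x) \<in> nuclear_tensor E K E" if "closed_polys E K ?B = nuclear_tensor E K E"
    using EB.operator_closed_polys[OF E.id_to_B] that by simp
  \<comment> \<open>Statement (i) is applied to the copy \<open>?C\<close>, since \<open>?B\<close>
    has elements of type \<open>'e\<close> instead of \<open>'e + 'u\<close>. The embedding
    \<open>Inl\<close> is an operator from \<open>E\<close> into \<open>?C\<close>, hence one of its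
    polynomials and by (i) in the tensor product; \<open>projl\<close> then turns it into the
    identity of \<open>E\<close>.\<close>
  have i_iii: "(\<lambda>x\<in>K. x) \<in> nuclear_tensor E K E" if "closed_polys E K ?C = nuclear_tensor E K ?C"
  proof -
    have "(\<lambda>x. Inl x) \<in> bounded_operators E ?C"
      by (rule bounded_operators_compose[OF normed E.complex_normed_space_B EC.A.complex_normed_space_axioms
            Inl_bounded_operator E.id_to_B])
    then have "(\<lambda>x\<in>K. Inl x) \<in> nuclear_tensor E K ?C"
      using EC.operator_closed_polys that by blast
    moreover have "(\<lambda>y. projl y) \<in> bounded_operators ?C E"
      by (rule bounded_operators_compose[OF EC.A.complex_normed_space_axioms E.complex_normed_space_B normed
            E.id_from_B projl_bounded_operator])
    ultimately have "(\<lambda>x\<in>K. projl ((\<lambda>x\<in>K. Inl x :: 'e + 'u) x)) \<in> nuclear_tensor E K E"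
      using EC.nuclear_tensor_image[OF normed] by blast
    moreover have "(\<lambda>x\<in>K. projl ((\<lambda>x\<in>K. Inl x :: 'e + 'u) x)) = (\<lambda>x\<in>K. x)"
      by (intro restrict_ext) simp
    ultimately show ?thesis
      by (simp only:)
  qed
  show ?thesis
    using iii_i iii_ii ii_iii i_iii[OF] C by blast
qed

end
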